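(* The trivial extension $T(A_L)$ of a pedigree algebra $A_L$ (of a pedigree $L$ with at least two points) is isomorphic to a Brauer-quiver algebra, and any Brauer-quiver algebra $B(Q)$ ($Q$ a Brauer-quiver with at least two points) is isomorphic to $T(A_L)$ for some pedigree $L$.
   Context: $k$ is an algebraically closed field; paths are composed from right to left. Pedigrees: define oriented trees $T(m)$ recursively. $T(0)$ is one point $\omega$. $T(m+1)$ is obtained from $T(m)$ by adding to each leaf $x$ (for $m=0$: to $x=\omega$; for $m\geq1$: to each of the $2^m$ points added last) two new points $x',x''$ and two arrows $\beta_x:x'\to x$ and $\alpha_x:x\to x''$. A pedigree $L$ is a subtree of some $T(m)$ containing the root $\omega$. The pedigree algebra $A_L$ is the path algebra $kL$ modulo all zero relations $\alpha_x\beta_x=0$ for points $x$ such that both arrows $\alpha_x,\beta_x$ lie in $L$. The trivial extension of a finite-dimensional algebra $B$ is $T(B)=B\oplus DB$ with $D=\mathrm{Hom}_k(-,k)$ and multiplication $(g,n)(f,m)=(gf,gm+nf)$. A cycle of length $n\ge1$ in a quiver is a closed path of length $n$ leading through $n$ distinct points (up to the choice of the starting point); loops are cycles of length 1. A Brauer-quiver $Q$ is a finite connected quiver such that each arrow occurs in a cycle, each point belongs to (exactly) two cycles, and two cycles have at most one point in common. For a point $x$ in a cycle $Z$, $\zeta(x,Z)$ denotes the path running once through $Z$ starting and ending in $x$. The Brauer-quiver algebra $B(Q)$ is the quotient of $kQ$ by the relations: every path of length two not lying on a cycle (i.e. composed of arrows of two different cycles) is zero, and $\zeta(x,Z)=\zeta(x,Z')$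 for each point $x$, where $Z,Z'$ are the two cycles containing $x$. (The quiver of the algebra $B(Q)$ is obtained from $Q$ by removing the loops.) *)

theory Defs
  imports
    "HOL-Library.Poly_Mapping"
    "HOL-Computational_Algebra.Polynomial"
    "HOL-Algebra.QuotRing"
    "HOL-Algebra.Module"
    "Graph_Theory.Graph_Theory"
begin

section \<open>Algebras over a field\<close>

text \<open>
  A (not necessarily commutative) algebra over the field \<open>'k\<close> is represented by a record of type
  \<open>('k, 'a) module\<close>, which carries a ring structure together with a scalar multiplication.
\<close>

definition alg_isomorphic ::
  "('k::field, 'a) module \<Rightarrow> ('k, 'b) module \<Rightarrow> bool"
  where "alg_isomorphic A B \<longleftrightarrow>
    (\<exists>h \<in> ring_iso A B. \<forall>c. \<forall>x \<in> carrier A. h (c \<odot>\<^bsub>A\<^esub> x) = c \<odot>\<^bsub>B\<^esub> h x)"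

definition alg_quot :: "('k::field, 'a) module \<Rightarrow> 'a set \<Rightarrow> ('k, 'a set) module"
  where "alg_quot A I =
    ring.extend (A Quot I) (module.fields (\<lambda>c X. \<Union>x\<in>X. I +>\<^bsub>A\<^esub> (c \<odot>\<^bsub>A\<^esub> x)))"

definition alg_dual :: "('k::field, 'a) module \<Rightarrow> ('a \<Rightarrow> 'k) set"
  where "alg_dual B = {\<phi> \<in> extensional (carrier B).
    (\<forall>x \<in> carrier B. \<forall>y \<in> carrier B. \<phi> (x \<oplus>\<^bsub>B\<^esub> y) = \<phi> x + \<phi> y) \<and>
    (\<forall>c. \<forall>x \<in> carrier B. \<phi> (c \<odot>\<^bsub>B\<^esub> x) = c * \<phi> x)}"

text \<open>
  The product is \<open>(g, n) (f, m) = (g f, g m + n f)\<close>, where the bimodule structure of the dual is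
  \<open>(g m) x = m (x g)\<close> and \<open>(n f) x = n (f x)\<close>.
\<close>

definition trivial_extension ::
  "('k::field, 'a) module \<Rightarrow> ('k, 'a \<times> ('a \<Rightarrow> 'k)) module"
  where "trivial_extension B =
    \<lparr>carrier = carrier B \<times> alg_dual B,
     mult = (\<lambda>(g, n) (f, m).
       (g \<otimes>\<^bsub>B\<^esub> f, \<lambda>x\<in>carrier B. m (x \<otimes>\<^bsub>B\<^esub> g) + n (f \<otimes>\<^bsub>B\<^esub> x))),
     one = (\<one>\<^bsub>B\<^esub>, \<lambda>x\<in>carrier B. 0),
     zero = (\<zero>\<^bsub>B\<^esub>, \<lambda>x\<in>carrier B. 0),
     add = (\<lambda>(g, n) (f, m). (g \<oplus>\<^bsub>B\<^esub> f, \<lambda>x\<in>carrier B. n x + m x)),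
     smult = (\<lambda>c (f, m). (c \<odot>\<^bsub>B\<^esub> f, \<lambda>x\<in>carrier B. c * m x))\<rparr>"


section \<open>Path algebras\<close>

text \<open>
  A path is a triple \<open>(u, p, v)\<close> of its start point, the list of its arrows in the order in which
  they are traversed, and its end point; \<open>(u, [], u)\<close> is the trivial path at \<open>u\<close>. In the product
  \<open>q p\<close> the path \<open>p\<close> is traversed first. Thus, the path usually written \<open>\<alpha>\<beta>\<close> has the arrow list
  \<open>[\<beta>, \<alpha>]\<close>.
\<close>

type_synonym ('v, 'a) path = "'v \<times> 'a list \<times> 'v"

definition quiver_paths :: "('v, 'a) pre_digraph \<Rightarrow> ('v, 'a) path set"
  where "quiver_paths Q = {(u, p, v). pre_digraph.awalk Q u p v}"

definition basis_mult ::
  "('v, 'a) path \<Rightarrow> ('v, 'a) path \<Rightarrow> 'k \<Rightarrow> ('v, 'a) path \<Rightarrow>\<^sub>0 'k::field"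
  where "basis_mult = (\<lambda>(v', q, w) (u, p, v) c.
    if v' = v then Poly_Mapping.single (u, p @ q, w) c else 0)"

definition path_mult ::
  "(('v, 'a) path \<Rightarrow>\<^sub>0 'k) \<Rightarrow> (('v, 'a) path \<Rightarrow>\<^sub>0 'k) \<Rightarrow> ('v, 'a) path \<Rightarrow>\<^sub>0 'k::field"
  where "path_mult f g =
    (\<Sum>q\<in>Poly_Mapping.keys f. \<Sum>p\<in>Poly_Mapping.keys g.
       basis_mult q p (Poly_Mapping.lookup f q * Poly_Mapping.lookup g p))"

definition path_algebra ::
  "('v, 'a) pre_digraph \<Rightarrow> ('k::field, ('v, 'a) path \<Rightarrow>\<^sub>0 'k) module"
  where "path_algebra Q =
    \<lparr>carrier = {f. Poly_Mapping.keys f \<subseteq> quiver_paths Q},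
     mult = path_mult,
     one = (\<Sum>v\<in>verts Q. Poly_Mapping.single (v, [], v) 1),
     zero = 0,
     add = (+),
     smult = (\<lambda>c. Poly_Mapping.map ((*) c))\<rparr>"

definition bound_quiver_algebra ::
  "('v, 'a) pre_digraph \<Rightarrow> (('v, 'a) path \<Rightarrow>\<^sub>0 'k) set
    \<Rightarrow> ('k::field, (('v, 'a) path \<Rightarrow>\<^sub>0 'k) set) module"
  where "bound_quiver_algebra Q R =
    alg_quot (path_algebra Q) (genideal (path_algebra Q) R)"


section \<open>Pedigrees\<close>

text \<open>\<open>Beta_End x\<close> and \<open>Alpha_End x\<close> are the points \<open>x'\<close> and \<open>x''\<close>.\<close>

datatype ped_point = Omega | Beta_End ped_point | Alpha_End ped_point

datatype ped_arrow = Alpha ped_point | Beta ped_point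

fun ped_tail :: "ped_arrow \<Rightarrow> ped_point" where
  "ped_tail (Alpha x) = x"
| "ped_tail (Beta x) = Beta_End x"

fun ped_head :: "ped_arrow \<Rightarrow> ped_point" where
  "ped_head (Alpha x) = Alpha_End x"
| "ped_head (Beta x) = x"

primrec ped_leaves :: "nat \<Rightarrow> ped_point set" where
  "ped_leaves 0 = {Omega}"
| "ped_leaves (Suc m) = (\<Union>x\<in>ped_leaves m. {Beta_End x, Alpha_End x})"

primrec ped_tree :: "nat \<Rightarrow> (ped_point, ped_arrow) pre_digraph" where
  "ped_tree 0 = \<lparr>verts = {Omega}, arcs = {}, tail = ped_tail, head = ped_head\<rparr>"
| "ped_tree (Suc m) =
    \<lparr>verts = verts (ped_tree m) \<union> (\<Union>x\<in>ped_leaves m. {Beta_End x, Alpha_End x}),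
     arcs = arcs (ped_tree m) \<union> (\<Union>x\<in>ped_leaves m. {Beta x, Alpha x}),
     tail = ped_tail, head = ped_head\<rparr>"

text \<open>
  A subtree of a tree is a connected subgraph. The predicate \<open>Digraph_Component.tree\<close> only
  excludes oriented cycles in addition to connectedness, so it is not the relevant notion for the
  underlying unoriented graph. \<open>Digraph_Component.connected\<close> does refer to the underlying
  unoriented graph, and implies non-emptiness.
\<close>

definition pedigree :: "(ped_point, ped_arrow) pre_digraph \<Rightarrow> bool"
  where "pedigree L \<longleftrightarrow>
    (\<exists>m. subgraph L (ped_tree m)) \<and> Digraph_Component.connected L \<and> Omega \<in> verts L"

definition pedigree_relations ::
  "(ped_point, ped_arrow) pre_digraph \<Rightarrow> ((ped_point, ped_arrow) path \<Rightarrow>\<^sub>0 'k::field) set"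
  where "pedigree_relations L =
    {Poly_Mapping.single (Beta_End x, [Beta x, Alpha x], Alpha_End x) 1 | x.
       x \<in> verts L \<and> Alpha x \<in> arcs L \<and> Beta x \<in> arcs L}"

definition pedigree_algebra ::
  "'k::field itself \<Rightarrow> (ped_point, ped_arrow) pre_digraph
    \<Rightarrow> ('k, ((ped_point, ped_arrow) path \<Rightarrow>\<^sub>0 'k) set) module"
  where "pedigree_algebra TYPE('k) L = bound_quiver_algebra L (pedigree_relations L)"


section \<open>Brauer quivers\<close>

text \<open>
  A cycle is an equivalence class of closed walks under change of the starting point.
  \<open>pre_digraph.cycle\<close> includes loops.
\<close>

definition quiver_cycles :: "('v, 'a) pre_digraph \<Rightarrow> 'a list set set"
  where "quiver_cycles Q = {{rotate n p | n. True} | p. pre_digraph.cycle Q p}"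

definition cycle_arcs :: "'a list set \<Rightarrow> 'a set"
  where "cycle_arcs Z = (\<Union>p\<in>Z. set p)"

definition cycle_verts :: "('v, 'a) pre_digraph \<Rightarrow> 'a list set \<Rightarrow> 'v set"
  where "cycle_verts Q Z = tail Q ` cycle_arcs Z"

definition brauer_quiver :: "('v, 'a) pre_digraph \<Rightarrow> bool"
  where "brauer_quiver Q \<longleftrightarrow>
    fin_digraph Q \<and> Digraph_Component.connected Q \<and>
    (\<forall>a \<in> arcs Q. \<exists>Z \<in> quiver_cycles Q. a \<in> cycle_arcs Z) \<and>
    (\<forall>x \<in> verts Q. card {Z \<in> quiver_cycles Q. x \<in> cycle_verts Q Z} = 2) \<and>
    (\<forall>Z \<in> quiver_cycles Q. \<forall>Z' \<in> quiver_cycles Q. Z \<noteq> Z' \<longrightarrow>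
       card (cycle_verts Q Z \<inter> cycle_verts Q Z') \<le> 1)"

text \<open>The representative of \<open>Z\<close> starting in \<open>x\<close> is unique, as a cycle passes through each of its points once.\<close>

definition zeta :: "('v, 'a) pre_digraph \<Rightarrow> 'v \<Rightarrow> 'a list set \<Rightarrow> ('v, 'a) path"
  where "zeta Q x Z = (x, THE p. p \<in> Z \<and> tail Q (hd p) = x, x)"

text \<open>
  In a Brauer quiver each arrow lies on a unique cycle, since two cycles with a common arrow that
  is not a loop share two points. Hence the paths in the first set are exactly the paths of length
  two whose arrows do not lie on a common cycle.
\<close>

definition brauer_relations ::
  "('v, 'a) pre_digraph \<Rightarrow> (('v, 'a) path \<Rightarrow>\<^sub>0 'k::field) set"
  where "brauer_relations Q =
    {Poly_Mapping.single (tail Q a, [a, b], head Q b) 1 | a b.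
       a \<in> arcs Q \<and> b \<in> arcs Q \<and> head Q a = tail Q b \<and>
       (\<exists>Z \<in> quiver_cycles Q. \<exists>Z' \<in> quiver_cycles Q.
          Z \<noteq> Z' \<and> a \<in> cycle_arcs Z \<and> b \<in> cycle_arcs Z')} \<union>
    {Poly_Mapping.single (zeta Q x Z) 1 - Poly_Mapping.single (zeta Q x Z') 1 | x Z Z'.
       x \<in> verts Q \<and> Z \<in> quiver_cycles Q \<and> Z' \<in> quiver_cycles Q \<and> Z \<noteq> Z' \<and>
       x \<in> cycle_verts Q Z \<and> x \<in> cycle_verts Q Z'}"

definition brauer_algebra ::
  "'k::field itself \<Rightarrow> ('v, 'a) pre_digraph \<Rightarrow> ('k, (('v, 'a) path \<Rightarrow>\<^sub>0 'k) set) module"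
  where "brauer_algebra TYPE('k) Q = bound_quiver_algebra Q (brauer_relations Q)"

end

theory Submission
  imports Defs
begin

text \<open>
  The arrows of a pedigree \<open>L\<close> fall into lines, along which either only arrows \<open>\<alpha>\<close> or only arrows
  \<open>\<beta>\<close> are followed, and each point lies on exactly one line of either kind (possibly reduced to the
  point). The nonzero paths of \<open>A\<^sub>L\<close> are the paths along the lines, and the dual of the path from \<open>x\<close>
  to \<open>y\<close> behaves in \<open>T(A\<^sub>L)\<close> like a path from \<open>y\<close> back to \<open>x\<close>. Hence \<open>T(A\<^sub>L)\<close> is the algebra
  \<open>B(Q)\<close> for the quiver \<open>Q\<close> obtained by closing up each line with one additional arrow, the dual of an
  idempotent being the common value of the two cycles \<open>\<zeta>\<close> at a point.

  Conversely, two points on a cycle \<open>C\<close> of a Brauer quiver cannot be joined by a walk avoiding the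
  arrows of \<open>C\<close>, so the cycles are arranged in a tree. Unfolding the quiver from a chosen root, with
  one of the two cycles at each vertex in the role of the line of arrows \<open>\<alpha>\<close> and the other one in
  that of the line of arrows \<open>\<beta>\<close>, therefore meets each vertex exactly once and yields the pedigree.
\<close>

text \<open>All algebras involved have bases in which a product of two basis elements is a basis
  element or zero. They are treated as algebras of partial monoids, with \<open>None\<close> for
  zero, so that isomorphisms become statements about multiplication tables. A bound quiver algebra
  is compared with a table by evaluating paths; the point to prove is that every ideal containing
  the relations contains the paths of value zero and the differences of paths of equal value. The
  obstacle is that \<open>le\<close>, the existence of a path along a line, is not transitive, since
  a path that changes its line vanishes. Associativity of the table for the trivial extension is
  therefore not formal. It rests on the tree shape: three distinct points that are pairwise on
  common lines lie on one line, and no proper quadrangle has sides of alternating directions. Both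
  halves of the theorem end in the same comparison, made in the locale \<open>brauer_lines\<close>.
  They differ in what is given: the quiver is built over the point set of the pedigree, or the point
  set is found inside the quiver.\<close>

abbreviation "keys \<equiv> Poly_Mapping.keys"
abbreviation "lookup \<equiv> Poly_Mapping.lookup"
abbreviation "single \<equiv> Poly_Mapping.single"

section \<open>Partial monoid algebras\<close>

text \<open>Additive maps are determined by their values on monomials. Restricting \<open>eq\<close>
  to the support of \<open>f\<close> is what lets conditions such as
  \<open>keys f \<subseteq> M\<close> enter the proofs of multilinear identities.\<close>

lemma poly_mapping_additive_eqI:
  fixes f :: "'n \<Rightarrow>\<^sub>0 'c::comm_monoid_add" and F G :: "('n \<Rightarrow>\<^sub>0 'c) \<Rightarrow> 'b::comm_monoid_add"
  assumes F: "F 0 = 0" "\<And>f g. F (f + g) = F f + F g"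
    and G: "G 0 = 0" "\<And>f g. G (f + g) = G f + G g"
    and eq: "\<And>k c. k \<in> keys f \<Longrightarrow> F (single k c) = G (single k c)"
  shows "F f = G f"
proof -
  have sumF: "F (sum h S) = (\<Sum>k\<in>S. F (h k))" for S and h :: "'n \<Rightarrow> 'n \<Rightarrow>\<^sub>0 'c"
    by (induction S rule: infinite_finite_induct) (auto simp: F)
  have sumG: "G (sum h S) = (\<Sum>k\<in>S. G (h k))" for S and h :: "'n \<Rightarrow> 'n \<Rightarrow>\<^sub>0 'c"
    by (induction S rule: infinite_finite_induct) (auto simp: G)
  have f: "f = (\<Sum>k\<in>keys f. single k (lookup f k))"
    by (rule poly_mapping_eqI) (simp add: lookup_sum lookup_single when_def in_keys_iff)
  have "F f = (\<Sum>k\<in>keys f. F (single k (lookup f k)))"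
    by (subst f) (rule sumF)
  also have "\<dots> = (\<Sum>k\<in>keys f. G (single k (lookup f k)))"
    using eq by (intro sum.cong) auto
  also have "\<dots> = G f"
    by (subst (3) f) (rule sumG[symmetric])
  finally show ?thesis .
qed

lemma keys_sum_subset: "keys (sum g S) \<subseteq> (\<Union>i\<in>S. keys (g i))"
proof
  fix k assume "k \<in> keys (sum g S)"
  then have "(\<Sum>i\<in>S. lookup (g i) k) \<noteq> 0"
    by (simp add: in_keys_iff lookup_sum)
  then obtain i where "i \<in> S" "lookup (g i) k \<noteq> 0"
    by (meson sum.neutral)
  then show "k \<in> (\<Union>i\<in>S. keys (g i))"
    by (auto simp: in_keys_iff)
qed

text \<open>Zero is adjoined to a basis through \<open>None\<close>: a product or an image of basis
  elements is a monomial or vanishes.\<close>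

definition opt_single :: "'m option \<Rightarrow> 'k \<Rightarrow> 'm \<Rightarrow>\<^sub>0 'k::zero"
  where "opt_single r c = (case r of None \<Rightarrow> 0 | Some m \<Rightarrow> single m c)"

lemma opt_single_simps [simp]:
  "opt_single None c = 0" "opt_single (Some m) c = single m c" "opt_single r 0 = 0"
  by (auto simp: opt_single_def split: option.split)

lemma opt_single_add: "opt_single r (c + d) = opt_single r c + opt_single r (d::'k::comm_monoid_add)"
  by (cases r) (simp_all add: single_add)

definition lin_lift :: "('n \<Rightarrow> 'm option) \<Rightarrow> ('n \<Rightarrow>\<^sub>0 'k::comm_monoid_add) \<Rightarrow> 'm \<Rightarrow>\<^sub>0 'k"
  where "lin_lift \<rho> f = (\<Sum>p\<in>keys f. opt_single (\<rho> p) (lookup f p))"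

lemma lin_lift_simps [simp]:
  "lin_lift \<rho> 0 = 0" "lin_lift \<rho> (single p c) = opt_single (\<rho> p) c"
  by (simp_all add: lin_lift_def)

lemma lin_lift_add: "lin_lift \<rho> (f + g) = lin_lift \<rho> f + lin_lift \<rho> g"
  unfolding lin_lift_def by (rule setsum_keys_plus_distrib) (simp_all add: opt_single_add)

lemma lin_lift_uminus: "lin_lift \<rho> (- f) = - lin_lift \<rho> (f :: 'n \<Rightarrow>\<^sub>0 'k::ab_group_add)"
proof -
  have "lin_lift \<rho> f + lin_lift \<rho> (- f) = 0"
    by (metis add.right_inverse lin_lift_add lin_lift_simps(1))
  then show ?thesis
    by (simp add: eq_neg_iff_add_eq_0 add.commute)
qed

lemma lin_lift_diff: "lin_lift \<rho> (f - g) = lin_lift \<rho> f - lin_lift \<rho> (g :: 'n \<Rightarrow>\<^sub>0 'k::ab_group_add)"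
  using lin_lift_add[of \<rho> f "- g"] by (simp add: lin_lift_uminus)

lemma lin_lift_sum: "lin_lift \<rho> (sum g S) = (\<Sum>i\<in>S. lin_lift \<rho> (g i))"
  by (induction S rule: infinite_finite_induct) (auto simp: lin_lift_add)

lemma lookup_map_mult [simp]:
  "lookup (Poly_Mapping.map ((*) c) f) k = c * lookup f k" for c :: "'k::mult_zero"
  by transfer (auto simp: when_def)

lemma map_mult_zero [simp]: "Poly_Mapping.map ((*) c) 0 = 0" for c :: "'k::mult_zero"
  by (rule poly_mapping_eqI) simp

lemma map_mult_add:
  "Poly_Mapping.map ((*) c) (f + g) = Poly_Mapping.map ((*) c) f + Poly_Mapping.map ((*) c) g"
  for c :: "'k::semiring_0"
  by (rule poly_mapping_eqI) (simp add: lookup_add distrib_left)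

lemma map_mult_single [simp]:
  "Poly_Mapping.map ((*) c) (single k d) = single k (c * d)"
  for c :: "'k::mult_zero"
  by (rule poly_mapping_eqI) (simp add: lookup_single when_def)

lemma map_mult_opt_single [simp]:
  "Poly_Mapping.map ((*) c) (opt_single r d) = opt_single r (c * d)" for c :: "'k::mult_zero"
  by (cases r) (auto intro: poly_mapping_eqI)

lemma lin_lift_map_mult:
  "lin_lift \<rho> (Poly_Mapping.map ((*) c) f) = Poly_Mapping.map ((*) c) (lin_lift \<rho> f)"
  for c :: "'k::semiring_0"
  by (rule poly_mapping_additive_eqI[of _ _ f])
    (auto simp: map_mult_add lin_lift_add intro: poly_mapping_eqI)

text \<open>The bilinear extension of a partial multiplication, as in a contracted semigroup
  algebra, where the zero of the semigroup becomes the zero of the algebra.\<close>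

definition conv_mult ::
    "('m \<Rightarrow> 'm \<Rightarrow> 'm option) \<Rightarrow> ('m \<Rightarrow>\<^sub>0 'k) \<Rightarrow> ('m \<Rightarrow>\<^sub>0 'k) \<Rightarrow> 'm \<Rightarrow>\<^sub>0 'k::semiring_0"
  where "conv_mult mul f g =
    (\<Sum>q\<in>keys f. \<Sum>p\<in>keys g. opt_single (mul q p) (lookup f q * lookup g p))"

lemma conv_mult_zero [simp]: "conv_mult mul 0 g = 0" "conv_mult mul f 0 = 0"
  by (simp_all add: conv_mult_def)

lemma conv_mult_single [simp]:
  "conv_mult mul (single q c) (single p d) = opt_single (mul q p) (c * d)"
  by (auto simp: conv_mult_def)

lemma conv_mult_add_left: "conv_mult mul (f + f') g = conv_mult mul f g + conv_mult mul f' g"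
  unfolding conv_mult_def
  by (rule setsum_keys_plus_distrib)
    (simp_all add: distrib_right opt_single_add sum.distrib)

lemma conv_mult_add_right: "conv_mult mul f (g + g') = conv_mult mul f g + conv_mult mul f g'"
  unfolding conv_mult_def
  by (subst sum.distrib[symmetric], rule sum.cong[OF refl], rule setsum_keys_plus_distrib)
    (simp_all add: distrib_left opt_single_add)

lemma conv_mult_sum_left: "conv_mult mul (sum h S) g = (\<Sum>i\<in>S. conv_mult mul (h i) g)"
  by (induction S rule: infinite_finite_induct) (auto simp: conv_mult_add_left)

lemma conv_mult_sum_right: "conv_mult mul f (sum h S) = (\<Sum>i\<in>S. conv_mult mul f (h i))"
  by (induction S rule: infinite_finite_induct) (auto simp: conv_mult_add_right)

lemmas conv_mult_bilinear = conv_mult_add_left conv_mult_add_right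

definition mono_alg ::
    "'m set \<Rightarrow> 'm set \<Rightarrow> ('m \<Rightarrow> 'm \<Rightarrow> 'm option) \<Rightarrow> ('k::field, 'm \<Rightarrow>\<^sub>0 'k) module"
  where "mono_alg M E mul =
    \<lparr>carrier = {f. keys f \<subseteq> M}, mult = conv_mult mul,
     one = (\<Sum>e\<in>E. single e 1), zero = 0, add = (+),
     smult = (\<lambda>c. Poly_Mapping.map ((*) c))\<rparr>"

lemma mono_alg_simps [simp]:
  "carrier (mono_alg M E mul) = {f. keys f \<subseteq> M}"
  "mult (mono_alg M E mul) = conv_mult mul"
  "one (mono_alg M E mul) = (\<Sum>e\<in>E. single e 1)"
  "zero (mono_alg M E mul) = 0"
  "add (mono_alg M E mul) = (+)"
  "smult (mono_alg M E mul) = (\<lambda>c. Poly_Mapping.map ((*) c))"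
  by (simp_all add: mono_alg_def)

lemma keys_opt_single_subset: "keys (opt_single r c) \<subseteq> set_option r"
  by (cases r) auto

lemma keys_map_mult_subset: "keys (Poly_Mapping.map ((*) c) f) \<subseteq> keys f" for c :: "'k::mult_zero"
  by (auto simp: in_keys_iff)

text \<open>A semigroup with its zero removed. Written with \<open>Option.bind\<close>,
  associativity says that both bracketings vanish or both exist and agree. The elements of
  \<open>E\<close> behave like the identities of a small category: exactly one of them acts
  nontrivially on each side of \<open>a\<close>, so their sum is the identity of the
  algebra.\<close>

locale partial_monoid =
  fixes M E :: "'m set" and mul :: "'m \<Rightarrow> 'm \<Rightarrow> 'm option"
  assumes mul_closed: "\<lbrakk>a \<in> M; b \<in> M; mul a b = Some c\<rbrakk> \<Longrightarrow> c \<in> M"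
    and mul_assoc: "\<lbrakk>a \<in> M; b \<in> M; c \<in> M\<rbrakk> \<Longrightarrow>
      Option.bind (mul a b) (\<lambda>x. mul x c) = Option.bind (mul b c) (mul a)"
    and units: "E \<subseteq> M" and finite_units: "finite E"
    and left_unit: "a \<in> M \<Longrightarrow> \<exists>l\<in>E. mul l a = Some a \<and> (\<forall>e\<in>E - {l}. mul e a = None)"
    and right_unit: "a \<in> M \<Longrightarrow> \<exists>r\<in>E. mul a r = Some a \<and> (\<forall>e\<in>E - {r}. mul a e = None)"
begin

lemma conv_mult_keys:
  assumes "keys f \<subseteq> M" "keys g \<subseteq> M"
  shows "keys (conv_mult mul f g) \<subseteq> M"
proof -
  have "keys (conv_mult mul f g) \<subseteq> (\<Union>q\<in>keys f. \<Union>p\<in>keys g. set_option (mul q p))"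
    unfolding conv_mult_def
    by (rule order.trans[OF keys_sum_subset] UN_mono order.refl keys_opt_single_subset)+
  also have "\<dots> \<subseteq> M"
    using assms mul_closed by (fastforce simp: set_option_def split: option.splits)
  finally show ?thesis .
qed

lemma conv_mult_assoc:
  assumes "keys f \<subseteq> M" "keys g \<subseteq> M" "keys h \<subseteq> M"
  shows "conv_mult mul (conv_mult mul f g) h = conv_mult mul f (conv_mult mul g h)"
proof (rule poly_mapping_additive_eqI[of _ _ f])
  fix a c assume a: "a \<in> keys f"
  show "conv_mult mul (conv_mult mul (single a c) g) h =
      conv_mult mul (single a c) (conv_mult mul g h)"
  proof (rule poly_mapping_additive_eqI[of _ _ g])
    fix b d assume b: "b \<in> keys g"
    show "conv_mult mul (conv_mult mul (single a c) (single b d)) h =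
      conv_mult mul (single a c) (conv_mult mul (single b d) h)"
    proof (rule poly_mapping_additive_eqI[of _ _ h])
      fix x e assume x: "x \<in> keys h"
      have "Option.bind (mul a b) (\<lambda>y. mul y x) = Option.bind (mul b x) (mul a)"
        using a b x assms mul_assoc by blast
      then show "conv_mult mul (conv_mult mul (single a c) (single b d))
          (single x e) =
        conv_mult mul (single a c)
          (conv_mult mul (single b d) (single x e))"
        by (cases "mul a b"; cases "mul b x") (auto simp: mult.assoc)
    qed (auto simp: conv_mult_bilinear)
  qed (auto simp: conv_mult_bilinear)
qed (auto simp: conv_mult_bilinear)

lemma conv_mult_one_left:
  fixes f :: "'m \<Rightarrow>\<^sub>0 'k::field"
  assumes "keys f \<subseteq> M"
  shows "conv_mult mul (\<Sum>e\<in>E. single e 1) f = f"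
proof (rule poly_mapping_additive_eqI[of _ _ f])
  fix a and c :: 'k assume "a \<in> keys f"
  then obtain l where l: "l \<in> E" "mul l a = Some a" "\<forall>e\<in>E - {l}. mul e a = None"
    using assms left_unit by blast
  have "(\<Sum>e\<in>E. opt_single (mul e a) c) = opt_single (mul l a) c"
    using l by (subst sum.remove[OF finite_units l(1)]) (auto intro!: sum.neutral)
  then show "conv_mult mul (\<Sum>e\<in>E. single e 1) (single a c) =
      single a c"
    using l by (simp add: conv_mult_sum_left)
qed (auto simp: conv_mult_bilinear)

lemma conv_mult_one_right:
  fixes f :: "'m \<Rightarrow>\<^sub>0 'k::field"
  assumes "keys f \<subseteq> M"
  shows "conv_mult mul f (\<Sum>e\<in>E. single e 1) = f"
proof (rule poly_mapping_additive_eqI[of _ _ f])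
  fix a and c :: 'k assume "a \<in> keys f"
  then obtain r where r: "r \<in> E" "mul a r = Some a" "\<forall>e\<in>E - {r}. mul a e = None"
    using assms right_unit by blast
  have "(\<Sum>e\<in>E. opt_single (mul a e) c) = opt_single (mul a r) c"
    using r by (subst sum.remove[OF finite_units r(1)]) (auto intro!: sum.neutral)
  then show "conv_mult mul (single a c) (\<Sum>e\<in>E. single e 1) =
      single a c"
    using r by (simp add: conv_mult_sum_right)
qed (auto simp: conv_mult_bilinear)

lemma keys_one: "keys (\<Sum>e\<in>E. single e (1::'k::field)) \<subseteq> M"
  using units by (intro order.trans[OF keys_sum_subset]) auto

lemma keys_add_closed: "keys f \<subseteq> M \<Longrightarrow> keys g \<subseteq> M \<Longrightarrow> keys (f + g) \<subseteq> M"
  by (rule order.trans[OF Poly_Mapping.keys_add]) auto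

lemma ring_mono_alg: "ring (mono_alg M E mul :: ('k::field, _) module)"
proof (rule ringI)
  show "abelian_group (mono_alg M E mul :: ('k, _) module)"
  proof (rule abelian_groupI)
    fix x assume x: "x \<in> carrier (mono_alg M E mul :: ('k, _) module)"
    show "\<exists>y\<in>carrier (mono_alg M E mul :: ('k, _) module).
        y \<oplus>\<^bsub>mono_alg M E mul\<^esub> x = \<zero>\<^bsub>mono_alg M E mul\<^esub>"
      by (rule bexI[of _ "- x"]) (use x in auto)
  qed (auto simp: keys_add_closed add.assoc add.commute)
  show "monoid (mono_alg M E mul :: ('k, _) module)"
    by (rule monoidI)
      (use keys_one in \<open>auto simp: conv_mult_keys conv_mult_assoc conv_mult_one_left conv_mult_one_right\<close>)
qed (auto simp: conv_mult_bilinear)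

end

lemma conv_mult_lin_lift:
  fixes f g :: "'n \<Rightarrow>\<^sub>0 'k::semiring_0"
  assumes "\<And>q p. q \<in> keys f \<Longrightarrow> p \<in> keys g \<Longrightarrow>
    Option.bind (mul q p) \<rho> = Option.bind (\<rho> q) (\<lambda>a. Option.bind (\<rho> p) (mul' a))"
  shows "lin_lift \<rho> (conv_mult mul f g) = conv_mult mul' (lin_lift \<rho> f) (lin_lift \<rho> g)"
proof (rule poly_mapping_additive_eqI[of _ _ f])
  fix a and c :: 'k assume a: "a \<in> keys f"
  show "lin_lift \<rho> (conv_mult mul (single a c) g) =
      conv_mult mul' (lin_lift \<rho> (single a c)) (lin_lift \<rho> g)"
  proof (rule poly_mapping_additive_eqI[of _ _ g])
    fix b and d :: 'k assume "b \<in> keys g"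
    from assms[OF a this]
    show "lin_lift \<rho> (conv_mult mul (single a c) (single b d)) =
      conv_mult mul' (lin_lift \<rho> (single a c)) (lin_lift \<rho> (single b d))"
      by (cases "mul a b"; cases "\<rho> a"; cases "\<rho> b") auto
  qed (auto simp: conv_mult_bilinear lin_lift_add)
qed (auto simp: conv_mult_bilinear lin_lift_add)

section \<open>Isomorphisms of algebras\<close>

lemma alg_quot_simps [simp]:
  "carrier (alg_quot A I) = carrier (A Quot I)"
  "mult (alg_quot A I) = mult (A Quot I)"
  "one (alg_quot A I) = one (A Quot I)"
  "zero (alg_quot A I) = zero (A Quot I)"
  "add (alg_quot A I) = add (A Quot I)"
  "smult (alg_quot A I) = (\<lambda>c X. \<Union>x\<in>X. I +>\<^bsub>A\<^esub> (c \<odot>\<^bsub>A\<^esub> x))"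
  by (simp_all add: alg_quot_def ring.defs module.defs)

text \<open>The first isomorphism theorem. Scalars act on the quotient through a union of cosets;
  identifying cosets with fibres of \<open>h\<close> shows that this union is a single coset. The
  last two conclusions are what symmetry of \<open>alg_isomorphic\<close> and transport of trivial
  extensions ask for.\<close>

lemma alg_quot_isomorphic:
  fixes A B :: "('k::field, _) module"
  assumes hom: "ring_hom_ring A B h" and surj: "h ` carrier A = carrier B"
    and smult: "\<And>c x. x \<in> carrier A \<Longrightarrow> c \<odot>\<^bsub>A\<^esub> x \<in> carrier A \<and> h (c \<odot>\<^bsub>A\<^esub> x) = c \<odot>\<^bsub>B\<^esub> h x"
    and ker: "a_kernel A B h = I"
  shows "alg_isomorphic (alg_quot A I) B"
    and "\<And>c X. X \<in> carrier (alg_quot A I) \<Longrightarrow> c \<odot>\<^bsub>alg_quot A I\<^esub> X \<in> carrier (alg_quot A I)"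
    and "ring (alg_quot A I)"
proof -
  interpret ring_hom_ring A B h by fact
  interpret I: ideal I A using kernel_is_ideal ker by simp
  have coset: "I +>\<^bsub>A\<^esub> x = {y \<in> carrier A. h y = h x}" if "x \<in> carrier A" for x
  proof
    show "I +>\<^bsub>A\<^esub> x \<subseteq> {y \<in> carrier A. h y = h x}"
      using that unfolding ker[symmetric] a_kernel_def' a_r_coset_def' by auto
    show "{y \<in> carrier A. h y = h x} \<subseteq> I +>\<^bsub>A\<^esub> x"
    proof
      fix y assume y: "y \<in> {y \<in> carrier A. h y = h x}"
      then have "y \<ominus>\<^bsub>A\<^esub> x \<in> I"
        using that unfolding ker[symmetric] a_kernel_def' by (simp add: R.minus_eq S.r_neg)
      moreover have "y = (y \<ominus>\<^bsub>A\<^esub> x) \<oplus>\<^bsub>A\<^esub> x"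
        using y that by (simp add: R.minus_eq R.a_assoc R.l_neg)
      ultimately show "y \<in> I +>\<^bsub>A\<^esub> x"
        unfolding a_r_coset_def' by blast
    qed
  qed
  have cosets: "\<exists>x\<in>carrier A. X = {y \<in> carrier A. h y = h x}" if "X \<in> carrier (A Quot I)" for X
    using that coset unfolding FactRing_def A_RCOSETS_def' by auto
  have sm: "c \<odot>\<^bsub>alg_quot A I\<^esub> {y \<in> carrier A. h y = h x} = I +>\<^bsub>A\<^esub> (c \<odot>\<^bsub>A\<^esub> x)"
    if "x \<in> carrier A" for c x
  proof -
    have "I +>\<^bsub>A\<^esub> (c \<odot>\<^bsub>A\<^esub> y) = I +>\<^bsub>A\<^esub> (c \<odot>\<^bsub>A\<^esub> x)" if "y \<in> carrier A" "h y = h x" for y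
      using that \<open>x \<in> carrier A\<close> smult coset by simp
    then show ?thesis
      unfolding alg_quot_simps using that by (intro SUP_eq_const) blast+
  qed
  show closed: "c \<odot>\<^bsub>alg_quot A I\<^esub> X \<in> carrier (alg_quot A I)" if X: "X \<in> carrier (alg_quot A I)" for c X
  proof -
    obtain x where x: "x \<in> carrier A" "X = {y \<in> carrier A. h y = h x}"
      using cosets[of X] X by auto
    then show ?thesis
      using sm[OF x(1), of c] smult[OF x(1), of c] unfolding x(2)
      by (auto simp: FactRing_def A_RCOSETS_def' simp del: alg_quot_simps(6))
  qed
  have iso: "(\<lambda>X. the_elem (h ` X)) \<in> ring_iso (A Quot I) B"
    using FactRing_iso_set[OF surj] ker by simp
  have "the_elem (h ` (c \<odot>\<^bsub>alg_quot A I\<^esub> X)) = c \<odot>\<^bsub>B\<^esub> the_elem (h ` X)"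
    if X: "X \<in> carrier (A Quot I)" for c X
  proof -
    obtain x where x: "x \<in> carrier A" "X = {y \<in> carrier A. h y = h x}"
      using cosets[OF X] by blast
    have "h ` X = {h x}" "h ` (c \<odot>\<^bsub>alg_quot A I\<^esub> X) = {c \<odot>\<^bsub>B\<^esub> h x}"
      unfolding x(2) sm[OF x(1)] using x(1) smult coset by auto
    then show ?thesis by simp
  qed
  moreover have "ring_iso (alg_quot A I) B = ring_iso (A Quot I) B"
    by (simp add: ring_iso_def ring_hom_def)
  ultimately show "alg_isomorphic (alg_quot A I) B"
    using iso unfolding alg_isomorphic_def alg_quot_simps(1)
    by (intro bexI[of _ "\<lambda>X. the_elem (h ` X)"]) simp_all
  interpret q: ring "A Quot I" by (rule I.quotient_is_ring)
  show "ring (alg_quot A I)"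
  proof (rule ringI)
    show "abelian_group (alg_quot A I)"
    proof (rule abelian_groupI)
      fix x assume x: "x \<in> carrier (alg_quot A I)"
      show "\<exists>y\<in>carrier (alg_quot A I). y \<oplus>\<^bsub>alg_quot A I\<^esub> x = \<zero>\<^bsub>alg_quot A I\<^esub>"
        by (rule bexI[of _ "\<ominus>\<^bsub>A Quot I\<^esub> x"]) (use x in \<open>simp_all add: q.l_neg\<close>)
    qed (simp_all add: q.a_ac)
    show "monoid (alg_quot A I)"
      by (rule monoidI) (simp_all add: q.m_assoc)
  qed (simp_all add: q.l_distr q.r_distr)
qed

lemma alg_isomorphic_sym:
  fixes A B :: "('k::field, _) module"
  assumes "alg_isomorphic A B"
    and "ring A" and "\<And>c x. x \<in> carrier A \<Longrightarrow> c \<odot>\<^bsub>A\<^esub> x \<in> carrier A"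
  shows "alg_isomorphic B A"
proof -
  obtain h where h: "h \<in> ring_iso A B" "\<And>c x. x \<in> carrier A \<Longrightarrow> h (c \<odot>\<^bsub>A\<^esub> x) = c \<odot>\<^bsub>B\<^esub> h x"
    using assms(1) unfolding alg_isomorphic_def by auto
  let ?g = "inv_into (carrier A) h"
  have g: "?g \<in> ring_iso B A"
    by (rule ring_iso_set_sym[OF assms(2) h(1)])
  have bij: "bij_betw h (carrier A) (carrier B)"
    using h(1) by (simp add: ring_iso_def)
  have "?g (c \<odot>\<^bsub>B\<^esub> y) = c \<odot>\<^bsub>A\<^esub> ?g y" if "y \<in> carrier B" for c y
  proof -
    have *: "?g y \<in> carrier A" "h (?g y) = y"
      using bij that by (auto simp: bij_betw_def f_inv_into_f inv_into_into)
    then have "c \<odot>\<^bsub>B\<^esub> y = h (c \<odot>\<^bsub>A\<^esub> ?g y)"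
      using h(2) by simp
    then show ?thesis
      using * bij assms(3) by (simp add: bij_betw_def inv_into_f_f)
  qed
  then show ?thesis
    using g unfolding alg_isomorphic_def by blast
qed

lemma alg_isomorphic_trans:
  assumes "alg_isomorphic A B" "alg_isomorphic B C"
  shows "alg_isomorphic A C"
proof -
  obtain h where h: "h \<in> ring_iso A B" "\<And>c x. x \<in> carrier A \<Longrightarrow> h (c \<odot>\<^bsub>A\<^esub> x) = c \<odot>\<^bsub>B\<^esub> h x"
    using assms(1) unfolding alg_isomorphic_def by auto
  obtain g where g: "g \<in> ring_iso B C" "\<And>c x. x \<in> carrier B \<Longrightarrow> g (c \<odot>\<^bsub>B\<^esub> x) = c \<odot>\<^bsub>C\<^esub> g x"
    using assms(2) unfolding alg_isomorphic_def by auto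
  have "g \<circ> h \<in> ring_iso A C"
    by (rule ring_iso_set_trans[OF h(1) g(1)])
  moreover have "h x \<in> carrier B" if "x \<in> carrier A" for x
    using h(1) that by (auto simp: ring_iso_def ring_hom_def)
  ultimately show ?thesis
    unfolding alg_isomorphic_def using h(2) g(2) by (intro bexI[of _ "g \<circ> h"]) auto
qed

section \<open>Trivial extensions of isomorphic algebras\<close>

lemma alg_dual_iff:
  "\<phi> \<in> alg_dual B \<longleftrightarrow> \<phi> \<in> extensional (carrier B) \<and>
    (\<forall>x \<in> carrier B. \<forall>y \<in> carrier B. \<phi> (x \<oplus>\<^bsub>B\<^esub> y) = \<phi> x + \<phi> y) \<and>
    (\<forall>c. \<forall>x \<in> carrier B. \<phi> (c \<odot>\<^bsub>B\<^esub> x) = c * \<phi> x)"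
  by (simp add: alg_dual_def)

lemma trivial_extension_simps [simp]:
  "carrier (trivial_extension B) = carrier B \<times> alg_dual B"
  "(g, n) \<otimes>\<^bsub>trivial_extension B\<^esub> (f, m) =
     (g \<otimes>\<^bsub>B\<^esub> f, \<lambda>x\<in>carrier B. m (x \<otimes>\<^bsub>B\<^esub> g) + n (f \<otimes>\<^bsub>B\<^esub> x))"
  "\<one>\<^bsub>trivial_extension B\<^esub> = (\<one>\<^bsub>B\<^esub>, \<lambda>x\<in>carrier B. 0)"
  "(g, n) \<oplus>\<^bsub>trivial_extension B\<^esub> (f, m) = (g \<oplus>\<^bsub>B\<^esub> f, \<lambda>x\<in>carrier B. n x + m x)"
  "c \<odot>\<^bsub>trivial_extension B\<^esub> (f, m) = (c \<odot>\<^bsub>B\<^esub> f, \<lambda>x\<in>carrier B. c * m x)"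
  by (simp_all add: trivial_extension_def)

lemma trivial_extension_isomorphic:
  fixes A B :: "('k::field, _) module"
  assumes iso: "alg_isomorphic A B" and "ring A" "ring B"
    and smult_A: "\<And>c x. x \<in> carrier A \<Longrightarrow> c \<odot>\<^bsub>A\<^esub> x \<in> carrier A"
    and smult_B: "\<And>c x. x \<in> carrier B \<Longrightarrow> c \<odot>\<^bsub>B\<^esub> x \<in> carrier B"
  shows "alg_isomorphic (trivial_extension A) (trivial_extension B)"
proof -
  interpret A: ring A by fact
  interpret B: ring B by fact
  obtain h where h: "h \<in> ring_iso A B" and hs: "\<And>c x. x \<in> carrier A \<Longrightarrow> h (c \<odot>\<^bsub>A\<^esub> x) = c \<odot>\<^bsub>B\<^esub> h x"
    using iso unfolding alg_isomorphic_def by auto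
  define g where "g = inv_into (carrier A) h"
  have g: "g \<in> ring_iso B A"
    unfolding g_def by (rule ring_iso_set_sym[OF assms(2) h])
  have bij: "bij_betw h (carrier A) (carrier B)"
    using h by (simp add: ring_iso_def)
  have hc: "h x \<in> carrier B" "g (h x) = x" if "x \<in> carrier A" for x
    using that bij by (auto simp: g_def bij_betw_def inv_into_f_f)
  have gc: "g y \<in> carrier A" "h (g y) = y" if "y \<in> carrier B" for y
    using that bij by (auto simp: g_def bij_betw_def inv_into_into f_inv_into_f)
  have gs: "g (c \<odot>\<^bsub>B\<^esub> y) = c \<odot>\<^bsub>A\<^esub> g y" if "y \<in> carrier B" for c y
    using hs[of "g y" c] hc(2)[of "c \<odot>\<^bsub>A\<^esub> g y"] gc[OF that] smult_A by simp
  have hom: "h (x \<otimes>\<^bsub>A\<^esub> y) = h x \<otimes>\<^bsub>B\<^esub> h y" "h (x \<oplus>\<^bsub>A\<^esub> y) = h x \<oplus>\<^bsub>B\<^esub> h y"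
    if "x \<in> carrier A" "y \<in> carrier A" for x y
    using h that by (auto simp: ring_iso_def ring_hom_def)
  have gom: "g (x \<otimes>\<^bsub>B\<^esub> y) = g x \<otimes>\<^bsub>A\<^esub> g y" "g (x \<oplus>\<^bsub>B\<^esub> y) = g x \<oplus>\<^bsub>A\<^esub> g y"
    if "x \<in> carrier B" "y \<in> carrier B" for x y
    using g that by (auto simp: ring_iso_def ring_hom_def)
  have h1: "h \<one>\<^bsub>A\<^esub> = \<one>\<^bsub>B\<^esub>"
    using h by (auto simp: ring_iso_def ring_hom_def)
  \<comment> \<open>A functional on \<open>A\<close> is carried to \<open>B\<close> by composition
    with the inverse \<open>g\<close> of \<open>h\<close>; the restriction to the carrier keeps it
    extensional, as \<open>alg_dual\<close> demands.\<close>
  define F where "F = (\<lambda>(a, n). (h a, \<lambda>y\<in>carrier B. (n (g y) :: 'k)))"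
  define G where "G = (\<lambda>(b, n). (g b, \<lambda>x\<in>carrier A. (n (h x) :: 'k)))"
  have F: "F \<in> carrier (trivial_extension A) \<rightarrow> carrier (trivial_extension B)"
    by (auto simp: F_def alg_dual_iff hc gc smult_B gom gs)
  have G: "G \<in> carrier (trivial_extension B) \<rightarrow> carrier (trivial_extension A)"
    by (auto simp: G_def alg_dual_iff hc gc smult_A hom hs)
  have "bij_betw F (carrier (trivial_extension A)) (carrier (trivial_extension B))"
  proof (rule bij_betw_byWitness[where f' = G])
    show "\<forall>a\<in>carrier (trivial_extension A). G (F a) = a"
      by (auto simp: F_def G_def hc gc alg_dual_iff extensional_def fun_eq_iff)
    show "\<forall>a\<in>carrier (trivial_extension B). F (G a) = a"
      by (auto simp: F_def G_def hc gc alg_dual_iff extensional_def fun_eq_iff)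
  qed (use F G in \<open>simp_all only: image_subset_iff_funcset\<close>)
  moreover have "F \<in> ring_hom (trivial_extension A) (trivial_extension B)"
  proof (rule ring_hom_memI)
    fix x y
    assume "x \<in> carrier (trivial_extension A)" "y \<in> carrier (trivial_extension A)"
    then obtain a n b m where xy: "x = (a, n)" "y = (b, m)" "a \<in> carrier A" "b \<in> carrier A"
      by auto
    show "F (x \<otimes>\<^bsub>trivial_extension A\<^esub> y) = F x \<otimes>\<^bsub>trivial_extension B\<^esub> F y"
      using xy by (auto simp: F_def hom gom hc gc fun_eq_iff)
    show "F (x \<oplus>\<^bsub>trivial_extension A\<^esub> y) = F x \<oplus>\<^bsub>trivial_extension B\<^esub> F y"
      using xy by (auto simp: F_def hom gom hc gc fun_eq_iff)
  next
    show "F \<one>\<^bsub>trivial_extension A\<^esub> = \<one>\<^bsub>trivial_extension B\<^esub>"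
      by (auto simp: F_def h1 gc fun_eq_iff)
  qed (rule funcset_mem[OF F])
  moreover have "F (c \<odot>\<^bsub>trivial_extension A\<^esub> x) = c \<odot>\<^bsub>trivial_extension B\<^esub> F x"
    if "x \<in> carrier (trivial_extension A)" for c x
    using that by (auto simp: F_def hs gc fun_eq_iff)
  ultimately show ?thesis
    unfolding alg_isomorphic_def ring_iso_def by blast
qed

text \<open>The table of a trivial extension: \<open>P\<close> is a basis of the algebra and
  \<open>d p\<close> is the dual basis vector of \<open>p\<close>. On basis vectors
  \<open>mul_d_left\<close> is the rule (n f) x = n (f x), and \<open>mul_d_right\<close> is (g m) x
  = m (x g); \<open>mul_d_d\<close> says that the dual bimodule has square zero.\<close>

locale symmetric_monoid = partial_monoid M E mul for M E :: "'m set" and mul +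
  fixes P :: "'m set" and d :: "'m \<Rightarrow> 'm"
  assumes finite_P: "finite P" and units_P: "E \<subseteq> P"
    and inj_d: "inj_on d P" and M_eq: "M = P \<union> d ` P" and disj: "P \<inter> d ` P = {}"
    and mul_P: "\<lbrakk>a \<in> P; b \<in> P; mul a b = Some c\<rbrakk> \<Longrightarrow> c \<in> P"
    and mul_not_P: "\<lbrakk>a \<in> M; b \<in> M; a \<notin> P \<or> b \<notin> P; mul a b = Some c\<rbrakk> \<Longrightarrow> c \<notin> P"
    and mul_d_d: "\<lbrakk>a \<in> P; b \<in> P\<rbrakk> \<Longrightarrow> mul (d a) (d b) = None"
    and mul_d_left: "\<lbrakk>a \<in> P; b \<in> P; c \<in> P\<rbrakk> \<Longrightarrow> mul (d a) b = Some (d c) \<longleftrightarrow> mul b c = Some a"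
    and mul_d_right: "\<lbrakk>a \<in> P; b \<in> P; c \<in> P\<rbrakk> \<Longrightarrow> mul b (d a) = Some (d c) \<longleftrightarrow> mul c b = Some a"
begin

text \<open>The dual part of \<open>f\<close>, read as a functional and evaluated at
  \<open>z\<close>: the coefficient of \<open>d p\<close> is its value at \<open>p\<close>.\<close>

definition pairing :: "('m \<Rightarrow>\<^sub>0 'k) \<Rightarrow> ('m \<Rightarrow>\<^sub>0 'k) \<Rightarrow> 'k::semiring_0"
  where "pairing f z = (\<Sum>p\<in>keys z. lookup f (d p) * lookup z p)"

definition proj :: "('m \<Rightarrow>\<^sub>0 'k) \<Rightarrow> ('m \<Rightarrow>\<^sub>0 'k::comm_monoid_add)"
  where "proj = lin_lift (\<lambda>p. if p \<in> P then Some p else None)"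

lemma proj_simps [simp]:
  "proj 0 = 0" "proj (f + g) = proj f + proj g"
  "proj (single p c) = (if p \<in> P then single p c else 0)"
  by (simp_all add: proj_def lin_lift_add)

lemma lookup_proj: "lookup (proj f) k = (if k \<in> P then lookup f k else 0)"
  by (rule poly_mapping_additive_eqI[of _ _ f]) (auto simp: lookup_add lookup_single when_def)

lemma pairing_zero [simp]: "pairing 0 z = 0" "pairing f 0 = 0"
  by (simp_all add: pairing_def)

lemma pairing_add_left: "pairing (f + g) z = pairing f z + pairing g z"
  by (simp add: pairing_def lookup_add distrib_right sum.distrib)

lemma pairing_add_right: "pairing f (z + z') = pairing f z + pairing f z'"
  unfolding pairing_def by (rule setsum_keys_plus_distrib) (simp_all add: distrib_left)

lemma pairing_single [simp]: "pairing f (single p c) = lookup f (d p) * c"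
  by (simp add: pairing_def)

lemma pairing_smult_right:
  "pairing f (Poly_Mapping.map ((*) c) z) = c * pairing f z" for c :: "'k::comm_semiring_0"
  by (rule poly_mapping_additive_eqI[of _ _ z])
    (auto simp: pairing_add_right map_mult_add distrib_left mult.left_commute)

lemma pairing_smult_left:
  "pairing (Poly_Mapping.map ((*) c) f) z = c * pairing f z" for c :: "'k::comm_semiring_0"
  by (simp add: pairing_def sum_distrib_left mult.assoc)

text \<open>This is the second coordinate of the product in the trivial extension. By trilinearity
  it suffices to take monomials \<open>a\<close>, \<open>b\<close>, \<open>c\<close>. At most one
  term on the right survives, depending on which of \<open>a\<close> and \<open>b\<close> is dual,
  and the duality axioms identify it with the left side.\<close>

lemma pairing_conv_mult:
  fixes f g z :: "'m \<Rightarrow>\<^sub>0 'k::comm_semiring_0"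
  assumes "keys f \<subseteq> M" "keys g \<subseteq> M" "keys z \<subseteq> P"
  shows "pairing (conv_mult mul f g) z =
    pairing g (conv_mult mul z (proj f)) + pairing f (conv_mult mul (proj g) z)"
proof (rule poly_mapping_additive_eqI[of _ _ f])
  fix a and x :: 'k assume a: "a \<in> keys f"
  let ?a = "single a x"
  show "pairing (conv_mult mul ?a g) z =
    pairing g (conv_mult mul z (proj ?a)) + pairing ?a (conv_mult mul (proj g) z)"
  proof (rule poly_mapping_additive_eqI[of _ _ g])
    fix b and y :: 'k assume b: "b \<in> keys g"
    let ?b = "single b y"
    show "pairing (conv_mult mul ?a ?b) z =
      pairing ?b (conv_mult mul z (proj ?a)) + pairing ?a (conv_mult mul (proj ?b) z)"
    proof (rule poly_mapping_additive_eqI[of _ _ z])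
      fix c and w :: 'k assume "c \<in> keys z"
      then have c: "c \<in> P" using assms by auto
      have pair: "lookup (opt_single r u) (d c) = (if r = Some (d c) then u else 0)" for r and u :: 'k
        by (cases r) (auto simp: lookup_single when_def)
      have pair': "pairing (single (d q) u) (opt_single r v) =
          (if r = Some q then u * v else 0)"
        if "q \<in> P" "\<And>s. r = Some s \<Longrightarrow> s \<in> P" for q r and u v :: 'k
        using that inj_onD[OF inj_d, of q] by (cases r) (auto simp: lookup_single when_def)
      have pair0: "pairing (single q u) (opt_single r v) = 0"
        if "q \<in> P" "\<And>s. r = Some s \<Longrightarrow> s \<in> P" for q r and u v :: 'k
        using that disj by (cases r) (auto simp: lookup_single when_def)
      show "pairing (conv_mult mul ?a ?b) (single c w) =
        pairing ?b (conv_mult mul (single c w) (proj ?a)) +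
        pairing ?a (conv_mult mul (proj ?b) (single c w))"
      proof (cases "a \<in> P"; cases "b \<in> P")
        assume "a \<in> P" "b \<in> P"
        then have "mul a b \<noteq> Some (d c)"
          using mul_P disj c by blast
        then show ?thesis
          using \<open>a \<in> P\<close> \<open>b \<in> P\<close> mul_P[OF c \<open>a \<in> P\<close>] mul_P[OF \<open>b \<in> P\<close> c]
          by (simp add: pair pair0)
      next
        assume "a \<in> P" "b \<notin> P"
        moreover then obtain b' where "b = d b'" "b' \<in> P"
          using b assms M_eq by auto
        ultimately show ?thesis
          using c mul_P[OF c \<open>a \<in> P\<close>] by (simp add: pair pair' mul_d_right mult_ac)
      next
        assume "a \<notin> P" "b \<in> P"
        moreover then obtain a' where "a = d a'" "a' \<in> P"
          using a assms M_eq by auto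
        ultimately show ?thesis
          using c mul_P[OF \<open>b \<in> P\<close> c] by (simp add: pair pair' mul_d_left mult_ac)
      next
        assume "a \<notin> P" "b \<notin> P"
        obtain a' where "a = d a'" "a' \<in> P"
          using \<open>a \<notin> P\<close> a assms(1) M_eq by auto
        moreover obtain b' where "b = d b'" "b' \<in> P"
          using \<open>b \<notin> P\<close> b assms(2) M_eq by auto
        ultimately show ?thesis
          using \<open>a \<notin> P\<close> \<open>b \<notin> P\<close>
          by (simp add: mul_d_d)
      qed
    qed (auto simp: conv_mult_bilinear pairing_add_left pairing_add_right algebra_simps)
  qed (auto simp: conv_mult_bilinear pairing_add_left pairing_add_right algebra_simps)
qed (auto simp: conv_mult_bilinear pairing_add_left pairing_add_right algebra_simps)

lemma proj_conv_mult:
  assumes "keys f \<subseteq> M" "keys g \<subseteq> M"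
  shows "proj (conv_mult mul f g) = conv_mult mul (proj f) (proj g)"
  unfolding proj_def
proof (rule conv_mult_lin_lift)
  fix q p assume "q \<in> keys f" "p \<in> keys g"
  then have qp: "q \<in> P \<union> d ` P" "p \<in> P \<union> d ` P" "q \<in> M" "p \<in> M"
    using assms M_eq by auto
  show "Option.bind (mul q p) (\<lambda>p. if p \<in> P then Some p else None) =
    Option.bind (if q \<in> P then Some q else None)
      (\<lambda>a. Option.bind (if p \<in> P then Some p else None) (mul a))"
  proof (cases "mul q p")
    case None
    then show ?thesis by simp
  next
    case (Some r)
    show ?thesis
    proof (cases "q \<in> P \<and> p \<in> P")
      case True
      then show ?thesis using Some mul_P[of q p r] by simp
    next
      case False
      then show ?thesis using Some mul_not_P[OF qp(3,4) _ Some] by auto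
    qed
  qed
qed

lemma pairing_keys_eq_0: "keys f \<subseteq> P \<Longrightarrow> keys z \<subseteq> P \<Longrightarrow> pairing f z = 0"
  unfolding pairing_def
proof (intro sum.neutral ballI)
  fix p assume "keys f \<subseteq> P" "keys z \<subseteq> P" "p \<in> keys z"
  then have "d p \<notin> keys f" using disj by blast
  then show "lookup f (d p) * lookup z p = 0" by (simp add: in_keys_iff)
qed

theorem trivial_extension_mono_alg:
  "alg_isomorphic (mono_alg M E mul :: ('k::field, _) module) (trivial_extension (mono_alg P E mul))"
proof -
  let ?A = "mono_alg M E mul :: ('k, _) module"
  let ?B = "mono_alg P E mul :: ('k, _) module"
  define F where "F = (\<lambda>f :: 'm \<Rightarrow>\<^sub>0 'k. (proj f, \<lambda>z\<in>carrier ?B. pairing f z))"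
  have PM: "P \<subseteq> M" using M_eq by auto
  have keys_proj: "keys (proj f) \<subseteq> P" for f :: "'m \<Rightarrow>\<^sub>0 'k"
    by (auto simp: in_keys_iff lookup_proj split: if_splits)
  have keys_P: "keys (conv_mult mul f g) \<subseteq> P" if "keys f \<subseteq> P" "keys g \<subseteq> P" for f g :: "'m \<Rightarrow>\<^sub>0 'k"
  proof -
    have "keys (conv_mult mul f g) \<subseteq> (\<Union>q\<in>keys f. \<Union>p\<in>keys g. set_option (mul q p))"
      unfolding conv_mult_def
      by (rule order.trans[OF keys_sum_subset] UN_mono order.refl keys_opt_single_subset)+
    then show ?thesis
      using that mul_P by fastforce
  qed
  have keys_add_P: "keys (f + g) \<subseteq> P" if "keys f \<subseteq> P" "keys g \<subseteq> P" for f g :: "'m \<Rightarrow>\<^sub>0 'k"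
    using that by (intro order.trans[OF Poly_Mapping.keys_add]) auto
  have keys_smult_P: "keys (Poly_Mapping.map ((*) c) f) \<subseteq> P" if "keys f \<subseteq> P" for c and f :: "'m \<Rightarrow>\<^sub>0 'k"
    by (rule order.trans[OF keys_map_mult_subset that])
  have F_closed: "F f \<in> carrier (trivial_extension ?B)" if "f \<in> carrier ?A" for f
    using keys_proj keys_add_P keys_smult_P
    by (auto simp: F_def alg_dual_iff pairing_add_right pairing_smult_right)
  have "bij_betw F (carrier ?A) (carrier (trivial_extension ?B))"
  proof (rule bij_betwI')
    fix f g assume f: "f \<in> carrier ?A" and g: "g \<in> carrier ?A"
    show "(F f = F g) = (f = g)"
    proof
      assume eq: "F f = F g"
      show "f = g"
      proof (rule poly_mapping_eqI)
        fix k
        consider "k \<in> P" | p where "p \<in> P" "k = d p" | "k \<notin> M" using M_eq by auto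
        then show "lookup f k = lookup g k"
        proof cases
          case 1
          have "proj f = proj g" using eq by (simp add: F_def)
          then have "lookup (proj f) k = lookup (proj g) k" by simp
          then show ?thesis using 1 by (simp add: lookup_proj)
        next
          case 2
          have "snd (F f) (single p 1) = snd (F g) (single p 1)"
            using eq by simp
          then show ?thesis using 2 by (simp add: F_def)
        next
          case 3
          then have "k \<notin> keys f" "k \<notin> keys g" using f g by auto
          then show ?thesis by (simp add: in_keys_iff)
        qed
      qed
    qed simp
  next
    fix y assume "y \<in> carrier (trivial_extension ?B)"
    then obtain f \<phi> where y: "y = (f, \<phi>)" and f: "keys f \<subseteq> P" and \<phi>: "\<phi> \<in> alg_dual ?B"
      by auto
    \<comment> \<open>The expansion of \<open>\<phi>\<close> in the dual basis, which exists because
      \<open>P\<close> is finite.\<close>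
    define h where "h = (\<Sum>p\<in>P. single (d p) (\<phi> (single p 1)))"
    have h0: "lookup h k = 0" if "k \<notin> d ` P" for k
      using that by (auto simp: h_def lookup_sum lookup_single when_def intro!: sum.neutral)
    have hd: "lookup h (d p) = \<phi> (single p 1)" if "p \<in> P" for p
    proof -
      have "lookup h (d p) = (\<Sum>q\<in>P. if q = p then \<phi> (single p 1) else 0)"
        unfolding h_def lookup_sum
        by (rule sum.cong) (use that inj_d in \<open>auto simp: lookup_single when_def inj_on_eq_iff\<close>)
      then show ?thesis using that finite_P by simp
    qed
    have \<phi>0: "\<phi> 0 = 0"
      using \<phi> by (auto simp: alg_dual_iff dest!: spec[of _ 0] bspec[of _ _ 0])
    have \<phi>_sum: "\<phi> (sum u S) = (\<Sum>i\<in>S. \<phi> (u i))" if "\<And>i. i \<in> S \<Longrightarrow> keys (u i) \<subseteq> P" for u and S :: "'m set"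
      using that
    proof (induction S rule: infinite_finite_induct)
      case (insert i S)
      have "keys (sum u S) \<subseteq> P"
        by (rule order.trans[OF keys_sum_subset]) (use insert in auto)
      then show ?case using insert \<phi> by (auto simp: alg_dual_iff)
    qed (auto simp: \<phi>0)
    have pair: "pairing (f + h) z = \<phi> z" if z: "keys z \<subseteq> P" for z
    proof -
      have "z = (\<Sum>k\<in>keys z. single k (lookup z k))"
        by (rule poly_mapping_eqI) (simp add: lookup_sum lookup_single when_def in_keys_iff)
      moreover have "keys (single k (lookup z k)) \<subseteq> P" if "k \<in> keys z" for k
        using that z by auto
      ultimately have "\<phi> z = (\<Sum>k\<in>keys z. \<phi> (single k (lookup z k)))"
        using \<phi>_sum[of "keys z" "\<lambda>k. single k (lookup z k)"] by metis
      also have "\<dots> = (\<Sum>k\<in>keys z. lookup h (d k) * lookup z k)"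
      proof (rule sum.cong[OF refl])
        fix k assume "k \<in> keys z"
        then have k: "k \<in> P" using z by auto
        have "\<forall>c. \<forall>x\<in>carrier ?B. \<phi> (c \<odot>\<^bsub>?B\<^esub> x) = c * \<phi> x"
          using \<phi> unfolding alg_dual_iff by blast
        from bspec[OF spec[OF this], of "single k 1" "lookup z k"]
        have "\<phi> (single k (lookup z k)) = lookup z k * \<phi> (single k 1)"
          using k by simp
        then show "\<phi> (single k (lookup z k)) = lookup h (d k) * lookup z k"
          using k by (simp add: hd mult.commute)
      qed
      also have "\<dots> = pairing h z"
        by (simp add: pairing_def)
      also have "\<dots> = pairing (f + h) z"
        using f z by (simp add: pairing_add_left pairing_keys_eq_0)
      finally show ?thesis by simp
    qed
    have "proj (f + h) = f"
    proof (rule poly_mapping_eqI)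
      fix k show "lookup (proj (f + h)) k = lookup f k"
        using f disj h0[of k] by (auto simp: lookup_proj lookup_add in_keys_iff subset_iff)
    qed
    then have "F (f + h) = y"
      using \<phi> pair by (auto simp: F_def y alg_dual_iff extensional_def fun_eq_iff)
    moreover have "keys (f + h) \<subseteq> M"
    proof (rule keys_add_closed)
      show "keys h \<subseteq> M"
        using h0 M_eq by (auto simp: in_keys_iff)
    qed (use f PM in auto)
    ultimately show "\<exists>x\<in>carrier ?A. y = F x" by auto
  qed (use F_closed in auto)
  moreover have "F \<in> ring_hom ?A (trivial_extension ?B)"
  proof (rule ring_hom_memI)
    fix f g assume fg: "f \<in> carrier ?A" "g \<in> carrier ?A"
    show "F (f \<otimes>\<^bsub>?A\<^esub> g) = F f \<otimes>\<^bsub>trivial_extension ?B\<^esub> F g"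
      using fg keys_proj keys_P
      by (auto simp: F_def proj_conv_mult pairing_conv_mult fun_eq_iff)
    show "F (f \<oplus>\<^bsub>?A\<^esub> g) = F f \<oplus>\<^bsub>trivial_extension ?B\<^esub> F g"
      by (auto simp: F_def pairing_add_left fun_eq_iff)
  next
    have keys_one_P: "keys \<one>\<^bsub>?B\<^esub> \<subseteq> P"
      unfolding mono_alg_simps by (rule order.trans[OF keys_sum_subset]) (use units_P in auto)
    have "proj \<one>\<^bsub>?B\<^esub> = \<one>\<^bsub>?B\<^esub>"
      using keys_one_P by (intro poly_mapping_eqI) (auto simp: lookup_proj subset_iff in_keys_iff)
    then show "F \<one>\<^bsub>?A\<^esub> = \<one>\<^bsub>trivial_extension ?B\<^esub>"
      using keys_one_P by (auto simp: F_def pairing_keys_eq_0 fun_eq_iff)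
  qed (use F_closed in auto)
  moreover have "F (c \<odot>\<^bsub>?A\<^esub> f) = c \<odot>\<^bsub>trivial_extension ?B\<^esub> F f" for c f
    by (auto simp: F_def pairing_smult_left fun_eq_iff proj_def lin_lift_map_mult)
  ultimately show ?thesis
    unfolding alg_isomorphic_def ring_iso_def by blast
qed

end

text \<open>The kernel of the linear extension of \<open>\<rho>\<close> is spanned by the
  \<open>p\<close> with value \<open>None\<close> and by the differences of basis elements of equal
  value. So \<open>R\<close> generates it once every ideal containing \<open>R\<close> contains
  these. Quantifying over ideals avoids describing the elements of the generated ideal.\<close>

theorem quot_mono_alg_isomorphic:
  fixes \<rho> :: "'n \<Rightarrow> 'm option" and R :: "('n \<Rightarrow>\<^sub>0 'k::field) set"
  assumes "partial_monoid N EN mulN" "partial_monoid M EM mulM"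
    and \<rho>_mul: "\<And>q p. q \<in> N \<Longrightarrow> p \<in> N \<Longrightarrow>
      Option.bind (mulN q p) \<rho> = Option.bind (\<rho> q) (\<lambda>a. Option.bind (\<rho> p) (mulM a))"
    and \<rho>_units: "bij_betw u EN EM" "\<And>e. e \<in> EN \<Longrightarrow> \<rho> e = Some (u e)"
    and \<rho>_closed: "\<And>p m. p \<in> N \<Longrightarrow> \<rho> p = Some m \<Longrightarrow> m \<in> M"
    and \<rho>_surj: "\<And>m. m \<in> M \<Longrightarrow> \<exists>p\<in>N. \<rho> p = Some m"
    and R: "\<And>r. r \<in> R \<Longrightarrow> keys r \<subseteq> N" "\<And>r. r \<in> R \<Longrightarrow> lin_lift \<rho> r = 0"
    and None_I: "\<And>I p. \<lbrakk>ideal I (mono_alg N EN mulN); R \<subseteq> I; p \<in> N; \<rho> p = None\<rbrakk> \<Longrightarrow>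
      single p 1 \<in> I"
    and Some_I: "\<And>I p q m. \<lbrakk>ideal I (mono_alg N EN mulN); R \<subseteq> I; p \<in> N; q \<in> N;
      \<rho> p = Some m; \<rho> q = Some m\<rbrakk> \<Longrightarrow> single p 1 - single q 1 \<in> I"
  defines "Q \<equiv> alg_quot (mono_alg N EN mulN) (genideal (mono_alg N EN mulN) R)"
  shows "alg_isomorphic Q (mono_alg M EM mulM)"
    and "\<And>c X. X \<in> carrier Q \<Longrightarrow> c \<odot>\<^bsub>Q\<^esub> X \<in> carrier Q"
    and "ring Q"
proof -
  interpret N: partial_monoid N EN mulN by fact
  interpret M: partial_monoid M EM mulM by fact
  let ?A = "mono_alg N EN mulN :: ('k, _) module"
  let ?B = "mono_alg M EM mulM :: ('k, _) module"
  interpret A: ring ?A by (rule N.ring_mono_alg)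
  interpret B: ring ?B by (rule M.ring_mono_alg)
  let ?h = "lin_lift \<rho> :: ('n \<Rightarrow>\<^sub>0 'k) \<Rightarrow> _"
  have closed: "keys (?h f) \<subseteq> M" if "keys f \<subseteq> N" for f
  proof -
    have "keys (?h f) \<subseteq> (\<Union>p\<in>keys f. set_option (\<rho> p))"
      unfolding lin_lift_def
      by (rule order.trans[OF keys_sum_subset] UN_mono order.refl keys_opt_single_subset)+
    then show ?thesis using that \<rho>_closed by fastforce
  qed
  have one: "?h \<one>\<^bsub>?A\<^esub> = \<one>\<^bsub>?B\<^esub>"
    using \<rho>_units by (simp add: lin_lift_sum sum.reindex_bij_betw[symmetric])
  interpret h: ring_hom_ring ?A ?B ?h
    by (rule ring_hom_ringI)
      (use closed one N.ring_mono_alg M.ring_mono_alg in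
        \<open>auto simp: lin_lift_add subset_iff intro!: conv_mult_lin_lift \<rho>_mul\<close>)
  define I where "I = genideal ?A R"
  have "R \<subseteq> carrier ?A" using R(1) by auto
  then interpret I: ideal I ?A unfolding I_def by (rule A.genideal_ideal)
  have RI: "R \<subseteq> I"
    unfolding I_def using \<open>R \<subseteq> carrier ?A\<close> by (rule A.genideal_self)
  have I_add: "f + g \<in> I" if "f \<in> I" "g \<in> I" for f g
    using I.a_closed[of f g] that by simp
  have I_0: "0 \<in> I"
    using I.zero_closed by simp
  have I_sum: "sum u S \<in> I" if "\<And>i. i \<in> S \<Longrightarrow> u i \<in> I" for u and S :: "'x set"
    using that by (induction S rule: infinite_finite_induct) (auto simp: I_0 I_add)
  \<comment> \<open>Ideals refer to the ring structure only; scalars are absorbed because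
    \<open>c\<close> acts as multiplication by \<open>c\<close> times the identity.\<close>
  have I_smult: "Poly_Mapping.map ((*) c) f \<in> I" if "f \<in> I" for c f
  proof -
    have f: "f \<in> carrier ?A" using that I.a_subset by auto
    have c1: "Poly_Mapping.map ((*) c) \<one>\<^bsub>?A\<^esub> \<in> carrier ?A"
      using N.keys_one[where 'k = 'k] keys_map_mult_subset by fastforce
    have "conv_mult mulN (Poly_Mapping.map ((*) c) u) v = Poly_Mapping.map ((*) c) (conv_mult mulN u v)" for u v
    proof (rule poly_mapping_additive_eqI[of _ _ u])
      fix a x
      show "conv_mult mulN (Poly_Mapping.map ((*) c) (single a x)) v =
        Poly_Mapping.map ((*) c) (conv_mult mulN (single a x) v)"
        by (rule poly_mapping_additive_eqI[of _ _ v])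
          (auto simp: conv_mult_bilinear map_mult_add mult.assoc)
    qed (auto simp: conv_mult_bilinear map_mult_add)
    then have "Poly_Mapping.map ((*) c) f = (Poly_Mapping.map ((*) c) \<one>\<^bsub>?A\<^esub>) \<otimes>\<^bsub>?A\<^esub> f"
      using f by (simp add: N.conv_mult_one_left)
    then show ?thesis
      using I.I_l_closed[OF that c1] by simp
  qed
  have kernel: "a_kernel ?A ?B ?h = I"
  proof
    have "ideal (a_kernel ?A ?B ?h) ?A" by (rule h.kernel_is_ideal)
    moreover have "R \<subseteq> a_kernel ?A ?B ?h"
    proof
      fix r assume r: "r \<in> R"
      show "r \<in> a_kernel ?A ?B ?h"
        unfolding a_kernel_def' using R(1)[OF r] R(2)[OF r] by simp
    qed
    ultimately show "I \<subseteq> a_kernel ?A ?B ?h"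
      unfolding I_def by (rule A.genideal_minimal)
    \<comment> \<open>A section of \<open>\<rho>\<close>. Following \<open>\<rho>\<close> by it
      gives \<open>t\<close>, which vanishes on the kernel, while \<open>f - t f\<close> is visibly
      a combination of elements that must lie in \<open>I\<close>.\<close>
    define s where "s m = (SOME p. p \<in> N \<and> \<rho> p = Some m)" for m
    have s: "s m \<in> N" "\<rho> (s m) = Some m" if "m \<in> M" for m
      using someI_ex[of "\<lambda>p. p \<in> N \<and> \<rho> p = Some m"] \<rho>_surj[OF that] unfolding s_def by auto
    define t :: "('n \<Rightarrow>\<^sub>0 'k) \<Rightarrow> _" where "t = lin_lift (\<lambda>p. map_option s (\<rho> p))"
    have t: "t f = lin_lift (\<lambda>m. Some (s m)) (?h f)" for f :: "'n \<Rightarrow>\<^sub>0 'k"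
    proof (rule poly_mapping_additive_eqI[of _ _ f])
      fix k c show "t (single k c) =
          lin_lift (\<lambda>m. Some (s m)) (?h (single k c))"
        by (cases "\<rho> k") (auto simp: t_def)
    qed (auto simp: t_def lin_lift_add)
    show "a_kernel ?A ?B ?h \<subseteq> I"
    proof
      fix f assume "f \<in> a_kernel ?A ?B ?h"
      then have f: "keys f \<subseteq> N" "?h f = 0" unfolding a_kernel_def' by simp_all
      have "t f = 0" unfolding t f(2) by simp
      then have "f = f - t f" by simp
      also have "\<dots> = (\<Sum>k\<in>keys f. Poly_Mapping.map ((*) (lookup f k))
          (single k 1 - opt_single (map_option s (\<rho> k)) 1))"
      proof -
        have "f = (\<Sum>k\<in>keys f. single k (lookup f k))"
          by (rule poly_mapping_eqI) (simp add: lookup_sum lookup_single when_def in_keys_iff)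
        then have "f - t f = (\<Sum>k\<in>keys f. single k (lookup f k)) - t f"
          by (rule arg_cong)
        also have "\<dots> = (\<Sum>k\<in>keys f. single k (lookup f k) -
            opt_single (map_option s (\<rho> k)) (lookup f k))"
          by (simp add: t_def lin_lift_def sum_subtractf)
        also have "\<dots> = (\<Sum>k\<in>keys f. Poly_Mapping.map ((*) (lookup f k))
          (single k 1 - opt_single (map_option s (\<rho> k)) 1))"
        proof (rule sum.cong[OF refl])
          fix k show "single k (lookup f k) - opt_single (map_option s (\<rho> k)) (lookup f k) =
            Poly_Mapping.map ((*) (lookup f k))
              (single k 1 - opt_single (map_option s (\<rho> k)) 1)"
            by (cases "\<rho> k")
              (auto intro!: poly_mapping_eqI simp: lookup_minus lookup_single when_def)
        qed
        finally show ?thesis .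
      qed
      also have "\<dots> \<in> I"
      proof (rule I_sum, rule I_smult)
        fix k assume "k \<in> keys f"
        then have k: "k \<in> N" using f by auto
        show "single k 1 - opt_single (map_option s (\<rho> k)) 1 \<in> I"
        proof (cases "\<rho> k")
          case None
          then show ?thesis using None_I[OF I.ideal_axioms RI k] by simp
        next
          case (Some m)
          then have "m \<in> M" using k \<rho>_closed by blast
          then show ?thesis using Some_I[OF I.ideal_axioms RI k s(1) Some s(2)] Some by simp
        qed
      qed
      finally show "f \<in> I" .
    qed
  qed
  have surj: "?h ` carrier ?A = carrier ?B"
  proof
    show "carrier ?B \<subseteq> ?h ` carrier ?A"
    proof
      fix g assume g: "g \<in> carrier ?B"
      obtain s where s: "\<And>m. m \<in> M \<Longrightarrow> s m \<in> N \<and> \<rho> (s m) = Some m"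
        using \<rho>_surj by metis
      let ?f = "\<Sum>k\<in>keys g. single (s k) (lookup g k)"
      have "keys ?f \<subseteq> N"
        by (rule order.trans[OF keys_sum_subset]) (use s g in \<open>auto split: if_splits\<close>)
      moreover have "?h ?f = (\<Sum>k\<in>keys g. single k (lookup g k))"
        unfolding lin_lift_sum by (rule sum.cong) (use s g in auto)
      moreover have "\<dots> = g"
        by (rule poly_mapping_eqI) (simp add: lookup_sum lookup_single when_def in_keys_iff)
      ultimately show "g \<in> ?h ` carrier ?A" by (auto intro!: image_eqI[of _ _ ?f])
    qed
  qed (use closed in auto)
  have sm: "c \<odot>\<^bsub>?A\<^esub> x \<in> carrier ?A \<and> ?h (c \<odot>\<^bsub>?A\<^esub> x) = c \<odot>\<^bsub>?B\<^esub> ?h x" if "x \<in> carrier ?A" for c x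
    using that keys_map_mult_subset by (fastforce simp: lin_lift_map_mult)
  note iso = alg_quot_isomorphic[OF h.ring_hom_ring_axioms surj sm kernel]
  show "alg_isomorphic Q ?B" "ring Q" "\<And>c X. X \<in> carrier Q \<Longrightarrow> c \<odot>\<^bsub>Q\<^esub> X \<in> carrier Q"
    using iso unfolding Q_def I_def by blast+
qed

section \<open>Lines in a pedigree\<close>

text \<open>Points are words in two letters. With \<open>False\<close> for \<alpha> and
  \<open>True\<close> for \<beta>, both directions are handled by the same statements.\<close>

fun ext :: "bool \<Rightarrow> ped_point \<Rightarrow> ped_point" where
  "ext False x = Alpha_End x"
| "ext True x = Beta_End x"

text \<open>The point nearest to the root on the line of direction \<open>d\<close>, obtained by
  stripping all final letters \<open>d\<close>. It serves as the name of the line: two points are on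
  a common line of direction \<open>d\<close> exactly when these tops agree.\<close>

fun ltop :: "bool \<Rightarrow> ped_point \<Rightarrow> ped_point" where
  "ltop d Omega = Omega"
| "ltop d (Alpha_End x) = (if d then Alpha_End x else ltop d x)"
| "ltop d (Beta_End x) = (if d then ltop d x else Beta_End x)"

lemma ltop_ext [simp]: "ltop d (ext d x) = ltop d x" "ltop (\<not> d) (ext d x) = ext d x"
  by (cases d; simp)+

lemma size_ext [simp]: "size (ext d x) = Suc (size x)"
  by (cases d) simp_all

lemma ext_inject [simp]: "ext d x = ext d' y \<longleftrightarrow> d = d' \<and> x = y"
  by (cases d; cases d') auto

lemma ped_point_induct [case_names Omega ext]:
  assumes "Q Omega" "\<And>d x. Q x \<Longrightarrow> Q (ext d x)"
  shows "Q x"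
  using assms(1) assms(2)[of _ False] assms(2)[of _ True] by (induction x) auto

lemma ltop_ltop [simp]: "ltop d (ltop d x) = ltop d x"
  by (induction d x rule: ltop.induct) auto

lemma size_ltop: "ltop d x = x \<or> size (ltop d x) < size x"
  by (induction d x rule: ltop.induct) auto

lemma size_ltop_le: "size (ltop d x) \<le> size x"
  using size_ltop[of d x] by auto

lemma ltop_cases: "ltop d x = x \<or> (\<exists>y. x = ext d y)"
  by (cases x; cases d) auto

text \<open>A word has at most one last letter, so a point is the top of at least one of its two
  lines. The geometry of lines below rests on this.\<close>

lemma ltop_other: "ltop d x \<noteq> x \<Longrightarrow> ltop (\<not> d) x = x"
  using ltop_cases[of d x] by auto

lemma ltop_ext_neq [simp]: "ltop d y \<noteq> ext d x"
proof
  assume "ltop d y = ext d x"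
  then have "ltop d (ext d x) = ext d x" by (metis ltop_ltop)
  then have "size (ltop d x) = Suc (size x)" by simp
  then show False using size_ltop_le[of d x] by simp
qed

lemma same_line_size_less:
  "ltop d x = ltop d y \<Longrightarrow> size x < size y \<Longrightarrow> \<exists>z. y = ext d z \<and> ltop d x = ltop d z \<and> size x \<le> size z"
  using ltop_cases[of d y] size_ltop_le[of d x] by auto

text \<open>The distance \<open>size\<close> from the root is a coordinate on every line.\<close>

lemma same_line_size_eq: "ltop d x = ltop d y \<Longrightarrow> size x = size y \<Longrightarrow> x = y"
proof (induction x arbitrary: y rule: ped_point_induct)
  case Omega
  then show ?case by (cases y) auto
next
  case (ext e x)
  show ?case
  proof (cases "e = d")
    case True
    then obtain z where "y = ext d z"
      using ltop_cases[of d y] ext.prems size_ltop_le[of d x] by auto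
    then show ?thesis using ext True by auto
  next
    case False
    then have "ltop d (ext e x) = ext e x" using ltop_ext(2)[of "\<not> d" x] by (cases "e = (\<not> d)") auto
    then show ?thesis using ext.prems size_ltop[of d y] by auto
  qed
qed

text \<open>If \<open>u\<close> is the top of one common line and \<open>v\<close> is another point
  of it, then \<open>v\<close> is deeper than \<open>u\<close>. But \<open>v\<close> is then the top
  of the second common line, hence not deeper than \<open>u\<close>.\<close>

lemma two_lines:
  assumes "ltop d x = ltop d y" "ltop (\<not> d) x = ltop (\<not> d) y"
  shows "x = y"
proof -
  have *: "u = v" if "ltop e u = u" "ltop e u = ltop e v" "ltop (\<not> e) u = ltop (\<not> e) v" for e u v
  proof (rule ccontr)
    assume "u \<noteq> v"
    then have v: "ltop e v \<noteq> v" using that by simp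
    then have "size u < size v" using size_ltop[of e v] that by simp
    moreover have "size v \<le> size u"
      using ltop_other[OF v] that(3) size_ltop_le[of "\<not> e" u] by simp
    ultimately show False by simp
  qed
  show ?thesis
    using *[of d x y] *[of "\<not> d" x y] ltop_other[of d x] assms by auto
qed

text \<open>A coordinate that increases along the arrows: \<alpha> leads away from the root and
  \<beta> towards it, whence the sign.\<close>

definition pos :: "bool \<Rightarrow> ped_point \<Rightarrow> int"
  where "pos d x = (if d then - int (size x) else int (size x))"

lemma pos_eq: "ltop d x = ltop d y \<Longrightarrow> pos d x = pos d y \<Longrightarrow> x = y"
  using same_line_size_eq[of d x y] by (auto simp: pos_def split: if_splits)

text \<open>The vertex set of a pedigree, as a finite set of words closed under prefixes.\<close>

locale ped_set =
  fixes P :: "ped_point set"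
  assumes finite_P [simp]: "finite P" and Omega_P [simp]: "Omega \<in> P"
    and ext_P: "ext d x \<in> P \<Longrightarrow> x \<in> P"
begin

text \<open>There is a nonzero path of \<open>A_L\<close> from \<open>x\<close> to \<open>y\<close>.
  The relation is not transitive, since a path that changes its line vanishes.\<close>

definition le :: "ped_point \<Rightarrow> ped_point \<Rightarrow> bool"
  where "le x y \<longleftrightarrow> x \<in> P \<and> y \<in> P \<and> (\<exists>d. ltop d x = ltop d y \<and> pos d x \<le> pos d y)"

lemma le_P: "le x y \<Longrightarrow> x \<in> P" "le x y \<Longrightarrow> y \<in> P"
  by (auto simp: le_def)

lemma le_refl: "x \<in> P \<Longrightarrow> le x x"
  by (auto simp: le_def)

lemma le_line: "le x y \<Longrightarrow> ltop d x = ltop d y \<Longrightarrow> pos d x \<le> pos d y"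
proof -
  assume "le x y" and d: "ltop d x = ltop d y"
  then obtain e where e: "ltop e x = ltop e y" "pos e x \<le> pos e y"
    by (auto simp: le_def)
  show "pos d x \<le> pos d y"
  proof (cases "e = d")
    case False
    then have "e = (\<not> d)" by auto
    then show ?thesis using two_lines[of d x y] d e by simp
  qed (use e in simp)
qed

lemma le_antisym: "le x y \<Longrightarrow> le y x \<Longrightarrow> x = y"
  by (metis antisym le_def le_line pos_eq)

lemma leE:
  assumes "le x y"
  obtains d where "ltop d x = ltop d y" "pos d x \<le> pos d y"
  using assms by (auto simp: le_def)

text \<open>Two of the three directions coincide, so the lines concerned are one line, and the third
  line meets it in two points.\<close>

lemma triangle:
  assumes "ltop d x = ltop d y" "ltop e y = ltop e z" "ltop f x = ltop f z"
  shows "x = y \<or> y = z \<or> x = z \<or> (d = e \<and> e = f)"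
  using assms two_lines[of True x y] two_lines[of True y z] two_lines[of True x z]
  by (cases d; cases e; cases f) auto

text \<open>A corner farthest from the root would lie strictly below the tops of both its lines,
  which \<open>ltop_other\<close> forbids.\<close>

lemma quadrangle:
  assumes "ltop d x = ltop d y" "ltop (\<not> d) y = ltop (\<not> d) z" "ltop d z = ltop d w" "ltop (\<not> d) w = ltop (\<not> d) x"
  shows "x = y \<or> y = z \<or> z = w \<or> w = x"
proof (rule ccontr)
  assume neq: "\<not> ?thesis"
  have False if "ltop e a = ltop e b" "ltop (\<not> e) a = ltop (\<not> e) c" "a \<noteq> b" "a \<noteq> c"
    "size b \<le> size a" "size c \<le> size a" for e a b c
  proof -
    have lt: "ltop f u \<noteq> u" if "ltop f u = ltop f v" "u \<noteq> v" "size v \<le> size u" for f u v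
      using that size_ltop[of f v] same_line_size_eq[of f u v] by (metis leD)
    show False using lt[of e a b] lt[of "\<not> e" a c] that ltop_other by metis
  qed
  note * = this[of d] this[of "\<not> d"]
  have "(size y \<le> size x \<and> size w \<le> size x) \<or> (size x \<le> size y \<and> size z \<le> size y) \<or>
    (size y \<le> size z \<and> size w \<le> size z) \<or> (size x \<le> size w \<and> size z \<le> size w)"
    by linarith
  then show False
    using *(1)[of x y w] *(1)[of y x z] *(1)[of z w y] *(1)[of w z x] assms neq by metis
qed

text \<open>The core of associativity: when the total product of three paths is nonzero, so are the
  partial products. If the four points are distinct, \<open>triangle\<close> and
  \<open>quadrangle\<close> force them onto one line, where positions decide.\<close>

lemma le_chain:
  assumes "le x y" "le y z" "le z w" "le x w"
  shows "le x z" "le y w"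
proof -
  obtain a b c e where l: "ltop a x = ltop a y" "ltop b y = ltop b z" "ltop c z = ltop c w" "ltop e x = ltop e w"
    and p: "pos a x \<le> pos a y" "pos b y \<le> pos b z" "pos c z \<le> pos c w" "pos e x \<le> pos e w"
    using assms by (metis leE)
  have P: "x \<in> P" "y \<in> P" "z \<in> P" "w \<in> P" using assms le_P by auto
  have "(le x z \<and> le y w)"
  proof (cases "x = y \<or> y = z \<or> z = w \<or> w = x \<or> x = z \<or> y = w")
    case True
    then show ?thesis using assms le_antisym le_refl P
      by (smt (verit) le_def le_line pos_eq triangle order.trans)
  next
    case False
    have "a = b \<and> b = c \<and> c = e"
    proof -
      have "a = b" if "b = c"
        using triangle[of a x y b w e] that l False by auto
      moreover have "b = c" if "a = b"
        using triangle[of a x z c w e] that l False by auto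
      moreover have "c = e" if "a = b"
        using triangle[of a x z c w e] that l False by auto
      moreover have "a = b \<or> b = c"
      proof (rule ccontr)
        assume "\<not> ?thesis"
        then have bc: "b = (\<not> a)" "c = a" by auto
        show False
        proof (cases "e = a")
          case True
          then have "ltop a y = ltop a z" using l bc by simp
          then show False using two_lines[of a y z] l bc False by simp
        next
          case e: False
          then have "e = (\<not> a)" by auto
          then show False using quadrangle[of a x y z w] l bc False by simp
        qed
      qed
      ultimately show ?thesis by argo
    qed
    then have "b = a" "c = a" "e = a" by auto
    then show ?thesis using l p P unfolding le_def by (intro conjI exI[of _ a]) auto
  qed
  then show "le x z" "le y w" by auto
qed

text \<open>
  The triple \<open>(False, x, y)\<close> stands for the path from \<open>x\<close> to \<open>y\<close> along a line, and \<open>(True, x, y)\<close> for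
  the dual of the path from \<open>y\<close> to \<open>x\<close>. Both are composed like paths from \<open>x\<close> to \<open>y\<close>.
\<close>

definition el :: "bool \<Rightarrow> ped_point \<Rightarrow> ped_point \<Rightarrow> bool"
  where "el c x y = (if c then le y x else le x y)"

text \<open>A product exists when its outcome is again a basis element. If one factor is dual, this
  asks for a path from \<open>z\<close> to \<open>x\<close>; together with the other factor it
  composes to the path that the dual factor dualises.\<close>

fun pmul :: "bool \<times> ped_point \<times> ped_point \<Rightarrow> bool \<times> ped_point \<times> ped_point
    \<Rightarrow> (bool \<times> ped_point \<times> ped_point) option"
  where "pmul (d, y', z) (c, x, y) =
    (if y = y' \<and> \<not> (c \<and> d) \<and> el (c \<or> d) x z then Some (c \<or> d, x, z) else None)"

definition "basis = {(c, x, y). el c x y}"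
definition "paths = {(False, x, y) | x y. le x y}"
definition "idems = {(False, x, x) | x. x \<in> P}"

fun dual :: "bool \<times> ped_point \<times> ped_point \<Rightarrow> bool \<times> ped_point \<times> ped_point" where
  "dual (c, x, y) = (\<not> c, y, x)"

lemma basis_iff: "(c, x, y) \<in> basis \<longleftrightarrow> el c x y"
  by (simp add: basis_def)

lemma idems_eq: "idems = (\<lambda>x. (False, x, x)) ` P"
  by (auto simp: idems_def)

lemma basis_assoc:
  assumes "m3 \<in> basis" "m2 \<in> basis" "m1 \<in> basis"
  shows "Option.bind (pmul m3 m2) (\<lambda>x. pmul x m1) = Option.bind (pmul m2 m1) (pmul m3)"
proof -
  obtain c x y where m1: "m1 = (c, x, y)" by (cases m1)
  obtain d y' z where m2: "m2 = (d, y', z)" by (cases m2)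
  obtain e z' w where m3: "m3 = (e, z', w)" by (cases m3)
  show ?thesis
  proof (cases "y' = y \<and> z' = z")
    case True
    have "el c x y" "el d y z" "el e z w"
      using assms True by (auto simp: m1 m2 m3 basis_iff)
    \<comment> \<open>A single dual factor reverses one inequality and also the total one. Read
      cyclically from another starting point, the four points then form a chain again, so the cyclic
      rotations of \<open>le_chain\<close> cover all cases.\<close>
    then have "el (c \<or> d \<or> e) x w \<Longrightarrow> \<not> (c \<and> d) \<Longrightarrow> \<not> (c \<and> e) \<Longrightarrow> \<not> (d \<and> e) \<Longrightarrow>
        el (c \<or> d) x z \<and> el (d \<or> e) y w"
      using le_chain[of x y z w] le_chain[of y z w x] le_chain[of z w x y] le_chain[of w x y z]
      by (auto simp: el_def)
    then show ?thesis
      using True by (cases c; cases d; cases e; auto simp: m1 m2 m3)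
  next
    case False
    then show ?thesis by (auto simp: m1 m2 m3)
  qed
qed

lemma basis_monoid: "partial_monoid basis idems pmul"
proof
  show "finite idems" by (simp add: idems_eq)
  show "idems \<subseteq> basis" by (auto simp: idems_def basis_def el_def le_refl)
  fix a assume "a \<in> basis"
  then obtain c x y where a: "a = (c, x, y)" "el c x y"
    by (auto simp: basis_def)
  then have P: "x \<in> P" "y \<in> P" using le_P by (auto simp: el_def split: if_splits)
  show "\<exists>l\<in>idems. pmul l a = Some a \<and> (\<forall>e\<in>idems - {l}. pmul e a = None)"
    by (rule bexI[of _ "(False, y, y)"]) (use a P in \<open>auto simp: idems_def split: if_splits\<close>)
  show "\<exists>r\<in>idems. pmul a r = Some a \<and> (\<forall>e\<in>idems - {r}. pmul a e = None)"
    by (rule bexI[of _ "(False, x, x)"]) (use a P in \<open>auto simp: idems_def split: if_splits\<close>)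
next
  fix a b c assume "a \<in> basis" "b \<in> basis" "pmul a b = Some c"
  then show "c \<in> basis"
    by (cases a; cases b) (auto simp: basis_def split: if_splits)
qed (rule basis_assoc)

lemma basis_symmetric: "symmetric_monoid basis idems pmul paths dual"
proof -
  interpret partial_monoid basis idems pmul by (rule basis_monoid)
  show ?thesis
  proof
    have "paths \<subseteq> {False} \<times> P \<times> P" by (auto simp: paths_def dest: le_P)
    then show "finite paths" by (rule finite_subset) simp
    show "basis = paths \<union> dual ` paths"
    proof (rule Set.set_eqI)
      fix m :: "bool \<times> ped_point \<times> ped_point"
      obtain c x y where m: "m = (c, x, y)" by (cases m)
      show "m \<in> basis \<longleftrightarrow> m \<in> paths \<union> dual ` paths"
        by (cases c) (auto simp: m basis_iff paths_def el_def image_iff intro!: exI[of _ y] exI[of _ x])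
    qed
    show "idems \<subseteq> paths" "paths \<inter> dual ` paths = {}" "inj_on dual paths"
      by (auto simp: paths_def idems_def le_refl inj_on_def)
    show "c \<in> paths" if "a \<in> paths" "b \<in> paths" "pmul a b = Some c" for a b c
      using that by (auto simp: paths_def el_def split: if_splits)
    show "c \<notin> paths" if "a \<in> basis" "b \<in> basis" "a \<notin> paths \<or> b \<notin> paths" "pmul a b = Some c" for a b c
      using that by (cases a; cases b) (auto simp: paths_def basis_def el_def split: if_splits)
    show "pmul (dual a) (dual b) = None" if "a \<in> paths" "b \<in> paths" for a b
      using that by (auto simp: paths_def)
    show "pmul (dual a) b = Some (dual c) \<longleftrightarrow> pmul b c = Some a"
      "pmul b (dual a) = Some (dual c) \<longleftrightarrow> pmul c b = Some a"
      if "a \<in> paths" "b \<in> paths" "c \<in> paths" for a b c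
      using that by (auto simp: paths_def el_def split: if_splits)
  qed
qed

lemma paths_monoid: "partial_monoid paths idems pmul"
proof -
  interpret symmetric_monoid basis idems pmul paths dual by (rule basis_symmetric)
  have PB: "paths \<subseteq> basis" using M_eq by auto
  show ?thesis
  proof
    show "Option.bind (pmul a b) (\<lambda>x. pmul x c) = Option.bind (pmul b c) (pmul a)"
      if "a \<in> paths" "b \<in> paths" "c \<in> paths" for a b c
      using that PB by (intro mul_assoc) auto
  qed (use PB units_P in \<open>auto intro: mul_P left_unit right_unit finite_units\<close>)
qed

end

section \<open>Closing up the lines to cycles\<close>

context ped_set
begin

definition line :: "bool \<Rightarrow> ped_point \<Rightarrow> ped_point set"
  where "line d x = {y \<in> P. ltop d y = ltop d x}"

lemma ltop_P: "x \<in> P \<Longrightarrow> ltop d x \<in> P"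
proof (induction x rule: ped_point_induct)
  case (ext e x)
  then have "ltop d x \<in> P" using ext_P by blast
  then show ?case using ext.prems ltop_ext(1)[of d x] ltop_ext(2)[of "\<not> d" x]
    by (cases "e = d") auto
qed simp

text \<open>Closure under prefixes makes the part of a line inside \<open>P\<close> a segment
  without gaps.\<close>

lemma ext_below:
  "z \<in> P \<Longrightarrow> ltop d y = ltop d z \<Longrightarrow> size y < size z \<Longrightarrow> ext d y \<in> P"
proof (induction "size z" arbitrary: z rule: less_induct)
  case less
  obtain w where w: "z = ext d w" "ltop d y = ltop d w" "size y \<le> size w"
    using same_line_size_less[OF less.prems(2,3)] by blast
  show ?case
  proof (cases "size y = size w")
    case True
    then show ?thesis using same_line_size_eq[OF w(2)] w(1) less.prems(1) by simp
  next
    case False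
    then show ?thesis using less.hyps[of w] w less.prems(1) ext_P by simp
  qed
qed

text \<open>Moves away from the root in both directions, so that closing up a line is treated once;
  \<open>nxt\<close> inverts it for direction \<open>True\<close>.\<close>

definition down :: "bool \<Rightarrow> ped_point \<Rightarrow> ped_point"
  where "down d x = (if ext d x \<in> P then ext d x else ltop d x)"

lemma down_P: "x \<in> P \<Longrightarrow> down d x \<in> P"
  by (simp add: down_def ltop_P)

lemma ltop_down: "ltop d (down d x) = ltop d x"
  by (simp add: down_def)

lemma inj_down: "inj_on (down d) P"
proof (rule inj_onI)
  fix x y assume P: "x \<in> P" "y \<in> P" and eq: "down d x = down d y"
  then have line: "ltop d x = ltop d y" using ltop_down by metis
  consider "ext d x \<in> P" "ext d y \<in> P" | "ext d x \<notin> P" "ext d y \<notin> P"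
    using eq ltop_ext_neq[of d x y] ltop_ext_neq[of d y x, symmetric] by (auto simp: down_def split: if_splits)
  then show "x = y"
  proof cases
    case 1
    then show ?thesis using eq by (simp add: down_def)
  next
    case 2
    \<comment> \<open>Both points are the last of the line inside \<open>P\<close>, and a segment
      without gaps has only one such end.\<close>
    then have "\<not> size x < size y" "\<not> size y < size x"
      using ext_below[of y d x] ext_below[of x d y] P line by auto
    then show ?thesis using same_line_size_eq[OF line] by simp
  qed
qed

lemma down_image: "down d ` P = P"
  by (rule endo_inj_surj) (auto simp: down_P inj_down)

text \<open>
  The lines of direction \<open>False\<close> are traversed away from the root, those of direction \<open>True\<close>
  towards it, as prescribed by the arrows \<open>Alpha\<close> and \<open>Beta\<close>.
\<close>

definition nxt :: "bool \<Rightarrow> ped_point \<Rightarrow> ped_point"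
  where "nxt d = (if d then inv_into P (down d) else down d)"

text \<open>The step out of \<open>x\<close> is the additional arrow of its line. Lines of direction
  \<open>True\<close> are traversed towards the root, so there the last point is the top.\<close>

definition closing :: "bool \<Rightarrow> ped_point \<Rightarrow> bool"
  where "closing d x \<longleftrightarrow> (if d then ltop d x = x else ext d x \<notin> P)"

lemma nxt_True:
  assumes "x \<in> P"
  shows "nxt True x \<in> P" "down True (nxt True x) = x"
  using assms by (simp_all add: nxt_def inv_into_into f_inv_into_f down_image)

lemma nxt_P: "x \<in> P \<Longrightarrow> nxt d x \<in> P"
  using nxt_True(1) by (cases d) (auto simp: nxt_def down_P)

lemma ltop_nxt: "x \<in> P \<Longrightarrow> ltop d (nxt d x) = ltop d x"
  using nxt_True(2)[of x] ltop_down[of True "nxt True x"] by (cases d) (auto simp: nxt_def ltop_down)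

lemma inj_nxt: "inj_on (nxt d) P"
  by (cases d) (auto simp: nxt_def inj_down down_image inj_on_inv_into)

lemma nxt_pos:
  assumes "x \<in> P" "\<not> closing d x"
  shows "pos d (nxt d x) = pos d x + 1"
proof (cases d)
  case True
  let ?y = "nxt True x"
  have "ext True ?y = x"
  proof (rule ccontr)
    assume "ext True ?y \<noteq> x"
    then have "ltop True ?y = x"
      using nxt_True(2)[OF assms(1)] by (auto simp: down_def split: if_splits)
    then have "ltop True x = x" by (metis ltop_ltop)
    then show False using assms(2) True by (simp add: closing_def)
  qed
  then have "size x = Suc (size ?y)" using size_ext by metis
  then show ?thesis using True by (simp add: pos_def)
next
  case False
  then show ?thesis using assms size_ext[of d x] by (simp add: nxt_def down_def closing_def pos_def)
qed

lemma line_end: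
  assumes "ext d y \<notin> P" "z \<in> P" "ltop d z = ltop d y"
  shows "size z \<le> size y"
  using ext_below[of z d y] assms by (metis not_le_imp_less)

lemma closing_pos:
  assumes "x \<in> P" "closing d x" "z \<in> P" "ltop d z = ltop d x"
  shows "pos d z \<le> pos d x" "pos d (nxt d x) \<le> pos d z"
proof -
  have "pos d z \<le> pos d x \<and> pos d (nxt d x) \<le> pos d z"
  proof (cases d)
    case True
    let ?y = "nxt True x"
    have "ltop True x = x" using assms(2) True by (simp add: closing_def)
    then have "ext True ?y \<noteq> x" using ltop_ext_neq[of True x ?y] by metis
    then have "ext True ?y \<notin> P"
      using nxt_True[OF assms(1)] by (auto simp: down_def split: if_splits)
    moreover have "ltop True z = ltop True ?y" using ltop_nxt[OF assms(1), of True] assms(4) True by simp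
    ultimately have "size z \<le> size ?y" using line_end assms(3) by blast
    moreover have "size x \<le> size z"
      using size_ltop_le[of True z] assms(4) True \<open>ltop True x = x\<close> by simp
    ultimately show ?thesis using True by (simp add: pos_def)
  next
    case False
    then have "size z \<le> size x" using line_end[of d x z] assms by (simp add: closing_def)
    moreover have "nxt d x = ltop d z" using False assms by (simp add: nxt_def down_def closing_def)
    ultimately show ?thesis using False size_ltop_le[of d z] by (simp add: pos_def)
  qed
  then show "pos d z \<le> pos d x" "pos d (nxt d x) \<le> pos d z" by auto
qed

definition lo where "lo d x = Min (pos d ` line d x)"
definition hi where "hi d x = Max (pos d ` line d x)"
text \<open>The positions on a line fill an integer interval, so this is the number of its points;
  \<open>line_iter\<close> makes this precise.\<close>

definition len where "len d x = nat (hi d x - lo d x + 1)"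

lemma finite_line: "finite (line d x)"
  by (simp add: line_def)

lemma pos_bounds:
  assumes "y \<in> P" "ltop d y = ltop d x"
  shows "lo d x \<le> pos d y" "pos d y \<le> hi d x"
  using assms finite_line by (auto simp: lo_def hi_def line_def)

lemma len_pos: "x \<in> P \<Longrightarrow> int (len d x) = hi d x - lo d x + 1"
  using pos_bounds[of x d x] by (simp add: len_def)

lemma len_gt_0: "x \<in> P \<Longrightarrow> 0 < len d x"
  using pos_bounds[of x d x] by (simp add: len_def)

lemma closing_lo_hi:
  assumes "x \<in> P" "closing d x"
  shows "pos d x = hi d x" "pos d (nxt d x) = lo d x"
proof -
  have x: "x \<in> line d x" "nxt d x \<in> line d x"
    using assms by (auto simp: line_def nxt_P ltop_nxt)
  show "pos d x = hi d x" unfolding hi_def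
    by (rule Max_eqI[symmetric]) (use x closing_pos[OF assms] finite_line in \<open>auto simp: line_def\<close>)
  show "pos d (nxt d x) = lo d x" unfolding lo_def
    by (rule Min_eqI[symmetric]) (use x closing_pos[OF assms] finite_line in \<open>auto simp: line_def\<close>)
qed

lemma line_cong: "ltop d x = ltop d y \<Longrightarrow> line d x = line d y"
  by (simp add: line_def)

lemma line_params:
  "ltop d x = ltop d y \<Longrightarrow> lo d x = lo d y" "ltop d x = ltop d y \<Longrightarrow> hi d x = hi d y"
  "ltop d x = ltop d y \<Longrightarrow> len d x = len d y"
  by (simp_all add: lo_def hi_def len_def line_cong[of d x y])

abbreviation iter :: "bool \<Rightarrow> nat \<Rightarrow> ped_point \<Rightarrow> ped_point"
  where "iter d n x \<equiv> (nxt d ^^ n) x"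

lemma iter_P: "x \<in> P \<Longrightarrow> iter d n x \<in> P"
  by (induction n) (auto simp: nxt_P)

lemma ltop_iter: "x \<in> P \<Longrightarrow> ltop d (iter d n x) = ltop d x"
  by (induction n) (auto simp: ltop_nxt iter_P)

lemma inj_iter: "x \<in> P \<Longrightarrow> y \<in> P \<Longrightarrow> iter d n x = iter d n y \<Longrightarrow> x = y"
  by (induction n) (auto dest: inj_onD[OF inj_nxt] simp: iter_P)

text \<open>Each step raises the position by one, except the closing one, which drops it from
  \<open>hi\<close> to \<open>lo\<close>, that is by \<open>len d x - 1\<close>. Within
  \<open>len d x\<close> steps this happens at most once, and the inequalities separate the two
  cases.\<close>

lemma iter_pos:
  assumes "x \<in> P" "n \<le> len d x"
  shows "(int n = pos d (iter d n x) - pos d x \<and> pos d x \<le> pos d (iter d n x)) \<or>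
    (int n = pos d (iter d n x) - pos d x + int (len d x) \<and> pos d (iter d n x) \<le> pos d x)"
  using assms(2)
proof (induction n)
  case (Suc n)
  let ?y = "iter d n x"
  have y: "?y \<in> P" "ltop d ?y = ltop d x" using assms by (auto simp: iter_P ltop_iter)
  have bounds: "lo d x \<le> pos d ?y" "pos d ?y \<le> hi d x" "lo d x \<le> pos d x" "pos d x \<le> hi d x"
    using pos_bounds[OF y] pos_bounds[of x d x] assms by auto
  have len: "int (len d x) = hi d x - lo d x + 1" using len_pos[OF assms(1)] .
  have n: "int n < int (len d x)" using Suc.prems by simp
  have IH: "(int n = pos d ?y - pos d x \<and> pos d x \<le> pos d ?y) \<or>
    (int n = pos d ?y - pos d x + int (len d x) \<and> pos d ?y \<le> pos d x)"
    using Suc by simp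
  show ?case
  proof (cases "closing d ?y")
    case True
    have "pos d ?y = hi d x" "pos d (nxt d ?y) = lo d x"
      using closing_lo_hi[OF y(1) True] line_params[OF y(2)] by auto
    then show ?thesis using IH bounds len n by auto
  next
    case False
    have "pos d (nxt d ?y) = pos d ?y + 1" by (rule nxt_pos[OF y(1) False])
    then show ?thesis using IH n by auto
  qed
qed simp

lemma iter_len:
  assumes "x \<in> P"
  shows "iter d (len d x) x = x"
proof -
  let ?y = "iter d (len d x) x"
  have y: "?y \<in> P" "ltop d ?y = ltop d x" using assms by (auto simp: iter_P ltop_iter)
  have "pos d ?y = pos d x"
    using iter_pos[OF assms, of "len d x" d] len_pos[OF assms, of d] pos_bounds[OF y] pos_bounds[of x d x] assms
    by auto
  then show ?thesis using pos_eq y by blast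
qed

lemma iter_neq:
  assumes "x \<in> P" "0 < n" "n < len d x"
  shows "iter d n x \<noteq> x"
  using iter_pos[of x n d] assms by auto

lemma inj_on_iter:
  assumes "x \<in> P"
  shows "inj_on (\<lambda>n. iter d n x) {..<len d x}"
proof (rule linorder_inj_onI)
  fix i j assume ij: "i < j" "i \<in> {..<len d x}" "j \<in> {..<len d x}"
  show "iter d i x \<noteq> iter d j x"
  proof
    assume "iter d i x = iter d j x"
    then have "iter d i x = iter d i (iter d (j - i) x)"
      using ij funpow_add[of i "j - i" "nxt d"] by simp
    then have "x = iter d (j - i) x"
      using inj_iter[OF assms iter_P[OF assms]] by blast
    moreover have "0 < j - i" "j - i < len d x" using ij by auto
    ultimately show False using iter_neq[OF assms, of "j - i" d] by simp
  qed
qed auto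

text \<open>Counting: the iterates are \<open>len d x\<close> different points, and the available
  positions leave room for no more.\<close>

lemma line_iter:
  assumes "x \<in> P"
  shows "line d x = {iter d n x | n. n < len d x}"
proof
  show "{iter d n x | n. n < len d x} \<subseteq> line d x"
    using assms by (auto simp: line_def iter_P ltop_iter)
  have "card (line d x) \<le> len d x"
  proof -
    have "card (line d x) = card (pos d ` line d x)"
      by (rule card_image[symmetric], rule inj_onI, rule pos_eq[of d]) (auto simp: line_def)
    also have "\<dots> \<le> card {lo d x..hi d x}"
      by (rule card_mono) (auto simp: line_def pos_bounds)
    finally show ?thesis by (simp add: len_def)
  qed
  moreover have "card {iter d n x | n. n < len d x} = len d x"
    using card_image[OF inj_on_iter[OF assms]] by (simp add: setcompr_eq_image lessThan_def)
  moreover have "{iter d n x | n. n < len d x} \<subseteq> line d x"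
    using assms by (auto simp: line_def iter_P ltop_iter)
  ultimately have "{iter d n x | n. n < len d x} = line d x"
    by (intro card_seteq) (simp_all add: finite_line)
  then show "line d x \<subseteq> {iter d n x | n. n < len d x}" by simp
qed

lemma iter_surj:
  assumes "x \<in> P" "y \<in> P" "ltop d y = ltop d x"
  obtains n where "n < len d x" "iter d n x = y"
proof -
  have "y \<in> line d x" using assms by (simp add: line_def)
  then show ?thesis using line_iter[OF assms(1), of d] that by auto
qed

subsection \<open>Stepping along a line\<close>

text \<open>The value of an arrow of the closed-up quiver: an ordinary step is an arrow of the
  pedigree, the closing step is the dual of the path along the whole line. On a line reduced to a
  point the loop is thus the dual of the idempotent.\<close>

definition step :: "bool \<Rightarrow> ped_point \<Rightarrow> bool \<times> ped_point \<times> ped_point"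
  where "step d x = (closing d x, x, nxt d x)"

lemma leI: "x \<in> P \<Longrightarrow> y \<in> P \<Longrightarrow> ltop d x = ltop d y \<Longrightarrow> pos d x \<le> pos d y \<Longrightarrow> le x y"
  by (auto simp: le_def)

lemma step_basis: "x \<in> P \<Longrightarrow> step d x \<in> basis"
  using nxt_pos[of x d] closing_pos[of x d x]
  by (auto simp: step_def basis_iff el_def ltop_nxt nxt_P intro!: leI[of _ _ d])

text \<open>Going on along the line does not give zero before a full turn; the excluded case is the
  dual of an idempotent, where the turn is complete. If \<open>c\<close> holds, the closing step has
  been passed and does not recur before \<open>x\<close> is reached again.\<close>

lemma pmul_step:
  assumes "el c x y" "ltop d x = ltop d y" "\<not> (c \<and> x = y)"
  shows "pmul (step d y) (c, x, y) = Some (c \<or> closing d y, x, nxt d y)"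
proof -
  have P: "x \<in> P" "y \<in> P" using assms(1) le_P by (auto simp: el_def split: if_splits)
  have pos: "if c then pos d y \<le> pos d x else pos d x \<le> pos d y"
    using assms le_line[of x y d] le_line[of y x d] by (auto simp: el_def)
  have line: "ltop d (nxt d y) = ltop d x" using ltop_nxt[OF P(2)] assms(2) by simp
  have N: "nxt d y \<in> P" using nxt_P P by blast
  show ?thesis
  proof (cases "closing d y")
    case True
    have *: "pos d x \<le> pos d y" "pos d (nxt d y) \<le> pos d x"
      using closing_pos[OF P(2) True P(1)] assms(2) by auto
    have "\<not> c"
    proof
      assume c
      then have "pos d x = pos d y" using * pos by simp
      then show False using pos_eq[OF assms(2)] assms(3) \<open>c\<close> by simp
    qed
    moreover have "le (nxt d y) x" using leI[OF N P(1) line *(2)] .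
    ultimately show ?thesis using True by (simp add: step_def el_def)
  next
    case False
    have nx: "pos d (nxt d y) = pos d y + 1" by (rule nxt_pos[OF P(2) False])
    have "el c x (nxt d y)"
    proof (cases c)
      case True
      then have "pos d x \<noteq> pos d y" using pos_eq[OF assms(2)] assms(3) by auto
      then have "pos d (nxt d y) \<le> pos d x" using pos True nx by simp
      then show ?thesis using leI[OF N P(1) line] True by (simp add: el_def)
    next
      case c: False
      then have "pos d x \<le> pos d (nxt d y)" using pos nx by simp
      then show ?thesis using leI[OF P(1) N line[symmetric]] c by (simp add: el_def)
    qed
    then show ?thesis using False by (simp add: step_def)
  qed
qed

lemma pmul_step_full:
  assumes "x \<in> P"
  shows "pmul (step d x) (True, x, x) = None"
proof (cases "closing d x")
  case False
  have "\<not> le (nxt d x) x"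
  proof
    assume "le (nxt d x) x"
    then show False
      using le_line[of "nxt d x" x d] nxt_pos[OF assms False] ltop_nxt[OF assms, of d] by simp
  qed
  then show ?thesis using False by (simp add: step_def el_def)
qed (simp add: step_def)

lemma step_neq: "x \<in> P \<Longrightarrow> \<not> closing d x \<Longrightarrow> nxt d x \<noteq> x"
  using nxt_pos[of x d] by auto

lemma le_lines:
  assumes "le x z" "ltop d x = ltop d y" "ltop (\<not> d) y = ltop (\<not> d) z"
  shows "x = y \<or> y = z"
proof -
  obtain e where "ltop e x = ltop e z" using assms(1) by (rule leE)
  then show ?thesis using triangle[OF assms(2,3)] assms two_lines[of d y z] two_lines[of d x y]
    by (cases "e = d") auto
qed

text \<open>A nonzero product would need a path joining the two ends, and by \<open>le_lines\<close>
  one of the steps is then a loop, whose value is the dual of an idempotent. Its product with an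
  ordinary step on the other line vanishes, as does the product of two duals.\<close>

lemma pmul_step_mixed:
  assumes x: "x \<in> P"
  shows "pmul (step (\<not> d) (nxt d x)) (step d x) = None"
proof -
  let ?y = "nxt d x" and ?z = "nxt (\<not> d) (nxt d x)"
  have y: "?y \<in> P" and l: "ltop d x = ltop d ?y" "ltop (\<not> d) ?y = ltop (\<not> d) ?z"
    using x by (simp_all add: nxt_P ltop_nxt)
  have False if cc: "\<not> (closing d x \<and> closing (\<not> d) ?y)"
    and el: "el (closing d x \<or> closing (\<not> d) ?y) x ?z"
  proof -
    have "x = ?y \<or> ?y = ?z"
      using le_lines[of x ?z d ?y] le_lines[of ?z x "\<not> d" ?y] l el
      by (auto simp: el_def split: if_splits)
    then show False
    proof
      assume eq: "x = ?y"
      then have "closing d x" using step_neq[OF x] by metis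
      then have nc: "\<not> closing (\<not> d) ?y" using cc by simp
      have "le ?z ?y" using el \<open>closing d x\<close> eq by (simp add: el_def)
      then have "pos (\<not> d) ?z \<le> pos (\<not> d) ?y" by (rule le_line) (simp add: l(2))
      then show False using nxt_pos[OF y nc] by simp
    next
      assume eq: "?y = ?z"
      then have "closing (\<not> d) ?y" using step_neq[OF y, of "\<not> d"] by metis
      then have nc: "\<not> closing d x" using cc by simp
      have "le ?y x" using el \<open>closing (\<not> d) ?y\<close> eq by (simp add: el_def)
      then have "pos d ?y \<le> pos d x" by (rule le_line) (simp add: l(1))
      then show False using nxt_pos[OF x nc] by simp
    qed
  qed
  then show ?thesis by (auto simp: step_def)
qed

end

section \<open>Path algebras\<close>

lemma conv_mult_diff_left:
  "conv_mult mul (f - f') g = conv_mult mul f g - conv_mult mul f' (g :: 'm \<Rightarrow>\<^sub>0 'k::field)"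
  using conv_mult_add_left[of mul "f - f'" f' g] by (simp add: algebra_simps)

lemma conv_mult_diff_right:
  "conv_mult mul f (g - g') = conv_mult mul f g - conv_mult mul f (g' :: 'm \<Rightarrow>\<^sub>0 'k::field)"
  using conv_mult_add_right[of mul f "g - g'" g'] by (simp add: algebra_simps)

fun path_comp :: "('v, 'a) path \<Rightarrow> ('v, 'a) path \<Rightarrow> ('v, 'a) path option" where
  "path_comp (v', q, w) (u, p, v) = (if v' = v then Some (u, p @ q, w) else None)"

lemma path_algebra_mono_alg:
  "path_algebra Q = mono_alg (quiver_paths Q) ((\<lambda>v. (v, [], v)) ` verts Q) path_comp"
proof -
  have "basis_mult q p c = opt_single (path_comp q p) c" for q p :: "('a, 'b) path" and c :: "'c::field"
    by (cases q; cases p) (simp add: basis_mult_def)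
  then have "path_mult = (conv_mult path_comp :: (('a, 'b) path \<Rightarrow>\<^sub>0 'c) \<Rightarrow> _)"
    by (simp add: path_mult_def conv_mult_def fun_eq_iff)
  moreover have "(\<Sum>v\<in>verts Q. single (v, [], v) 1) =
      (\<Sum>e\<in>(\<lambda>v. (v, [], v)) ` verts Q. single e (1 :: 'c))"
    by (subst sum.reindex) (auto simp: inj_on_def)
  ultimately show ?thesis
    by (simp add: path_algebra_def mono_alg_def)
qed

context fin_digraph
begin

lemma quiver_paths_iff [simp]: "(u, p, v) \<in> quiver_paths G \<longleftrightarrow> awalk u p v"
  by (simp add: quiver_paths_def)

lemma path_monoid:
  "partial_monoid (quiver_paths G) ((\<lambda>v. (v, [], v)) ` verts G) path_comp"
proof
  show "finite ((\<lambda>v. (v, [], v)) ` verts G)" by simp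
  show "(\<lambda>v. (v, [], v)) ` verts G \<subseteq> quiver_paths G"
    by (auto simp: awalk_Nil_iff)
  fix a b c assume ab: "a \<in> quiver_paths G" "b \<in> quiver_paths G" "path_comp a b = Some c"
  obtain v q w u p v' where "a = (v, q, w)" "b = (u, p, v')" by (cases a; cases b)
  then show "c \<in> quiver_paths G"
    using ab by (auto simp: awalk_appendI split: if_splits)
next
  fix a b c assume "a \<in> quiver_paths G" "b \<in> quiver_paths G" "c \<in> quiver_paths G"
  show "Option.bind (path_comp a b) (\<lambda>x. path_comp x c) = Option.bind (path_comp b c) (path_comp a)"
    by (cases a; cases b; cases c) auto
next
  fix a assume a: "a \<in> quiver_paths G"
  obtain u p v where [simp]: "a = (u, p, v)" by (cases a)
  have "u \<in> verts G" "v \<in> verts G" using a by auto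
  then show "\<exists>l\<in>(\<lambda>v. (v, [], v)) ` verts G. path_comp l a = Some a \<and>
      (\<forall>e\<in>(\<lambda>v. (v, [], v)) ` verts G - {l}. path_comp e a = None)"
    "\<exists>r\<in>(\<lambda>v. (v, [], v)) ` verts G. path_comp a r = Some a \<and>
      (\<forall>e\<in>(\<lambda>v. (v, [], v)) ` verts G - {r}. path_comp a e = None)"
    by (auto intro: bexI[of _ v] bexI[of _ u] split: if_splits)
qed

lemma path_ideal_mult:
  assumes "ideal I (path_algebra G :: ('k::field, _) module)" "f \<in> I"
    and "awalk u q v" "awalk w r z"
  shows "conv_mult path_comp (single (w, r, z) 1)
    (conv_mult path_comp f (single (u, q, v) 1)) \<in> I"
  using ideal.I_l_closed[OF assms(1) ideal.I_r_closed[OF assms(1,2)],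
      of "single (u, q, v) 1" "single (w, r, z) 1"] assms(3,4)
  by (simp add: path_algebra_mono_alg)

lemma path_ideal_single:
  assumes "ideal I (path_algebra G :: ('k::field, _) module)"
    and "single (v, p, w) 1 \<in> I"
    and "awalk u q v" "awalk w r z"
  shows "single (u, q @ p @ r, z) 1 \<in> I"
  using path_ideal_mult[OF assms] by simp

lemma path_ideal_diff:
  assumes "ideal I (path_algebra G :: ('k::field, _) module)"
    and "single (v, p, w) 1 - single (v, p', w) 1 \<in> I"
    and "awalk u q v" "awalk w r z"
  shows "single (u, q @ p @ r, z) 1 - single (u, q @ p' @ r, z) 1 \<in> I"
  using path_ideal_mult[OF assms] by (simp add: conv_mult_diff_left conv_mult_diff_right)

lemma path_ideal_add:
  assumes "ideal I (path_algebra G :: ('k::field, _) module)" "f \<in> I" "g \<in> I"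
  shows "f + g \<in> I"
  using additive_subgroup.a_closed[OF ideal.axioms(1)[OF assms(1)] assms(2,3)]
  by (simp add: path_algebra_mono_alg)

end

text \<open>Arrows receive values in a partial monoid, so that paths can be evaluated. The ends
  \<open>src\<close> and \<open>tgt\<close> guarantee that paths which do not compose have values
  with product \<open>None\<close>.\<close>

locale path_valuation = fin_digraph Q + partial_monoid M E mul
  for Q :: "('v, 'a) pre_digraph" and M E :: "'m set" and mul +
  fixes src tgt :: "'m \<Rightarrow> 'p" and unit :: "'p \<Rightarrow> 'm" and lab :: "'v \<Rightarrow> 'p" and gen :: "'a \<Rightarrow> 'm"
  assumes mul_ends: "\<lbrakk>a \<in> M; b \<in> M; mul a b = Some c\<rbrakk> \<Longrightarrow> tgt b = src a \<and> src c = src b \<and> tgt c = tgt a"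
    and bij_unit: "bij_betw (\<lambda>v. unit (lab v)) (verts Q) E"
    and unit_mul: "m \<in> M \<Longrightarrow> mul (unit (tgt m)) m = Some m"
      "m \<in> M \<Longrightarrow> mul m (unit (src m)) = Some m"
    and unit_ends: "v \<in> verts Q \<Longrightarrow> src (unit (lab v)) = lab v \<and> tgt (unit (lab v)) = lab v"
    and inj_lab: "inj_on lab (verts Q)"
    and gen: "e \<in> arcs Q \<Longrightarrow> gen e \<in> M \<and> src (gen e) = lab (tail Q e) \<and> tgt (gen e) = lab (head Q e)"
begin

text \<open>Arrows are listed in the order of traversal but multiplied from right to left, so each
  further arrow acts from the left.\<close>

definition val_from :: "'m option \<Rightarrow> 'a list \<Rightarrow> 'm option"
  where "val_from = foldl (\<lambda>r a. Option.bind r (mul (gen a)))"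

definition val :: "('v, 'a) path \<Rightarrow> 'm option"
  where "val = (\<lambda>(u, p, v). val_from (Some (unit (lab u))) p)"

lemma val_Nil [simp]: "val (u, [], v) = Some (unit (lab u))"
  by (simp add: val_def val_from_def)

lemma val_snoc: "val (u, p @ [a], v) = Option.bind (val (u, p, v')) (mul (gen a))"
  by (simp add: val_def val_from_def)

lemma unit_M: "v \<in> verts Q \<Longrightarrow> unit (lab v) \<in> M"
  using bij_unit units by (auto simp: bij_betw_def)

lemma val_closed:
  "awalk u p v \<Longrightarrow> val (u, p, v) = Some m \<Longrightarrow> m \<in> M \<and> src m = lab u \<and> tgt m = lab v"
proof (induction p arbitrary: v m rule: rev_induct)
  case Nil
  then show ?case using unit_ends[of u] unit_M[of u] by (auto simp: awalk_Nil_iff)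
next
  case (snoc a p)
  then have p: "awalk u p (tail Q a)" "a \<in> arcs Q" "v = head Q a"
    by (auto simp: awalk_simps)
  obtain m' where m': "val (u, p, tail Q a) = Some m'" "mul (gen a) m' = Some m"
    using snoc.prems(2) by (auto simp: val_snoc[of u p a v "tail Q a"] bind_eq_Some_conv)
  show ?case
    using snoc.IH[OF p(1) m'(1)] gen[OF p(2)] mul_ends[OF _ _ m'(2)] mul_closed[OF _ _ m'(2)] p(3)
    by auto
qed

lemma val_append:
  assumes "awalk u p v" "awalk v q w"
  shows "val (u, p @ q, w) = Option.bind (val (v, q, w)) (\<lambda>a. Option.bind (val (u, p, v)) (mul a))"
  using assms(2)
proof (induction q arbitrary: w rule: rev_induct)
  case Nil
  have "Option.bind (val (u, p, v)) (mul (unit (lab v))) = val (u, p, v)"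
  proof (cases "val (u, p, v)")
    case (Some a)
    then show ?thesis using val_closed[OF assms(1) Some] unit_mul(1)[of a] by simp
  qed simp
  then show ?case using Nil by (auto simp: awalk_Nil_iff)
next
  case (snoc a q)
  then have q: "awalk v q (tail Q a)" "a \<in> arcs Q" "w = head Q a"
    by (auto simp: awalk_simps)
  have "val (u, p @ q @ [a], w) = Option.bind (val (u, p @ q, tail Q a)) (mul (gen a))"
    using val_snoc[of u "p @ q" a w "tail Q a"] by simp
  also have "\<dots> = Option.bind (val (v, q, tail Q a))
      (\<lambda>b. Option.bind (val (u, p, v)) (\<lambda>c. Option.bind (mul b c) (mul (gen a))))"
    by (simp add: snoc.IH[OF q(1)])
  also have "\<dots> = Option.bind (val (v, q, tail Q a))
      (\<lambda>b. Option.bind (val (u, p, v)) (\<lambda>c. Option.bind (mul (gen a) b) (\<lambda>x. mul x c)))"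
  proof (cases "val (v, q, tail Q a)"; cases "val (u, p, v)")
    fix b c assume bc: "val (v, q, tail Q a) = Some b" "val (u, p, v) = Some c"
    then have "b \<in> M" "c \<in> M" "gen a \<in> M"
      using val_closed[OF q(1)] val_closed[OF assms(1)] gen[OF q(2)] by auto
    then show ?thesis using bc mul_assoc[of "gen a" b c] by simp
  qed auto
  also have "\<dots> = Option.bind (val (v, q @ [a], w)) (\<lambda>b. Option.bind (val (u, p, v)) (mul b))"
    unfolding val_snoc[of v q a w "tail Q a"]
    by (cases "val (v, q, tail Q a)"; cases "val (u, p, v)") (auto split: bind_splits)
  finally show ?case by simp
qed

lemma val_comp:
  assumes "q \<in> quiver_paths Q" "p \<in> quiver_paths Q"
  shows "Option.bind (path_comp q p) val = Option.bind (val q) (\<lambda>a. Option.bind (val p) (mul a))"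
proof -
  obtain v' q' w where q: "q = (v', q', w)" by (cases q)
  obtain u p' v where p: "p = (u, p', v)" by (cases p)
  show ?thesis
  proof (cases "v' = v")
    case True
    then show ?thesis using val_append[of u p' v q' w] assms q p by simp
  next
    case False
    have "mul a b = None" if "val q = Some a" "val p = Some b" for a b
    proof (rule ccontr)
      assume "mul a b \<noteq> None"
      then obtain c where c: "mul a b = Some c" by auto
      have "a \<in> M" "src a = lab v'" "b \<in> M" "tgt b = lab v"
        using val_closed[of v' q' w a] val_closed[of u p' v b] that assms p q by auto
      then have "lab v = lab v'" using mul_ends[OF _ _ c] by simp
      moreover have "v \<in> verts Q" "v' \<in> verts Q" using assms p q by auto
      ultimately show False using False inj_lab by (auto dest: inj_onD)
    qed
    then have "Option.bind (val q) (\<lambda>a. Option.bind (val p) (mul a)) = None"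
      by (cases "val q"; cases "val p") auto
    then show ?thesis using False p q by simp
  qed
qed

text \<open>Presentation of an algebra by evaluation: what remains to be checked concerns the values
  of paths and the membership of paths in ideals.\<close>

theorem bound_quiver_algebra_isomorphic:
  fixes R :: "(('v, 'a) path \<Rightarrow>\<^sub>0 'k::field) set"
  assumes "\<And>m. m \<in> M \<Longrightarrow> \<exists>p\<in>quiver_paths Q. val p = Some m"
    and "\<And>r. r \<in> R \<Longrightarrow> keys r \<subseteq> quiver_paths Q \<and> lin_lift val r = 0"
    and "\<And>I p. \<lbrakk>ideal I (path_algebra Q); R \<subseteq> I; p \<in> quiver_paths Q; val p = None\<rbrakk> \<Longrightarrow>
      single p 1 \<in> I"
    and "\<And>I p q m. \<lbrakk>ideal I (path_algebra Q); R \<subseteq> I; p \<in> quiver_paths Q; q \<in> quiver_paths Q;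
      val p = Some m; val q = Some m\<rbrakk> \<Longrightarrow> single p 1 - single q 1 \<in> I"
  shows "alg_isomorphic (bound_quiver_algebra Q R) (mono_alg M E mul)"
    and "\<And>c X. X \<in> carrier (bound_quiver_algebra Q R) \<Longrightarrow>
      c \<odot>\<^bsub>bound_quiver_algebra Q R\<^esub> X \<in> carrier (bound_quiver_algebra Q R)"
    and "ring (bound_quiver_algebra Q R)"
proof -
  have units: "bij_betw (\<lambda>(u, p, v). unit (lab u)) ((\<lambda>v. (v, [], v)) ` verts Q) E"
    using bij_unit by (auto simp: bij_betw_def inj_on_def image_image)
  have closed: "m \<in> M" if "p \<in> quiver_paths Q" "val p = Some m" for p m
    using val_closed that by (cases p) auto
  note iso = quot_mono_alg_isomorphic[OF path_monoid partial_monoid_axioms val_comp units _ closed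
      assms(1), where R = R, folded path_algebra_mono_alg bound_quiver_algebra_def]
  show "alg_isomorphic (bound_quiver_algebra Q R) (mono_alg M E mul)"
    by (rule iso(1)) (use assms(2-4) in auto)
  show "c \<odot>\<^bsub>bound_quiver_algebra Q R\<^esub> X \<in> carrier (bound_quiver_algebra Q R)"
    if "X \<in> carrier (bound_quiver_algebra Q R)" for c X
    by (rule iso(2)) (use assms(2-4) that in auto)
  show "ring (bound_quiver_algebra Q R)"
    by (rule iso(3)) (use assms(2-4) in auto)
qed

end

section \<open>Quivers composed of lines\<close>

text \<open>
  \<open>A\<close> is the set of those steps \<open>(d, x)\<close> which are realised by an arrow: all of them for Brauer
  quivers, those that do not close up a line for pedigrees.
\<close>

locale line_quiver = ped_set P for P +
  fixes Q :: "('v, 'a) pre_digraph" and \<phi> :: "ped_point \<Rightarrow> 'v" and arr :: "bool \<Rightarrow> ped_point \<Rightarrow> 'a"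
    and A :: "(bool \<times> ped_point) set" and B :: "(bool \<times> ped_point \<times> ped_point) set"
  assumes A: "(d, x) \<in> A \<Longrightarrow> x \<in> P"
    and bij_\<phi>: "bij_betw \<phi> P (verts Q)"
    and bij_arr: "bij_betw (\<lambda>(d, x). arr d x) A (arcs Q)"
    and tail_arr: "(d, x) \<in> A \<Longrightarrow> tail Q (arr d x) = \<phi> x"
    and head_arr: "(d, x) \<in> A \<Longrightarrow> head Q (arr d x) = \<phi> (nxt d x)"
    and B_monoid: "partial_monoid B idems pmul" and B_basis: "B \<subseteq> basis"
    and step_B: "(d, x) \<in> A \<Longrightarrow> step d x \<in> B"
begin

definition lab :: "'v \<Rightarrow> ped_point"
  where "lab = inv_into P \<phi>"

definition gen :: "'a \<Rightarrow> bool \<times> ped_point \<times> ped_point"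
  where "gen a = (case inv_into A (\<lambda>(d, x). arr d x) a of (d, x) \<Rightarrow> step d x)"

lemma \<phi>_verts: "x \<in> P \<Longrightarrow> \<phi> x \<in> verts Q"
  using bij_\<phi> by (auto simp: bij_betw_def)

lemma \<phi>_eq_iff: "x \<in> P \<Longrightarrow> y \<in> P \<Longrightarrow> \<phi> x = \<phi> y \<longleftrightarrow> x = y"
  using bij_\<phi> by (auto simp: bij_betw_def inj_on_eq_iff)

lemma vertsE: assumes "v \<in> verts Q" obtains x where "x \<in> P" "v = \<phi> x"
proof -
  have "v \<in> \<phi> ` P" using bij_\<phi> assms by (simp add: bij_betw_def)
  then show ?thesis using that by auto
qed

lemma lab_\<phi>: "x \<in> P \<Longrightarrow> lab (\<phi> x) = x"
  using bij_\<phi> by (simp add: lab_def bij_betw_def inv_into_f_f)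

lemma arr_arcs: "(d, x) \<in> A \<Longrightarrow> arr d x \<in> arcs Q"
  using bij_arr imageI[of "(d, x)" A "\<lambda>(d, x). arr d x"] by (simp add: bij_betw_def)

lemma arcsE: assumes "a \<in> arcs Q" obtains d x where "(d, x) \<in> A" "a = arr d x"
proof -
  have "a \<in> (\<lambda>(d, x). arr d x) ` A" using bij_arr assms by (simp add: bij_betw_def)
  then show ?thesis using that by auto
qed

lemma arr_eq_iff: "(d, x) \<in> A \<Longrightarrow> (e, y) \<in> A \<Longrightarrow> arr d x = arr e y \<longleftrightarrow> d = e \<and> x = y"
  using bij_arr inj_on_eq_iff[of "\<lambda>(d, x). arr d x" A "(d, x)" "(e, y)"] by (simp add: bij_betw_def)

lemma gen_arr: "(d, x) \<in> A \<Longrightarrow> gen (arr d x) = step d x"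
  using bij_arr inv_into_f_f[of "\<lambda>(d, x). arr d x" A "(d, x)"] by (simp add: gen_def bij_betw_def)

lemma finite_A: "finite A"
proof (rule finite_subset)
  show "A \<subseteq> UNIV \<times> P" using A by auto
qed simp

sublocale fin_digraph Q
proof
  show "finite (verts Q)" "finite (arcs Q)"
    using bij_betw_finite[OF bij_\<phi>] bij_betw_finite[OF bij_arr] finite_A by simp_all
  fix e assume "e \<in> arcs Q"
  then obtain d x where "(d, x) \<in> A" "e = arr d x" by (rule arcsE)
  then show "tail Q e \<in> verts Q" "head Q e \<in> verts Q"
    using A by (auto simp: tail_arr head_arr \<phi>_verts nxt_P)
qed

sublocale path_valuation Q B idems pmul "\<lambda>(c, x, y). x" "\<lambda>(c, x, y). y" "\<lambda>x. (False, x, x)" lab gen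
proof (intro path_valuation.intro path_valuation_axioms.intro)
  show "fin_digraph Q" by unfold_locales
  show "partial_monoid B idems pmul" by (rule B_monoid)
  have "bij_betw (\<lambda>x. (False, x, x)) P idems"
    by (auto simp: bij_betw_def inj_on_def idems_eq)
  moreover have "bij_betw lab (verts Q) P"
    unfolding lab_def by (rule bij_betw_inv_into[OF bij_\<phi>])
  ultimately have "bij_betw ((\<lambda>x. (False, x, x)) \<circ> lab) (verts Q) idems"
    by (rule bij_betw_trans[rotated])
  then show "bij_betw (\<lambda>v. (False, lab v, lab v)) (verts Q) idems"
    by (simp add: comp_def)
  show "inj_on lab (verts Q)"
    using bij_betw_inv_into[OF bij_\<phi>] by (simp add: lab_def bij_betw_def)
  show "gen e \<in> B \<and> (case gen e of (c, x, y) \<Rightarrow> x) = lab (tail Q e) \<and>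
      (case gen e of (c, x, y) \<Rightarrow> y) = lab (head Q e)" if e: "e \<in> arcs Q" for e
  proof -
    obtain d x where dx: "(d, x) \<in> A" "e = arr d x" using e by (rule arcsE)
    then show ?thesis
      using A[OF dx(1)] step_B[OF dx(1)]
      by (simp add: gen_arr tail_arr head_arr lab_\<phi> nxt_P step_def)
  qed
  show "pmul (False, case m of (c, x, y) \<Rightarrow> y, case m of (c, x, y) \<Rightarrow> y) m = Some m"
    "pmul m (False, case m of (c, x, y) \<Rightarrow> x, case m of (c, x, y) \<Rightarrow> x) = Some m" if m: "m \<in> B" for m
  proof -
    obtain c x y where mc: "m = (c, x, y)" by (cases m)
    have "el c x y" using m B_basis mc by (auto simp: basis_iff)
    then show "pmul (False, case m of (c, x, y) \<Rightarrow> y, case m of (c, x, y) \<Rightarrow> y) m = Some m"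
      "pmul m (False, case m of (c, x, y) \<Rightarrow> x, case m of (c, x, y) \<Rightarrow> x) = Some m" using mc by auto
  qed
qed (auto split: if_splits)

lemma val_closed': "awalk u p v \<Longrightarrow> val (u, p, v) = Some (c, x, y) \<Longrightarrow>
    (c, x, y) \<in> B \<and> el c x y \<and> x = lab u \<and> y = lab v"
  using val_closed[of u p v "(c, x, y)"] B_basis by (auto simp: basis_iff)

definition walk :: "bool \<Rightarrow> ped_point \<Rightarrow> nat \<Rightarrow> 'a list"
  where "walk d x n = map (\<lambda>i. arr d (iter d i x)) [0..<n]"

definition walk_ok :: "bool \<Rightarrow> ped_point \<Rightarrow> nat \<Rightarrow> bool"
  where "walk_ok d x n \<longleftrightarrow> x \<in> P \<and> (\<forall>i<n. (d, iter d i x) \<in> A)"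

lemma walk_0 [simp]: "walk d x 0 = []" and walk_Suc: "walk d x (Suc n) = walk d x n @ [arr d (iter d n x)]"
  by (simp_all add: walk_def)

lemma iter_add: "iter d (m + n) x = iter d n (iter d m x)"
  by (simp add: add.commute[of m] funpow_add)

lemma walk_add: "walk d x (m + n) = walk d x m @ walk d (iter d m x) n"
  by (induction n) (simp_all add: walk_Suc iter_add)

lemma walk_Suc_left: "walk d x (Suc n) = arr d x # walk d (nxt d x) n"
  using walk_add[of d x 1 n] by (simp add: walk_def)

lemma walk_ok_mono: "walk_ok d x n \<Longrightarrow> m \<le> n \<Longrightarrow> walk_ok d x m"
  by (simp add: walk_ok_def)

lemma length_walk [simp]: "length (walk d x n) = n"
  by (simp add: walk_def)

lemma awalk_walk: "walk_ok d x n \<Longrightarrow> awalk (\<phi> x) (walk d x n) (\<phi> (iter d n x))"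
proof (induction n)
  case 0
  then show ?case by (simp add: awalk_Nil_iff walk_ok_def \<phi>_verts)
next
  case (Suc n)
  then have *: "(d, iter d n x) \<in> A" "awalk (\<phi> x) (walk d x n) (\<phi> (iter d n x))"
    by (auto simp: walk_ok_def)
  have "awalk (\<phi> (iter d n x)) [arr d (iter d n x)] (\<phi> (iter d (Suc n) x))"
    using arc_implies_awalk[OF arr_arcs[OF *(1)]] *(1) by (simp add: tail_arr head_arr)
  with *(2) show ?case unfolding walk_Suc by (rule awalk_appendI)
qed

text \<open>The path changes its line somewhere. The parts before and after the turn are kept as
  walks, so that a zero relation at the turn can be multiplied by them on both sides.\<close>

definition turning :: "'v \<Rightarrow> 'a list \<Rightarrow> 'v \<Rightarrow> bool"
  where "turning u p v \<longleftrightarrow> (\<exists>q d y r. p = q @ [arr d y, arr (\<not> d) (nxt d y)] @ r \<and> (d, y) \<in> A \<and>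
    (\<not> d, nxt d y) \<in> A \<and> awalk u q (\<phi> y) \<and> awalk (\<phi> (nxt (\<not> d) (nxt d y))) r v)"

lemma turningI:
  "\<lbrakk>(d, y) \<in> A; (\<not> d, nxt d y) \<in> A; awalk u q (\<phi> y); awalk (\<phi> (nxt (\<not> d) (nxt d y))) r v\<rbrakk>
    \<Longrightarrow> turning u (q @ [arr d y, arr (\<not> d) (nxt d y)] @ r) v"
  unfolding turning_def by blast

lemma walk_or_turning:
  assumes "awalk u p v"
  shows "turning u p v \<or> (\<exists>d x n. walk_ok d x n \<and> u = \<phi> x \<and> p = walk d x n \<and> v = \<phi> (iter d n x))"
  using assms
proof (induction p arbitrary: u)
  case Nil
  then obtain x where "x \<in> P" "u = \<phi> x" "v = u" by (auto simp: awalk_Nil_iff elim: vertsE)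
  then have "walk_ok False x 0" "u = \<phi> x" "[] = walk False x 0" "v = \<phi> (iter False 0 x)"
    by (simp_all add: walk_ok_def)
  then show ?case by blast
next
  case (Cons a p)
  then obtain e y where a: "(e, y) \<in> A" "a = arr e y" by (auto simp: awalk_Cons_iff elim: arcsE)
  have p: "awalk (\<phi> (nxt e y)) p v" and u: "u = \<phi> y"
    using Cons.prems a by (auto simp: awalk_Cons_iff tail_arr head_arr)
  have y: "y \<in> P" using A a by blast
  have a1: "awalk u [a] (\<phi> (nxt e y))"
    using arc_implies_awalk[OF arr_arcs[OF a(1)]] a u by (simp add: tail_arr head_arr)
  from Cons.IH[OF p] show ?case
  proof
    assume "turning (\<phi> (nxt e y)) p v"
    then obtain q d z r where t: "p = q @ [arr d z, arr (\<not> d) (nxt d z)] @ r" "(d, z) \<in> A"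
      "(\<not> d, nxt d z) \<in> A" "awalk (\<phi> (nxt e y)) q (\<phi> z)" "awalk (\<phi> (nxt (\<not> d) (nxt d z))) r v"
      unfolding turning_def by blast
    have "turning u (([a] @ q) @ [arr d z, arr (\<not> d) (nxt d z)] @ r) v"
      by (rule turningI[OF t(2,3) awalk_appendI[OF a1 t(4)] t(5)])
    then show ?thesis using t(1) by simp
  next
    assume "\<exists>d x n. walk_ok d x n \<and> \<phi> (nxt e y) = \<phi> x \<and> p = walk d x n \<and> v = \<phi> (iter d n x)"
    then obtain d x n where w: "walk_ok d x n" "\<phi> (nxt e y) = \<phi> x" "p = walk d x n" "v = \<phi> (iter d n x)"
      by blast
    have x: "x = nxt e y" using w(1,2) y \<phi>_eq_iff[of "nxt e y" x] by (auto simp: walk_ok_def nxt_P)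
    have straight: "walk_ok e y (Suc m) \<and> u = \<phi> y \<and> a # walk e x m = walk e y (Suc m) \<and>
        \<phi> (iter e m x) = \<phi> (iter e (Suc m) y)" if "walk_ok e x m" for m
    proof -
      have "walk_ok e y (Suc m)"
        unfolding walk_ok_def
      proof (intro conjI allI impI)
        fix i assume "i < Suc m"
        then show "(e, iter e i y) \<in> A"
          using that a(1) x by (cases i) (auto simp: walk_ok_def funpow_Suc_right simp del: funpow.simps)
      qed (rule y)
      then show ?thesis using u x a(2) by (simp add: walk_Suc_left funpow_swap1)
    qed
    show ?thesis
    proof (cases n)
      case 0
      \<comment> \<open>An empty remainder carries no direction and may be regarded as a walk in the
        direction of the preceding arrow.\<close>
      have "walk_ok e x 0" using w(1) by (simp add: walk_ok_def)
      from straight[OF this] show ?thesis using w 0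
        by (intro disjI2 exI[of _ e] exI[of _ y] exI[of _ "Suc 0"]) simp
    next
      case (Suc m)
      show ?thesis
      proof (cases "d = e")
        case True
        then show ?thesis using straight[of n] w
          by (intro disjI2 exI[of _ e] exI[of _ y] exI[of _ "Suc n"]) simp
      next
        case False
        then have d: "d = (\<not> e)" by auto
        have dx: "(\<not> e, nxt e y) \<in> A" using w(1) Suc d x by (auto simp: walk_ok_def)
        have "awalk (\<phi> (nxt d x)) (walk d (nxt d x) m) v"
          using p w(3) Suc dx d x by (simp add: walk_Suc_left awalk_Cons_iff head_arr)
        then have "turning u ([] @ [arr e y, arr (\<not> e) (nxt e y)] @ walk d (nxt d x) m) v"
          by (intro turningI) (use a dx u d x y in \<open>auto simp: awalk_Nil_iff \<phi>_verts\<close>)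
        then show ?thesis using w(3) Suc a d x by (simp add: walk_Suc_left)
      qed
    qed
  qed
qed

lemma val_single: "(d, x) \<in> A \<Longrightarrow> val (\<phi> x, [arr d x], v) = Some (step d x)"
proof -
  assume dx: "(d, x) \<in> A"
  then have "step d x \<in> basis" using step_B B_basis by blast
  then have "el (closing d x) x (nxt d x)" by (simp add: step_def basis_iff)
  then show ?thesis
    using dx val_snoc[of "\<phi> x" "[]" "arr d x" v "\<phi> x"] A[OF dx] by (simp add: gen_arr lab_\<phi> step_def)
qed

lemma val_pair:
  assumes "(d, x) \<in> A" "(e, nxt d x) \<in> A"
  shows "val (\<phi> x, [arr d x, arr e (nxt d x)], v) = pmul (step e (nxt d x)) (step d x)"
  using val_snoc[of "\<phi> x" "[arr d x]" "arr e (nxt d x)" v "\<phi> (nxt d x)"] assms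
  by (simp add: val_single gen_arr)

lemma val_turning:
  assumes "turning u p v"
  shows "val (u, p, v) = None"
proof -
  obtain q d y r where t: "p = q @ [arr d y, arr (\<not> d) (nxt d y)] @ r" "(d, y) \<in> A"
      "(\<not> d, nxt d y) \<in> A" "awalk u q (\<phi> y)" "awalk (\<phi> (nxt (\<not> d) (nxt d y))) r v"
    using assms unfolding turning_def by blast
  let ?z = "\<phi> (nxt (\<not> d) (nxt d y))" and ?m = "[arr d y, arr (\<not> d) (nxt d y)]"
  have m: "awalk (\<phi> y) ?m ?z"
    using t(2,3) A by (simp add: awalk_simps arr_arcs tail_arr head_arr \<phi>_verts nxt_P)
  have "val (\<phi> y, ?m, ?z) = None"
    using val_pair[OF t(2,3)] pmul_step_mixed[of y d] A[OF t(2)] by simp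
  then have "val (u, q @ ?m, ?z) = None" using val_append[OF t(4) m] by simp
  then show ?thesis
    using val_append[OF awalk_appendI[OF t(4) m] t(5)] t(1) by (cases "val (?z, r, v)") simp_all
qed

text \<open>The flag \<open>c\<close> records whether the closing step has been passed. That step
  changes the position by \<open>1 - len d x\<close> instead of \<open>1\<close>, which accounts for
  the summand \<open>len d x\<close>.\<close>

lemma val_walk:
  assumes "walk_ok d x n" "n \<le> len d x"
  shows "\<exists>c. val (\<phi> x, walk d x n, v) = Some (c, x, iter d n x) \<and>
    int n = pos d (iter d n x) - pos d x + (if c then int (len d x) else 0)"
  using assms
proof (induction n arbitrary: v)
  case 0
  then show ?case by (intro exI[of _ False]) (simp add: walk_ok_def lab_\<phi>)
next
  case (Suc n)
  let ?y = "iter d n x"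
  have ok: "walk_ok d x n" using Suc.prems(1) walk_ok_mono by (metis le_SucI order.refl)
  have x: "x \<in> P" and y: "?y \<in> P" and l: "ltop d ?y = ltop d x" and yA: "(d, ?y) \<in> A"
    using Suc.prems(1) by (auto simp: walk_ok_def iter_P ltop_iter)
  obtain c where c: "val (\<phi> x, walk d x n, \<phi> ?y) = Some (c, x, ?y)"
    "int n = pos d ?y - pos d x + (if c then int (len d x) else 0)"
    using Suc.IH[OF ok, of "\<phi> ?y"] Suc.prems(2) by auto
  have el: "el c x ?y" using val_closed'[OF awalk_walk[OF ok] c(1)] by simp
  have ncx: "\<not> (c \<and> x = ?y)"
    using iter_neq[OF x, of n d] c(2) Suc.prems(2) by (cases "n = 0") auto
  have "val (\<phi> x, walk d x (Suc n), v) = Some (c \<or> closing d ?y, x, nxt d ?y)"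
    unfolding walk_Suc val_snoc[of _ _ _ v "\<phi> ?y"]
    using c(1) pmul_step[OF el l[symmetric] ncx] yA by (simp add: gen_arr)
  moreover have "int (Suc n) = pos d (nxt d ?y) - pos d x + (if c \<or> closing d ?y then int (len d x) else 0)"
  proof (cases "closing d ?y")
    case True
    have b: "pos d ?y = hi d x" "pos d (nxt d ?y) = lo d x"
      using closing_lo_hi[OF y True] line_params[OF l] by auto
    have "\<not> c"
      using c(2) b(1) pos_bounds[of x d x] x Suc.prems(2) by auto
    then show ?thesis using c(2) True b len_pos[OF x, of d] by simp
  next
    case False
    then show ?thesis using c(2) nxt_pos[OF y False] by simp
  qed
  ultimately show ?case by auto
qed

lemma val_full_walk:
  assumes "walk_ok d x (len d x)"
  shows "val (\<phi> x, walk d x (len d x), v) = Some (True, x, x)"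
proof -
  have x: "x \<in> P" using assms by (simp add: walk_ok_def)
  obtain c where "val (\<phi> x, walk d x (len d x), v) = Some (c, x, x)"
    "int (len d x) = (if c then int (len d x) else 0)"
    using val_walk[OF assms order.refl, of v] by (auto simp: iter_len[OF x])
  then show ?thesis using len_gt_0[OF x, of d] by (auto split: if_splits)
qed

lemma val_long_walk:
  assumes "walk_ok d x n" "len d x < n"
  shows "val (\<phi> x, walk d x n, v) = None"
proof -
  have x: "x \<in> P" using assms by (simp add: walk_ok_def)
  have "Suc (len d x) \<le> n" using assms by simp
  then have "val (\<phi> x, walk d x n, w) = None" for w
    using assms(1)
  proof (induction n arbitrary: w rule: dec_induct)
    case base
    then have "walk_ok d x (len d x)" "(d, x) \<in> A"
      using iter_len[OF x, of d] by (auto simp: walk_ok_def)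
    then show ?case
      using val_full_walk[of d x "\<phi> x"] pmul_step_full[OF x, of d]
      by (simp add: walk_Suc val_snoc[of _ _ _ _ "\<phi> x"] iter_len[OF x] gen_arr)
  next
    case (step n)
    then show ?case
      using walk_ok_mono[OF step.prems, of n] by (simp add: walk_Suc val_snoc[of _ _ _ _ w])
  qed
  then show ?thesis .
qed

text \<open>For a given direction the value determines the length through the position formula. For
  different directions the ends share both lines and hence coincide, so both walks are trivial or
  both are full turns; the latter are the two sides of a relation between cycles.\<close>

lemma val_Some_cases:
  assumes "awalk u p v" "awalk u' q v'" "val (u, p, v) = Some m" "val (u', q, v') = Some m"
  shows "u = u' \<and> v = v' \<and> (p = q \<or> (\<exists>d x. x \<in> P \<and> walk_ok d x (len d x) \<and>
    walk_ok (\<not> d) x (len (\<not> d) x) \<and> u = \<phi> x \<and> v = \<phi> x \<and> p = walk d x (len d x) \<and>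
    q = walk (\<not> d) x (len (\<not> d) x)))"
proof -
  obtain d x n where p: "walk_ok d x n" "u = \<phi> x" "p = walk d x n" "v = \<phi> (iter d n x)"
    using walk_or_turning[OF assms(1)] val_turning assms(3) by fastforce
  obtain e x' n' where q: "walk_ok e x' n'" "u' = \<phi> x'" "q = walk e x' n'" "v' = \<phi> (iter e n' x')"
    using walk_or_turning[OF assms(2)] val_turning assms(4) by fastforce
  have n: "n \<le> len d x" "n' \<le> len e x'"
    using val_long_walk[OF p(1), of v] val_long_walk[OF q(1), of v'] assms(3,4) p(2,3) q(2,3)
    by (auto simp: not_less[symmetric])
  obtain c where c: "m = (c, x, iter d n x)" "int n = pos d (iter d n x) - pos d x + (if c then int (len d x) else 0)"
    using val_walk[OF p(1) n(1), of v] assms(3) p by auto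
  obtain c' where c': "m = (c', x', iter e n' x')" "int n' = pos e (iter e n' x') - pos e x' + (if c' then int (len e x') else 0)"
    using val_walk[OF q(1) n(2), of v'] assms(4) q by auto
  have eq: "x' = x" "c' = c" "iter e n' x = iter d n x" using c(1) c'(1) by auto
  have x: "x \<in> P" using p(1) by (simp add: walk_ok_def)
  show ?thesis
  proof (cases "e = d")
    case True
    then have "n = n'" using c(2) c'(2) unfolding eq True by (cases c) (simp_all add: eq(3)[unfolded True])
    then show ?thesis using p q eq True by simp
  next
    case False
    then have e: "e = (\<not> d)" by auto
    have "iter d n x = x"
    proof (rule two_lines)
      show "ltop d (iter d n x) = ltop d x" using ltop_iter[OF x] .
      show "ltop (\<not> d) (iter d n x) = ltop (\<not> d) x" using ltop_iter[OF x, of e n'] eq e by simp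
    qed
    then have n: "n = (if c then len d x else 0)" "n' = (if c then len e x else 0)"
      using c(2) c'(2) eq by (auto split: if_splits)
    show ?thesis
    proof (cases c)
      case True
      have "u = u'" "v = v'" "u = \<phi> x" "v = \<phi> x"
        using p q eq \<open>iter d n x = x\<close> by auto
      moreover have "p = walk d x (len d x)" "q = walk (\<not> d) x (len (\<not> d) x)"
        "walk_ok d x (len d x)" "walk_ok (\<not> d) x (len (\<not> d) x)"
        using p q eq n e True by simp_all
      ultimately show ?thesis using x by blast
    next
      case False
      then show ?thesis using p q eq n by simp
    qed
  qed
qed

end

text \<open>Connectedness in the form of an induction principle: a set saturated under arrows and
  containing one vertex contains all of them.\<close>

lemma connected_closed_subset:
  assumes "Digraph_Component.connected G" "r \<in> verts G" "r \<in> S"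
    and "\<And>a. a \<in> arcs G \<Longrightarrow> tail G a \<in> S \<longleftrightarrow> head G a \<in> S"
  shows "verts G \<subseteq> S"
proof
  fix v assume "v \<in> verts G"
  then have "(r, v) \<in> rtrancl_on (verts G) ((arcs_ends G)\<^sup>s)"
    using assms(1,2) by (simp add: connected_conv)
  then show "v \<in> S"
    using assms(3,4) by (induction rule: rtrancl_on.induct) (auto simp: symcl_def arcs_ends_conv)
qed

lemma connectedI_closed_subset:
  assumes "wf_digraph G" "r \<in> verts G"
    and "\<And>S. r \<in> S \<Longrightarrow> (\<And>a. a \<in> arcs G \<Longrightarrow> tail G a \<in> S \<longleftrightarrow> head G a \<in> S) \<Longrightarrow> verts G \<subseteq> S"
  shows "Digraph_Component.connected G"
proof -
  interpret wf_digraph G by fact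
  let ?R = "rtrancl_on (verts G) ((arcs_ends G)\<^sup>s)"
  have sym: "sym ?R" by (rule rtrancl_on_sym) (auto simp: symcl_def sym_def)
  have "verts G \<subseteq> {v. (r, v) \<in> ?R}"
  proof (rule assms(3))
    fix a assume a: "a \<in> arcs G"
    then have "(tail G a, head G a) \<in> (arcs_ends G)\<^sup>s" "(head G a, tail G a) \<in> (arcs_ends G)\<^sup>s"
      by (auto simp: symcl_def arcs_ends_conv)
    then show "tail G a \<in> {v. (r, v) \<in> ?R} \<longleftrightarrow> head G a \<in> {v. (r, v) \<in> ?R}"
      using a by (auto intro: rtrancl_on_into_rtrancl_on)
  qed (use assms(2) in auto)
  then have R: "(r, v) \<in> ?R" if "v \<in> verts G" for v
    using that by auto
  have "(u, v) \<in> ?R" if "u \<in> verts G" "v \<in> verts G" for u v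
    by (rule rtrancl_on_trans[OF symD[OF sym R[OF that(1)]] R[OF that(2)]])
  then show ?thesis
    unfolding connected_conv using assms(2) by blast
qed

section \<open>Pedigree algebras\<close>

text \<open>Arrows \<open>Beta\<close> are named after their heads, whereas steps are indexed by
  their tails; this is the passage from tail to head.\<close>

fun beta_parent :: "ped_point \<Rightarrow> ped_point" where
  "beta_parent (Beta_End x) = x"
| "beta_parent x = x"

definition ped_arr :: "bool \<Rightarrow> ped_point \<Rightarrow> ped_arrow"
  where "ped_arr d x = (if d then Beta (beta_parent x) else Alpha x)"

definition pedigree_of :: "ped_point set \<Rightarrow> (ped_point, ped_arrow) pre_digraph"
  where "pedigree_of P = \<lparr>verts = P,
    arcs = {Alpha x | x. Alpha_End x \<in> P} \<union> {Beta x | x. Beta_End x \<in> P},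
    tail = ped_tail, head = ped_head\<rparr>"

context ped_set
begin

abbreviation "L \<equiv> pedigree_of P"

lemma L_simps [simp]:
  "verts L = P" "tail L = ped_tail" "head L = ped_head"
  "Alpha x \<in> arcs L \<longleftrightarrow> Alpha_End x \<in> P" "Beta x \<in> arcs L \<longleftrightarrow> Beta_End x \<in> P"
  by (auto simp: pedigree_of_def)

definition open_steps :: "(bool \<times> ped_point) set"
  where "open_steps = {(d, x). x \<in> P \<and> \<not> closing d x}"

lemma open_steps_iff:
  "(False, x) \<in> open_steps \<longleftrightarrow> Alpha_End x \<in> P"
  "(True, x) \<in> open_steps \<longleftrightarrow> (\<exists>y. x = Beta_End y \<and> x \<in> P)"
proof -
  show "(False, x) \<in> open_steps \<longleftrightarrow> Alpha_End x \<in> P"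
    using ext_P[of False x] by (auto simp: open_steps_def closing_def)
  show "(True, x) \<in> open_steps \<longleftrightarrow> (\<exists>y. x = Beta_End y \<and> x \<in> P)"
    using ltop_cases[of True x] ltop_ext_neq[of True x] by (auto simp: open_steps_def closing_def)
qed

lemma nxt_open:
  "Alpha_End x \<in> P \<Longrightarrow> nxt False x = Alpha_End x"
  "Beta_End x \<in> P \<Longrightarrow> nxt True (Beta_End x) = x"
proof -
  show "Alpha_End x \<in> P \<Longrightarrow> nxt False x = Alpha_End x"
    by (simp add: nxt_def down_def)
  show "nxt True (Beta_End x) = x" if "Beta_End x \<in> P"
    using that ext_P[of True x] inj_down[of True] by (auto simp: nxt_def down_def intro!: inv_into_f_eq)
qed

sublocale ped: line_quiver P L id ped_arr open_steps paths
proof (intro line_quiver.intro line_quiver_axioms.intro)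
  show "ped_set P" by (rule ped_set_axioms)
  show "partial_monoid paths idems pmul" by (rule paths_monoid)
  show "paths \<subseteq> basis" by (auto simp: paths_def basis_def el_def)
  show "bij_betw (\<lambda>(d, x). ped_arr d x) open_steps (arcs L)"
    unfolding bij_betw_def
  proof
    show "inj_on (\<lambda>(d, x). ped_arr d x) open_steps"
    proof (rule inj_onI)
      fix z z' :: "bool \<times> ped_point" assume z: "z \<in> open_steps" "z' \<in> open_steps"
        and eq: "(\<lambda>(d, x). ped_arr d x) z = (\<lambda>(d, x). ped_arr d x) z'"
      obtain d x d' x' where "z = (d, x)" "z' = (d', x')" by (cases z; cases z')
      then show "z = z'"
        using z eq by (cases d; cases d') (auto simp: ped_arr_def open_steps_iff)
    qed
    show "(\<lambda>(d, x). ped_arr d x) ` open_steps = arcs L"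
    proof (rule Set.set_eqI)
      fix a
      show "a \<in> (\<lambda>(d, x). ped_arr d x) ` open_steps \<longleftrightarrow> a \<in> arcs L"
      proof
        assume "a \<in> (\<lambda>(d, x). ped_arr d x) ` open_steps"
        then obtain d x where "(d, x) \<in> open_steps" "a = ped_arr d x" by auto
        then show "a \<in> arcs L" by (cases d) (auto simp: ped_arr_def open_steps_iff)
      next
        assume a: "a \<in> arcs L"
        show "a \<in> (\<lambda>(d, x). ped_arr d x) ` open_steps"
        proof (cases a)
          case (Alpha x)
          then have "(False, x) \<in> open_steps" "a = ped_arr False x"
            using a by (auto simp: open_steps_iff ped_arr_def)
          then show ?thesis by force
        next
          case (Beta x)
          then have "(True, Beta_End x) \<in> open_steps" "a = ped_arr True (Beta_End x)"
            using a by (auto simp: open_steps_iff ped_arr_def)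
          then show ?thesis by force
        qed
      qed
    qed
  qed
  fix d x assume dx: "(d, x) \<in> open_steps"
  then show x: "x \<in> P" by (simp add: open_steps_def)
  show "tail L (ped_arr d x) = id x"
    using dx by (cases d) (auto simp: ped_arr_def open_steps_iff)
  show "head L (ped_arr d x) = id (nxt d x)"
    using dx by (cases d) (auto simp: ped_arr_def open_steps_iff nxt_open)
  have "step d x \<in> basis" by (rule step_basis[OF x])
  then show "step d x \<in> paths"
    using dx by (auto simp: open_steps_def step_def paths_def basis_iff el_def)
qed (auto simp: bij_betw_def)

text \<open>A full turn would have the dual of an idempotent as its value, but values of paths of
  the pedigree stay in \<open>paths\<close>.\<close>

lemma not_full_open_walk: "\<not> ped.walk_ok d x (len d x)"
proof
  assume ok: "ped.walk_ok d x (len d x)"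
  then have x: "x \<in> P" by (simp add: ped.walk_ok_def)
  have "(True, x, x) \<in> paths"
    using ped.val_closed'[OF ped.awalk_walk[OF ok] ped.val_full_walk[OF ok]] by simp
  then show False by (simp add: paths_def)
qed

lemma open_walk_less: "ped.walk_ok d x n \<Longrightarrow> n < len d x"
  using not_full_open_walk[of d x] ped.walk_ok_mono[of d x n "len d x"] by (meson not_le_imp_less)

text \<open>A closing step leaves the point of highest position, so none occurs on the way up to
  \<open>y\<close>.\<close>

lemma open_walk:
  assumes "x \<in> P" "y \<in> P" "ltop d x = ltop d y" "pos d x \<le> pos d y"
  defines "n \<equiv> nat (pos d y - pos d x)"
  shows "ped.walk_ok d x n" "iter d n x = y"
proof -
  have *: "pos d (iter d i x) = pos d x + int i" if "i \<le> n" for i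
    using that
  proof (induction i)
    case (Suc i)
    have i: "iter d i x \<in> P" "ltop d (iter d i x) = ltop d x" using assms(1) by (auto simp: iter_P ltop_iter)
    have "\<not> closing d (iter d i x)"
    proof
      assume "closing d (iter d i x)"
      then have "pos d y \<le> pos d (iter d i x)"
        using closing_pos(1)[OF i(1) _ assms(2)] i(2) assms(3) by simp
      then show False using Suc assms(4) unfolding n_def by simp
    qed
    then show ?case using Suc nxt_pos[OF i(1)] by simp
  qed simp
  have "(d, iter d i x) \<in> open_steps" if "i < n" for i
  proof -
    have i: "iter d i x \<in> P" "ltop d (iter d i x) = ltop d x" using assms(1) by (auto simp: iter_P ltop_iter)
    have "\<not> closing d (iter d i x)"
    proof
      assume "closing d (iter d i x)"
      then have "pos d y \<le> pos d (iter d i x)"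
        using closing_pos(1)[OF i(1) _ assms(2)] i(2) assms(3) by simp
      then show False using *[of i] that assms(4) unfolding n_def by simp
    qed
    then show ?thesis using i by (simp add: open_steps_def)
  qed
  then show "ped.walk_ok d x n" using assms(1) by (simp add: ped.walk_ok_def)
  have "pos d (iter d n x) = pos d y" using *[of n] assms(4) unfolding n_def by simp
  then show "iter d n x = y"
    using ltop_iter[OF assms(1), of d n] assms(3) by (intro pos_eq[of d "iter d n x" y]) simp_all
qed

text \<open>No arrow \<beta> follows an arrow \<alpha>: the latter ends in an
  \<open>Alpha_End\<close>, the former starts in a \<open>Beta_End\<close>. So each turn is one of
  the given zero relations.\<close>

lemma ped_turning:
  assumes "ped.turning u p v"
  obtains q x r where "p = q @ [Beta x, Alpha x] @ r" "Beta_End x \<in> P" "Alpha_End x \<in> P"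
    "ped.awalk u q (Beta_End x)" "ped.awalk (Alpha_End x) r v"
proof -
  obtain q d y r where t: "p = q @ [ped_arr d y, ped_arr (\<not> d) (nxt d y)] @ r" "(d, y) \<in> open_steps"
      "(\<not> d, nxt d y) \<in> open_steps" "ped.awalk u q (id y)" "ped.awalk (id (nxt (\<not> d) (nxt d y))) r v"
    using assms unfolding ped.turning_def by blast
  have d
  proof (rule ccontr)
    assume "\<not> d"
    then show False using t(2,3) by (auto simp: open_steps_iff nxt_open)
  qed
  then obtain x where x: "y = Beta_End x" "Beta_End x \<in> P"
    using t(2) by (auto simp: open_steps_iff)
  then have "nxt d y = x" "Alpha_End x \<in> P"
    using t(3) \<open>d\<close> by (auto simp: open_steps_iff nxt_open)
  then show ?thesis
    using t x \<open>d\<close> by (intro that[of q x r]) (auto simp: ped_arr_def nxt_open)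
qed

theorem pedigree_algebra_isomorphic:
  defines "K \<equiv> TYPE('k::field)"
  shows "alg_isomorphic (pedigree_algebra K L) (mono_alg paths idems pmul)"
    and "\<And>c X. X \<in> carrier (pedigree_algebra K L) \<Longrightarrow>
      c \<odot>\<^bsub>pedigree_algebra K L\<^esub> X \<in> carrier (pedigree_algebra K L)"
    and "ring (pedigree_algebra K L)"
proof -
  let ?R = "pedigree_relations L :: ((ped_point, ped_arrow) path \<Rightarrow>\<^sub>0 'k) set"
  have surj: "\<exists>p\<in>quiver_paths L. ped.val p = Some m" if "m \<in> paths" for m
  proof -
    obtain x y where m: "m = (False, x, y)" "le x y" using \<open>m \<in> paths\<close> by (auto simp: paths_def)
    then have P: "x \<in> P" "y \<in> P" using le_P by auto
    obtain d where d: "ltop d x = ltop d y" "pos d x \<le> pos d y" using m(2) by (rule leE)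
    define n where "n = nat (pos d y - pos d x)"
    have w: "ped.walk_ok d x n" "iter d n x = y"
      using open_walk[OF P d] by (simp_all add: n_def)
    obtain c where c: "ped.val (id x, ped.walk d x n, y) = Some (c, x, y)"
      "int n = pos d y - pos d x + (if c then int (len d x) else 0)"
      using ped.val_walk[OF w(1), of y] open_walk_less[OF w(1)] w(2) by auto
    have "\<not> c" using c(2) d(2) len_gt_0[OF P(1), of d] by (auto simp: n_def)
    then show ?thesis
      using c(1) ped.awalk_walk[OF w(1)] w(2) m(1)
      by (intro bexI[of _ "(x, ped.walk d x n, y)"]) auto
  qed
  have rel: "keys r \<subseteq> quiver_paths L \<and> lin_lift ped.val r = 0" if r: "r \<in> ?R" for r
  proof -
    obtain x where x: "r = single (Beta_End x, [Beta x, Alpha x], Alpha_End x) 1"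
      "Alpha_End x \<in> P" "Beta_End x \<in> P"
      using r by (auto simp: pedigree_relations_def)
    have xP: "x \<in> P" using x(2) ext_P[of False x] by simp
    have "ped.turning (Beta_End x) ([] @ [ped_arr True (Beta_End x), ped_arr (\<not> True) (nxt True (Beta_End x))] @ [])
        (Alpha_End x)"
      by (rule ped.turningI) (use x xP in \<open>auto simp: open_steps_iff nxt_open ped.awalk_Nil_iff\<close>)
    then have "ped.val (Beta_End x, [Beta x, Alpha x], Alpha_End x) = None"
      using ped.val_turning x by (simp add: nxt_open ped_arr_def)
    moreover have "ped.awalk (Beta_End x) [Beta x, Alpha x] (Alpha_End x)"
      using x xP by (simp add: ped.awalk_simps)
    ultimately show ?thesis using x(1) by simp
  qed
  have None_I: "single p 1 \<in> I"
    if I: "ideal I (path_algebra L :: ('k, _) module)" "?R \<subseteq> I" "p \<in> quiver_paths L" "ped.val p = None" for I p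
  proof -
    obtain u q v where p: "p = (u, q, v)" by (cases p)
    have awalk: "ped.awalk u q v" using I(3) p by simp
    have "ped.turning u q v"
    proof (rule ccontr)
      assume "\<not> ?thesis"
      then obtain d x n where w: "ped.walk_ok d x n" "u = id x" "q = ped.walk d x n"
        using ped.walk_or_turning[OF awalk] by blast
      then show False
        using ped.val_walk[OF w(1), of v] open_walk_less[OF w(1)] I(4) p by auto
    qed
    then obtain q1 x q2 where t: "q = q1 @ [Beta x, Alpha x] @ q2" "Beta_End x \<in> P" "Alpha_End x \<in> P"
      "ped.awalk u q1 (Beta_End x)" "ped.awalk (Alpha_End x) q2 v"
      by (rule ped_turning)
    have "x \<in> P" using t(3) ext_P[of False x] by simp
    then have "single (Beta_End x, [Beta x, Alpha x], Alpha_End x) 1 \<in> I"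
      using t I(2) by (auto simp: pedigree_relations_def)
    then show ?thesis
      using ped.path_ideal_single[OF I(1) _ t(4,5), of "[Beta x, Alpha x]"] t(1) p by simp
  qed
  have Some_I: "single p 1 - single q 1 \<in> I"
    if I: "ideal I (path_algebra L :: ('k, _) module)" "?R \<subseteq> I" "p \<in> quiver_paths L" "q \<in> quiver_paths L"
      "ped.val p = Some m" "ped.val q = Some m" for I p q m
  proof -
    obtain u p' v u' q' v' where pq: "p = (u, p', v)" "q = (u', q', v')" by (cases p; cases q)
    have "u = u' \<and> v = v' \<and> p' = q'"
      using ped.val_Some_cases[of u p' v u' q' v' m] I(3-6) not_full_open_walk unfolding pq by auto
    then have "p = q" using pq by simp
    then show ?thesis
      using additive_subgroup.zero_closed[OF ideal.axioms(1)[OF I(1)]]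
      by (simp add: path_algebra_mono_alg)
  qed
  have eq: "pedigree_algebra K L = bound_quiver_algebra L ?R"
    by (simp add: K_def pedigree_algebra_def)
  show "alg_isomorphic (pedigree_algebra K L) (mono_alg paths idems pmul)"
    unfolding eq by (rule ped.bound_quiver_algebra_isomorphic(1)) (fact surj rel None_I Some_I)+
  show "c \<odot>\<^bsub>pedigree_algebra K L\<^esub> X \<in> carrier (pedigree_algebra K L)"
    if "X \<in> carrier (pedigree_algebra K L)" for c X
    using that unfolding eq
    by (rule ped.bound_quiver_algebra_isomorphic(2)[rotated 4]) (fact surj rel None_I Some_I)+
  show "ring (pedigree_algebra K L)"
    unfolding eq by (rule ped.bound_quiver_algebra_isomorphic(3)) (fact surj rel None_I Some_I)+
qed

end

section \<open>The Brauer quiver of a pedigree\<close>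

text \<open>Positions on a closed walk are indices modulo its length; a property handed on to the
  next index spreads all around.\<close>

lemma cyclic_closed:
  assumes "\<And>i. i < n \<Longrightarrow> S i \<Longrightarrow> S (Suc i mod n)" "S m" "m < n" "j < n"
  shows "S j"
proof -
  have "S ((m + k) mod n)" for k
  proof (induction k)
    case (Suc k)
    then show ?case using assms(1)[of "(m + k) mod n"] assms(3) by (simp add: mod_Suc_eq)
  qed (use assms in simp)
  from this[of "j + n - m"] show ?thesis using assms(3,4) by simp
qed

lemma brauer_relations_zero:
  "\<lbrakk>a \<in> arcs Q; b \<in> arcs Q; head Q a = tail Q b; C \<in> quiver_cycles Q; C' \<in> quiver_cycles Q;
    C \<noteq> C'; a \<in> cycle_arcs C; b \<in> cycle_arcs C'\<rbrakk>
    \<Longrightarrow> single (tail Q a, [a, b], head Q b) 1 \<in> brauer_relations Q"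
  unfolding brauer_relations_def by blast

lemma brauer_relations_zeta:
  "\<lbrakk>x \<in> verts Q; C \<in> quiver_cycles Q; C' \<in> quiver_cycles Q; C \<noteq> C';
    x \<in> cycle_verts Q C; x \<in> cycle_verts Q C'\<rbrakk>
    \<Longrightarrow> single (zeta Q x C) 1 - single (zeta Q x C') 1 \<in> brauer_relations Q"
  unfolding brauer_relations_def by blast

locale brauer_lines = line_quiver P Q \<phi> arr "UNIV \<times> P" "ped_set.basis P"
  for P and Q :: "('v, 'a) pre_digraph" and \<phi> arr
begin

definition cyc :: "bool \<Rightarrow> ped_point \<Rightarrow> 'a list"
  where "cyc d x = walk d x (len d x)"

lemma walk_ok_iff [simp]: "walk_ok d x n \<longleftrightarrow> x \<in> P"
  by (auto simp: walk_ok_def iter_P)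

lemma arr_simps [simp]:
  "x \<in> P \<Longrightarrow> tail Q (arr d x) = \<phi> x" "x \<in> P \<Longrightarrow> head Q (arr d x) = \<phi> (nxt d x)"
  "x \<in> P \<Longrightarrow> arr d x \<in> arcs Q"
  by (simp_all add: tail_arr head_arr arr_arcs)

lemma arr_inject [simp]: "x \<in> P \<Longrightarrow> y \<in> P \<Longrightarrow> arr d x = arr e y \<longleftrightarrow> d = e \<and> x = y"
  by (rule arr_eq_iff) auto

lemma awalk_cyc: "x \<in> P \<Longrightarrow> awalk (\<phi> x) (cyc d x) (\<phi> x)"
  using awalk_walk[of d x "len d x"] by (simp add: cyc_def iter_len)

lemma cyc_Cons: "x \<in> P \<Longrightarrow> cyc d x = arr d x # walk d (nxt d x) (len d x - 1)"
  using walk_Suc_left[of d x "len d x - 1"] len_gt_0[of x d] by (simp add: cyc_def)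

lemma cyc_neq_Nil: "x \<in> P \<Longrightarrow> cyc d x \<noteq> []"
  by (simp add: cyc_Cons)

lemma hd_cyc: "x \<in> P \<Longrightarrow> hd (cyc d x) = arr d x"
  by (simp add: cyc_Cons)

lemma rotate1_cyc: "x \<in> P \<Longrightarrow> rotate1 (cyc d x) = cyc d (nxt d x)"
proof -
  assume x: "x \<in> P"
  have l: "len d (nxt d x) = len d x" using line_params(3)[OF ltop_nxt[OF x]] .
  have "iter d (len d x - 1) (nxt d x) = iter d (Suc (len d x - 1)) x"
    by (simp add: funpow_swap1)
  also have "\<dots> = x" using len_gt_0[OF x, of d] iter_len[OF x, of d] by (metis Suc_pred' One_nat_def)
  finally have "walk d (nxt d x) (Suc (len d x - 1)) = walk d (nxt d x) (len d x - 1) @ [arr d x]"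
    by (simp add: walk_Suc)
  then show ?thesis
    using cyc_Cons[OF x, of d] l len_gt_0[OF x, of d] by (simp add: cyc_def)
qed

lemma rotate_cyc: "x \<in> P \<Longrightarrow> rotate n (cyc d x) = cyc d (iter d n x)"
  by (induction n) (simp_all add: rotate1_cyc iter_P)

lemma rotations_cyc: "x \<in> P \<Longrightarrow> {rotate n (cyc d x) | n. True} = cyc d ` line d x"
proof -
  assume x: "x \<in> P"
  have "iter d n x \<in> line d x" for n using x by (simp add: line_def iter_P ltop_iter)
  then show ?thesis using line_iter[OF x, of d] by (auto simp: rotate_cyc[OF x])
qed

lemma set_cyc: "x \<in> P \<Longrightarrow> set (cyc d x) = arr d ` line d x"
  using line_iter[of x d] by (auto simp: cyc_def walk_def intro!: imageI)

lemma cycle_cyc: "x \<in> P \<Longrightarrow> cycle (cyc d x)"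
proof -
  assume x: "x \<in> P"
  have "inj_on (\<lambda>i. \<phi> (iter d (Suc i) x)) {0..<len d x}"
  proof (rule inj_onI)
    fix i j assume ij: "i \<in> {0..<len d x}" "j \<in> {0..<len d x}" "\<phi> (iter d (Suc i) x) = \<phi> (iter d (Suc j) x)"
    then have "nxt d (iter d i x) = nxt d (iter d j x)"
      using \<phi>_eq_iff[of "iter d (Suc i) x" "iter d (Suc j) x"] x by (simp add: iter_P nxt_P)
    then have "iter d i x = iter d j x"
      using inj_onD[OF inj_nxt] iter_P[OF x] by blast
    then show "i = j" using inj_onD[OF inj_on_iter[OF x, of d]] ij by auto
  qed
  moreover have "tl (awalk_verts (\<phi> x) (cyc d x)) = map (\<lambda>i. \<phi> (iter d (Suc i) x)) [0..<len d x]"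
    using awalk_cyc[OF x, of d] awalk_verts_conv'[of "\<phi> x" "cyc d x" "\<phi> x"] cyc_neq_Nil[OF x, of d] x
    by (auto simp: awalk_def cyc_def walk_def iter_P)
  ultimately have "distinct (tl (awalk_verts (\<phi> x) (cyc d x)))"
    by (simp add: distinct_map)
  then show ?thesis
    unfolding cycle_def using awalk_cyc[OF x] cyc_neq_Nil[OF x] by blast
qed

text \<open>
  Among the lines met by a cycle, consider one whose top is farthest from the root. The cycle
  can enter and leave it only through its top, hence does not leave it at all.
\<close>

lemma cycle_is_cyc:
  assumes "cycle p"
  obtains d x where "x \<in> P" "p = cyc d x"
proof -
  obtain u where u: "awalk u p u" "distinct (tl (awalk_verts u p))" "p \<noteq> []"
    using assms by (auto simp: cycle_def)
  define n where "n = length p"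
  have n: "0 < n" using u(3) by (simp add: n_def)
  have "\<forall>i. \<exists>d x. i < n \<longrightarrow> x \<in> P \<and> p ! i = arr d x"
  proof (intro allI)
    fix i
    show "\<exists>d x. i < n \<longrightarrow> x \<in> P \<and> p ! i = arr d x"
    proof (cases "i < n")
      case True
      then have "p ! i \<in> arcs Q" using u(1) nth_mem[of i p] by (auto simp: awalk_def n_def)
      then obtain d x where "(d, x) \<in> UNIV \<times> P" "p ! i = arr d x" by (rule arcsE)
      then show ?thesis by auto
    qed simp
  qed
  then obtain \<delta> \<xi> where dx: "\<And>i. i < n \<Longrightarrow> \<xi> i \<in> P" "\<And>i. i < n \<Longrightarrow> p ! i = arr (\<delta> i) (\<xi> i)"
    by metis
  have cas: "cas u p u" using u(1) by auto
  have verts1: "awalk_verts u p = map (tail Q) p @ [head Q (last p)]"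
    using awalk_verts_conv[of u p] u(3) by simp
  have verts2: "awalk_verts u p = tail Q (hd p) # map (head Q) p"
    using awalk_verts_conv'[OF cas] u(3) by simp
  have ends: "tail Q (hd p) = u" "head Q (last p) = u"
  proof -
    have "awhd u p = u" "awlast u p = u" using u(1) by auto
    then show "tail Q (hd p) = u" "head Q (last p) = u"
      using arg_cong[OF verts2, of hd] arg_cong[OF verts1, of last] by simp_all
  qed
  have dist: "distinct (map (head Q) p)" using u(2) verts2 by simp
  have succ: "\<xi> (Suc i mod n) = nxt (\<delta> i) (\<xi> i)" if i: "i < n" for i
  proof -
    have "tail Q (p ! (Suc i mod n)) = head Q (p ! i)"
    proof (cases "Suc i = n")
      case True
      then have "i = length p - 1" by (simp add: n_def)
      moreover have "Suc i mod n = 0" using True by simp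
      ultimately have "p ! (Suc i mod n) = hd p" "p ! i = last p"
        using u(3) by (simp_all only: hd_conv_nth[OF u(3)] last_conv_nth[OF u(3)])
      then show ?thesis using ends by simp
    next
      case False
      then have lt: "Suc i < n" using i by simp
      have "awalk_verts u p ! Suc i = tail Q (p ! Suc i)"
        using lt unfolding verts1 n_def by (simp add: nth_append)
      moreover have "awalk_verts u p ! Suc i = head Q (p ! i)"
        using i unfolding verts2 n_def by simp
      ultimately show ?thesis using lt by simp
    qed
    moreover have "Suc i mod n < n" using n by simp
    ultimately have "\<phi> (\<xi> (Suc i mod n)) = \<phi> (nxt (\<delta> i) (\<xi> i))"
      using dx[OF i] dx[of "Suc i mod n"] by simp
    then show ?thesis
      using dx(1)[OF i] dx(1)[of "Suc i mod n"] n by (simp add: \<phi>_eq_iff nxt_P)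
  qed
  have inj_Suc: "i = j" if ij: "i < n" "j < n" "\<xi> (Suc i mod n) = \<xi> (Suc j mod n)" for i j
  proof -
    have "head Q (p ! i) = head Q (p ! j)"
      using succ[OF ij(1)] succ[OF ij(2)] ij(3) dx ij(1,2) by simp
    then have "map (head Q) p ! i = map (head Q) p ! j" using ij by (simp add: n_def)
    then show ?thesis using nth_eq_iff_index_eq[OF dist] ij by (simp add: n_def)
  qed
  have inj: "i = j" if ij: "i < n" "j < n" "\<xi> i = \<xi> j" for i j
  proof -
    define i' j' where "i' = (i + (n - 1)) mod n" and "j' = (j + (n - 1)) mod n"
    have *: "Suc i' mod n = i" "Suc j' mod n = j"
      using ij n unfolding i'_def j'_def by (simp_all add: mod_Suc_eq)
    have "i' < n" "j' < n" using n by (simp_all add: i'_def j'_def)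
    then have "i' = j'" using inj_Suc[of i' j'] * ij(3) by simp
    then show ?thesis using * by simp
  qed
  define f where "f i = size (ltop (\<delta> i) (\<xi> i))" for i
  have "Max (f ` {..<n}) \<in> f ` {..<n}" using n by (intro Max_in) auto
  then obtain m where m: "m < n" "f m = Max (f ` {..<n})" by auto
  have max: "f i \<le> f m" if "i < n" for i using m(2) that by simp
  define d t where "d = \<delta> m" and "t = ltop d (\<xi> m)"
  define S where "S i \<longleftrightarrow> \<delta> i = d \<and> ltop d (\<xi> i) = t" for i
  have Sm: "S m" by (simp add: S_def d_def t_def)
  have ft: "f m = size t" by (simp add: f_def t_def d_def)
  \<comment> \<open>A point of the line other than \<open>t\<close> is the top of its other line,
    which would then have a deeper top than \<open>t\<close>.\<close>
  have at_top: "\<xi> i = t" if i: "i < n" and l: "ltop d (\<xi> i) = t" and e: "size (ltop (\<not> d) (\<xi> i)) \<le> size t" for i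
  proof (rule ccontr)
    assume neq: "\<xi> i \<noteq> t"
    then have "size t < size (\<xi> i)" using size_ltop[of d "\<xi> i"] l by auto
    moreover have "ltop (\<not> d) (\<xi> i) = \<xi> i" using ltop_other[of d "\<xi> i"] neq l by simp
    ultimately show False using e by simp
  qed
  have all_S: "S j" if j: "j < n" for j
  proof (rule ccontr)
    assume nSj: "\<not> S j"
    obtain a where a: "a < n" "S a" "\<not> S (Suc a mod n)"
      using cyclic_closed[of n S m j] Sm m(1) j nSj by blast
    obtain b where b: "b < n" "\<not> S b" "S (Suc b mod n)"
      using cyclic_closed[of n "\<lambda>i. \<not> S i" j m] Sm m(1) j nSj by blast
    have lt: "Suc a mod n < n" "Suc b mod n < n" using n by auto
    have "\<xi> (Suc a mod n) = t"
    proof (rule at_top[OF lt(1)])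
      show l: "ltop d (\<xi> (Suc a mod n)) = t"
        using succ[OF a(1)] a(2) dx(1)[OF a(1)] by (simp add: S_def ltop_nxt)
      have "\<delta> (Suc a mod n) = (\<not> d)" using a(3) l by (auto simp: S_def)
      then show "size (ltop (\<not> d) (\<xi> (Suc a mod n))) \<le> size t"
        using max[OF lt(1)] ft by (simp add: f_def)
    qed
    moreover have "\<xi> (Suc b mod n) = t"
    proof (rule at_top[OF lt(2)])
      show l: "ltop d (\<xi> (Suc b mod n)) = t" using b(3) by (simp add: S_def)
      have lb: "ltop (\<delta> b) (\<xi> (Suc b mod n)) = ltop (\<delta> b) (\<xi> b)"
        using succ[OF b(1)] dx(1)[OF b(1)] by (simp add: ltop_nxt)
      have "\<delta> b = (\<not> d)"
      proof (rule ccontr)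
        assume "\<delta> b \<noteq> (\<not> d)"
        then have "\<delta> b = d" by simp
        then show False using b(2) lb l by (simp add: S_def)
      qed
      then show "size (ltop (\<not> d) (\<xi> (Suc b mod n))) \<le> size t"
        using max[OF b(1)] ft lb by (simp add: f_def)
    qed
    \<comment> \<open>The chosen line is left and entered at the same point \<open>t\<close>, which
      the cycle visits only once.\<close>
    ultimately have "Suc a mod n = Suc b mod n" using inj[OF lt] by simp
    then show False using a(3) b(3) by simp
  qed
  define x where "x = \<xi> 0"
  have x: "x \<in> P" using dx(1)[of 0] n by (simp add: x_def)
  have iter: "\<xi> (i mod n) = iter d i x" if "i \<le> n" for i
    using that
  proof (induction i)
    case (Suc i)
    then have "\<delta> i = d" "\<xi> i = iter d i x" using all_S[of i] by (auto simp: S_def)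
    then show ?case using succ[of i] Suc.prems by simp
  qed (simp add: x_def)
  have "n = len d x"
  proof (rule ccontr)
    assume "n \<noteq> len d x"
    then consider "n < len d x" | "len d x < n" by linarith
    then show False
    proof cases
      case 1
      then show False using iter[of n] iter_neq[OF x n, of d] by (simp add: x_def)
    next
      case 2
      then have "\<xi> (len d x) = \<xi> 0" using iter[of "len d x"] iter_len[OF x, of d] by (simp add: x_def)
      then show False using inj[of "len d x" 0] 2 n len_gt_0[OF x, of d] by simp
    qed
  qed
  moreover have "p = walk d x n"
  proof (rule nth_equalityI)
    fix i assume "i < length p"
    then have i: "i < n" by (simp add: n_def)
    then show "p ! i = walk d x n ! i"
      using dx(2)[OF i] all_S[OF i] iter[of i] by (simp add: S_def walk_def)
  qed (simp add: n_def)
  ultimately show ?thesis using that x by (simp add: cyc_def)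
qed

section \<open>The cycles of the quiver are the closed-up lines\<close>

definition Z :: "bool \<Rightarrow> ped_point \<Rightarrow> 'a list set"
  where "Z d x = cyc d ` line d x"

lemma quiver_cycles_eq: "quiver_cycles Q = {Z d x | d x. x \<in> P}"
proof (rule Set.set_eqI)
  fix C
  show "C \<in> quiver_cycles Q \<longleftrightarrow> C \<in> {Z d x | d x. x \<in> P}"
  proof
    assume "C \<in> quiver_cycles Q"
    then obtain p where p: "C = {rotate n p | n. True}" "cycle p" by (auto simp: quiver_cycles_def)
    obtain d x where "x \<in> P" "p = cyc d x" using p(2) by (rule cycle_is_cyc)
    then have "C = Z d x" using p(1) rotations_cyc[of x d] by (simp add: Z_def)
    then show "C \<in> {Z d x | d x. x \<in> P}" using \<open>x \<in> P\<close> by blast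
  next
    assume "C \<in> {Z d x | d x. x \<in> P}"
    then obtain d x where x: "x \<in> P" "C = Z d x" by auto
    have "C = {rotate n (cyc d x) | n. True}" using rotations_cyc[OF x(1), of d] x(2) by (simp add: Z_def)
    then show "C \<in> quiver_cycles Q"
      unfolding quiver_cycles_def using cycle_cyc[OF x(1), of d] by blast
  qed
qed

lemma line_P: "y \<in> line d x \<Longrightarrow> y \<in> P"
  by (simp add: line_def)

lemma line_trans: "y \<in> line d x \<Longrightarrow> line d y = line d x"
  by (auto simp: line_def)

lemma line_self: "x \<in> P \<Longrightarrow> x \<in> line d x"
  by (simp add: line_def)

lemma cycle_arcs_Z: "cycle_arcs (Z d x) = arr d ` line d x"
proof -
  have "set (cyc d y) = arr d ` line d x" if "y \<in> line d x" for y
    using set_cyc[OF line_P[OF that], of d] line_trans[OF that] by simp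
  then have "cycle_arcs (Z d x) = (\<Union>y\<in>line d x. arr d ` line d x)"
    by (simp add: cycle_arcs_def Z_def)
  then show ?thesis by auto
qed

lemma cycle_verts_Z: "cycle_verts Q (Z d x) = \<phi> ` line d x"
  unfolding cycle_verts_def cycle_arcs_Z image_image by (rule image_cong) (auto simp: line_P)

lemma Z_eq_iff: "x \<in> P \<Longrightarrow> y \<in> P \<Longrightarrow> Z d x = Z e y \<longleftrightarrow> d = e \<and> ltop d x = ltop e y"
proof
  assume P: "x \<in> P" "y \<in> P" and "Z d x = Z e y"
  then have "arr d ` line d x = arr e ` line e y" by (metis cycle_arcs_Z)
  then have "arr d x \<in> arr e ` line e y" using line_self[OF P(1), of d] by blast
  then obtain z where z: "z \<in> line e y" "arr d x = arr e z" by auto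
  then have "d = e \<and> x = z" using arr_inject[OF P(1) line_P[OF z(1)]] by simp
  then show "d = e \<and> ltop d x = ltop e y" using z(1) by (simp add: line_def)
next
  assume "d = e \<and> ltop d x = ltop e y"
  then have "d = e" "line d x = line e y" using line_cong[of e x y] by blast+
  then show "Z d x = Z e y" by (simp add: Z_def)
qed

lemma \<phi>_line_iff: "x \<in> P \<Longrightarrow> \<phi> x \<in> \<phi> ` line d y \<longleftrightarrow> ltop d x = ltop d y"
proof
  assume x: "x \<in> P" and "\<phi> x \<in> \<phi> ` line d y"
  then obtain z where "z \<in> line d y" "\<phi> x = \<phi> z" by auto
  then show "ltop d x = ltop d y" using \<phi>_eq_iff[OF x line_P, of z d y] by (simp add: line_def)
qed (auto simp: line_def)

lemma zeta_Z: "x \<in> P \<Longrightarrow> zeta Q (\<phi> x) (Z d x) = (\<phi> x, cyc d x, \<phi> x)"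
proof -
  assume x: "x \<in> P"
  have "(THE p. p \<in> Z d x \<and> tail Q (hd p) = \<phi> x) = cyc d x"
  proof (rule the_equality)
    show "cyc d x \<in> Z d x \<and> tail Q (hd (cyc d x)) = \<phi> x"
      using line_self[OF x] x by (simp add: Z_def hd_cyc)
    fix p assume p: "p \<in> Z d x \<and> tail Q (hd p) = \<phi> x"
    then obtain y where y: "y \<in> line d x" "p = cyc d y" by (auto simp: Z_def)
    then have "\<phi> y = \<phi> x" using p line_P[OF y(1)] by (simp add: hd_cyc)
    then show "p = cyc d x" using y \<phi>_eq_iff[OF line_P[OF y(1)] x] by simp
  qed
  then show ?thesis by (simp add: zeta_def)
qed

lemma cycles_at:
  assumes "x \<in> P"
  shows "{C \<in> quiver_cycles Q. \<phi> x \<in> cycle_verts Q C} = {Z False x, Z True x}"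
proof (rule Set.set_eqI)
  fix C
  show "C \<in> {C \<in> quiver_cycles Q. \<phi> x \<in> cycle_verts Q C} \<longleftrightarrow> C \<in> {Z False x, Z True x}"
  proof
    assume "C \<in> {C \<in> quiver_cycles Q. \<phi> x \<in> cycle_verts Q C}"
    then obtain d y where "y \<in> P" "C = Z d y" "\<phi> x \<in> \<phi> ` line d y"
      by (auto simp: quiver_cycles_eq cycle_verts_Z)
    then have "C = Z d x" using assms Z_eq_iff[of x y d d] \<phi>_line_iff[OF assms] by simp
    then show "C \<in> {Z False x, Z True x}" by (cases d) auto
  next
    assume "C \<in> {Z False x, Z True x}"
    then obtain d where "C = Z d x" by blast
    moreover have "Z d x \<in> quiver_cycles Q" unfolding quiver_cycles_eq using assms by blast
    moreover have "\<phi> x \<in> cycle_verts Q (Z d x)"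
      using line_self[OF assms] by (simp add: cycle_verts_Z)
    ultimately show "C \<in> {C \<in> quiver_cycles Q. \<phi> x \<in> cycle_verts Q C}" by simp
  qed
qed

text \<open>The conditions on cycles come from \<open>cycles_at\<close> and
  \<open>two_lines\<close>. Connectedness comes from the tree, since each \<open>ext d x\<close> is
  joined to \<open>x\<close> by an ordinary step.\<close>

theorem brauer_quiver: "brauer_quiver Q"
  unfolding brauer_quiver_def
proof (intro conjI ballI impI)
  show "fin_digraph Q" by (rule fin_digraph_axioms)
  show "Digraph_Component.connected Q"
  proof (rule connectedI_closed_subset)
    show "wf_digraph Q" by (rule wf_digraph_axioms)
    show "\<phi> Omega \<in> verts Q" by (simp add: \<phi>_verts)
    fix S assume S: "\<phi> Omega \<in> S" "\<And>a. a \<in> arcs Q \<Longrightarrow> tail Q a \<in> S \<longleftrightarrow> head Q a \<in> S"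
    have step: "\<phi> x \<in> S \<longleftrightarrow> \<phi> (nxt d x) \<in> S" if "x \<in> P" for d x
      using S(2)[of "arr d x"] that by simp
    have "\<phi> x \<in> S" if "x \<in> P" for x
      using that
    proof (induction x rule: ped_point_induct)
      case (ext d x)
      then have x: "x \<in> P" using ext_P by blast
      have "\<phi> x \<in> S \<longleftrightarrow> \<phi> (ext d x) \<in> S"
        using step[of "ext d x" True] step[of x False] nxt_open[of x] x ext.prems by (cases d) auto
      then show ?case using ext.IH x by simp
    qed (rule S(1))
    then show "verts Q \<subseteq> S" by (auto elim: vertsE)
  qed
  show "\<exists>C\<in>quiver_cycles Q. a \<in> cycle_arcs C" if a: "a \<in> arcs Q" for a
  proof -
    obtain d x where dx: "(d, x) \<in> UNIV \<times> P" "a = arr d x" using a by (rule arcsE)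
    then have "Z d x \<in> quiver_cycles Q" "a \<in> cycle_arcs (Z d x)"
      using line_self[of x d] by (auto simp: quiver_cycles_eq cycle_arcs_Z)
    then show ?thesis by blast
  qed
  show "card {C \<in> quiver_cycles Q. v \<in> cycle_verts Q C} = 2" if v: "v \<in> verts Q" for v
  proof -
    obtain x where x: "x \<in> P" "v = \<phi> x" using v by (rule vertsE)
    then show ?thesis using cycles_at[OF x(1)] Z_eq_iff[OF x(1) x(1), of False True] by simp
  qed
  show "card (cycle_verts Q C \<inter> cycle_verts Q C') \<le> 1"
    if C: "C \<in> quiver_cycles Q" "C' \<in> quiver_cycles Q" "C \<noteq> C'" for C C'
  proof -
    obtain d x e y where xy: "x \<in> P" "y \<in> P" "C = Z d x" "C' = Z e y"
      using C by (auto simp: quiver_cycles_eq)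
    have "v = w" if vw: "v \<in> cycle_verts Q C \<inter> cycle_verts Q C'" "w \<in> cycle_verts Q C \<inter> cycle_verts Q C'" for v w
    proof -
      obtain a where a: "a \<in> P" "v = \<phi> a" using vw(1) by (auto simp: xy cycle_verts_Z line_def)
      obtain b where b: "b \<in> P" "w = \<phi> b" using vw(2) by (auto simp: xy cycle_verts_Z line_def)
      have l: "ltop d a = ltop d x" "ltop e a = ltop e y" "ltop d b = ltop d x" "ltop e b = ltop e y"
        using vw a b by (auto simp: xy cycle_verts_Z \<phi>_line_iff)
      have "e = (\<not> d)"
      proof (rule ccontr)
        assume "e \<noteq> (\<not> d)"
        then have "e = d" by simp
        then have "C = C'" using l xy Z_eq_iff[of x y d e] by simp
        then show False using C(3) by simp
      qed
      then have "a = b" using two_lines[of d a b] l by simp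
      then show ?thesis using a b by simp
    qed
    then have "cycle_verts Q C \<inter> cycle_verts Q C' = {} \<or> (\<exists>v. cycle_verts Q C \<inter> cycle_verts Q C' = {v})"
      by blast
    then show ?thesis by auto
  qed
qed

theorem brauer_algebra_isomorphic:
  defines "K \<equiv> TYPE('k::field)"
  shows "alg_isomorphic (brauer_algebra K Q) (mono_alg basis idems pmul)"
    and "\<And>c X. X \<in> carrier (brauer_algebra K Q) \<Longrightarrow>
      c \<odot>\<^bsub>brauer_algebra K Q\<^esub> X \<in> carrier (brauer_algebra K Q)"
    and "ring (brauer_algebra K Q)"
proof -
  let ?R = "brauer_relations Q :: (('v, 'a) path \<Rightarrow>\<^sub>0 'k) set"
  have turn_rel: "single (\<phi> x, [arr d x, arr (\<not> d) (nxt d x)], \<phi> (nxt (\<not> d) (nxt d x))) 1 \<in> ?R"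
    if x: "x \<in> P" for d x
  proof -
    have y: "nxt d x \<in> P" using x by (rule nxt_P)
    have "Z d x \<noteq> Z (\<not> d) (nxt d x)" using Z_eq_iff[OF x y, of d "\<not> d"] by simp
    moreover have "Z d x \<in> quiver_cycles Q" "Z (\<not> d) (nxt d x) \<in> quiver_cycles Q"
      using x y by (auto simp: quiver_cycles_eq)
    moreover have "arr d x \<in> cycle_arcs (Z d x)" "arr (\<not> d) (nxt d x) \<in> cycle_arcs (Z (\<not> d) (nxt d x))"
      using line_self[OF x, of d] line_self[OF y, of "\<not> d"] by (simp_all add: cycle_arcs_Z)
    moreover have "arr d x \<in> arcs Q" "arr (\<not> d) (nxt d x) \<in> arcs Q"
      "head Q (arr d x) = tail Q (arr (\<not> d) (nxt d x))"
      using x y by simp_all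
    ultimately have "single (tail Q (arr d x), [arr d x, arr (\<not> d) (nxt d x)],
        head Q (arr (\<not> d) (nxt d x))) 1 \<in> ?R"
      by (intro brauer_relations_zero)
    then show ?thesis using x y by simp
  qed
  have zeta_rel: "single (\<phi> x, cyc d x, \<phi> x) 1 - single (\<phi> x, cyc (\<not> d) x, \<phi> x) 1 \<in> ?R"
    if x: "x \<in> P" for d x
  proof -
    have "Z d x \<noteq> Z (\<not> d) x" using Z_eq_iff[OF x x, of d "\<not> d"] by simp
    moreover have "Z d x \<in> quiver_cycles Q" "Z (\<not> d) x \<in> quiver_cycles Q"
      using x by (auto simp: quiver_cycles_eq)
    moreover have "\<phi> x \<in> cycle_verts Q (Z d x)" "\<phi> x \<in> cycle_verts Q (Z (\<not> d) x)"
      using line_self[OF x] by (simp_all add: cycle_verts_Z)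
    ultimately have "single (zeta Q (\<phi> x) (Z d x)) 1 -
        single (zeta Q (\<phi> x) (Z (\<not> d) x)) 1 \<in> ?R"
      using \<phi>_verts[OF x] by (intro brauer_relations_zeta)
    then show ?thesis unfolding zeta_Z[OF x] .
  qed
  have turning: "single (u, p, v) 1 \<in> I"
    if I: "ideal I (path_algebra Q :: ('k, _) module)" "?R \<subseteq> I" and t: "turning u p v" for I u p v
  proof -
    obtain q d y r where t: "p = q @ [arr d y, arr (\<not> d) (nxt d y)] @ r" "y \<in> P"
      "awalk u q (\<phi> y)" "awalk (\<phi> (nxt (\<not> d) (nxt d y))) r v"
      using t unfolding turning_def by auto
    have "single (\<phi> y, [arr d y, arr (\<not> d) (nxt d y)], \<phi> (nxt (\<not> d) (nxt d y))) 1 \<in> I"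
      using turn_rel[OF t(2)] I(2) by blast
    from path_ideal_single[OF I(1) this t(3,4)] show ?thesis unfolding t(1) .
  qed
  have val_cyc: "val (\<phi> x, cyc d x, v) = Some (True, x, x)" if "x \<in> P" for d x v
    using val_full_walk[of d x v] that by (simp add: cyc_def)
  have surj: "\<exists>p\<in>quiver_paths Q. val p = Some m" if m: "m \<in> basis" for m
  proof -
    obtain c x y where cxy: "m = (c, x, y)" "el c x y" using m by (auto simp: basis_def)
    then have P: "x \<in> P" "y \<in> P" using le_P by (auto simp: el_def split: if_splits)
    have "\<exists>d. ltop d y = ltop d x"
      using cxy(2) unfolding el_def le_def by metis
    then obtain d where d: "ltop d y = ltop d x" by blast
    show ?thesis
    proof (cases "c \<and> x = y")
      case True
      then show ?thesis
        using val_cyc[OF P(1), of d "\<phi> x"] awalk_cyc[OF P(1), of d] cxy(1)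
        by (intro bexI[of _ "(\<phi> x, cyc d x, \<phi> x)"]) auto
    next
      case False
      obtain n where n: "n < len d x" "iter d n x = y" by (rule iter_surj[OF P d])
      obtain c' where c': "val (\<phi> x, walk d x n, \<phi> y) = Some (c', x, y)"
        "int n = pos d y - pos d x + (if c' then int (len d x) else 0)"
        using val_walk[of d x n "\<phi> y"] P(1) n by auto
      \<comment> \<open>Within fewer than \<open>len d x\<close> steps, the closing step has been
        passed exactly when the position has dropped; this determines the flag.\<close>
      have "c' = c"
      proof (cases c)
        case True
        then have "pos d y \<le> pos d x" using cxy(2) le_line[of y x d] d by (simp add: el_def)
        moreover have "pos d y \<noteq> pos d x" using pos_eq[OF d] False True by auto
        ultimately show ?thesis using c'(2) True by (auto split: if_splits)
      next
        case c: False
        then have "pos d x \<le> pos d y" using cxy(2) le_line[of x y d] d by (simp add: el_def)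
        then show ?thesis using c'(2) n(1) c by (auto split: if_splits)
      qed
      then show ?thesis
        using c'(1) awalk_walk[of d x n] P(1) n(2) cxy(1)
        by (intro bexI[of _ "(\<phi> x, walk d x n, \<phi> y)"]) auto
    qed
  qed
  have rel: "keys r \<subseteq> quiver_paths Q \<and> lin_lift val r = 0" if r: "r \<in> ?R" for r
    using r unfolding brauer_relations_def
  proof
    assume "r \<in> {single (tail Q a, [a, b], head Q b) 1 | a b.
       a \<in> arcs Q \<and> b \<in> arcs Q \<and> head Q a = tail Q b \<and>
       (\<exists>Z \<in> quiver_cycles Q. \<exists>Z' \<in> quiver_cycles Q.
          Z \<noteq> Z' \<and> a \<in> cycle_arcs Z \<and> b \<in> cycle_arcs Z')}"
    then obtain a b C C' where ab: "r = single (tail Q a, [a, b], head Q b) 1"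
      "a \<in> arcs Q" "b \<in> arcs Q" "head Q a = tail Q b" "C \<in> quiver_cycles Q" "C' \<in> quiver_cycles Q"
      "C \<noteq> C'" "a \<in> cycle_arcs C" "b \<in> cycle_arcs C'" by blast
    obtain d x where C: "x \<in> P" "C = Z d x" using ab(5) by (auto simp: quiver_cycles_eq)
    obtain e y where C': "y \<in> P" "C' = Z e y" using ab(6) by (auto simp: quiver_cycles_eq)
    obtain x' where x': "x' \<in> line d x" "a = arr d x'" using ab(8) C by (auto simp: cycle_arcs_Z)
    obtain y' where y': "y' \<in> line e y" "b = arr e y'" using ab(9) C' by (auto simp: cycle_arcs_Z)
    have P: "x' \<in> P" "y' \<in> P" using x' y' line_P by auto
    have "\<phi> (nxt d x') = \<phi> y'" using ab(4) x' y' P by simp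
    then have eq: "y' = nxt d x'" using \<phi>_eq_iff[of "nxt d x'" y'] P nxt_P by simp
    have "e = (\<not> d)"
    proof (rule ccontr)
      assume "e \<noteq> (\<not> d)"
      then have "e = d" by simp
      then have "ltop d x = ltop e y"
        using x'(1) y'(1) eq ltop_nxt[OF P(1), of d] by (simp add: line_def)
      then show False using Z_eq_iff[OF C(1) C'(1), of d e] \<open>e = d\<close> ab(7) C C' by simp
    qed
    then have "turning (\<phi> x') ([] @ [arr d x', arr (\<not> d) (nxt d x')] @ []) (head Q b)"
      by (intro turningI) (use P y' eq nxt_P in \<open>auto simp: awalk_Nil_iff \<phi>_verts\<close>)
    then have "val (\<phi> x', [a, b], head Q b) = None"
      using val_turning x' y' eq \<open>e = (\<not> d)\<close> by simp
    moreover have "awalk (\<phi> x') [a, b] (head Q b)"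
      using ab(2-4) x' P by (simp add: awalk_simps)
    ultimately show ?thesis using ab(1) x' P by simp
  next
    assume "r \<in> {single (zeta Q x Z) 1 - single (zeta Q x Z') 1 | x Z Z'.
       x \<in> verts Q \<and> Z \<in> quiver_cycles Q \<and> Z' \<in> quiver_cycles Q \<and> Z \<noteq> Z' \<and>
       x \<in> cycle_verts Q Z \<and> x \<in> cycle_verts Q Z'}"
    then obtain v C C' where v: "r = single (zeta Q v C) 1 - single (zeta Q v C') 1"
      "v \<in> verts Q" "C \<in> quiver_cycles Q" "C' \<in> quiver_cycles Q" "v \<in> cycle_verts Q C" "v \<in> cycle_verts Q C'"
      by blast
    obtain x where x: "x \<in> P" "v = \<phi> x" using v(2) by (rule vertsE)
    have "C \<in> {Z False x, Z True x}" "C' \<in> {Z False x, Z True x}"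
      using cycles_at[OF x(1)] v x(2) by blast+
    then obtain d e where "C = Z d x" "C' = Z e x" by blast
    then have r: "r = single (\<phi> x, cyc d x, \<phi> x) 1 - single (\<phi> x, cyc e x, \<phi> x) 1"
      using v(1) x zeta_Z[OF x(1)] by simp
    have "keys r \<subseteq> keys (single (\<phi> x, cyc d x, \<phi> x) (1::'k)) \<union>
        keys (single (\<phi> x, cyc e x, \<phi> x) (1::'k))"
      unfolding r by (auto simp: in_keys_iff lookup_minus lookup_single when_def split: if_splits)
    then have "keys r \<subseteq> quiver_paths Q"
      using awalk_cyc[OF x(1)] by (auto split: if_splits)
    moreover have "lin_lift val r = 0"
      unfolding r lin_lift_diff by (simp add: val_cyc[OF x(1)])
    ultimately show ?thesis by simp
  qed
  have None_I: "single p 1 \<in> I"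
    if I: "ideal I (path_algebra Q :: ('k, _) module)" "?R \<subseteq> I" "p \<in> quiver_paths Q" "val p = None" for I p
  proof -
    obtain u q v where p: "p = (u, q, v)" by (cases p)
    have awalk: "awalk u q v" using I(3) p by simp
    from walk_or_turning[OF this] show ?thesis
    proof
      assume "turning u q v"
      then show ?thesis using turning[OF I(1,2)] p by simp
    next
      assume "\<exists>d x n. walk_ok d x n \<and> u = \<phi> x \<and> q = walk d x n \<and> v = \<phi> (iter d n x)"
      then obtain d x n where w: "x \<in> P" "u = \<phi> x" "q = walk d x n" "v = \<phi> (iter d n x)" by auto
      have "len d x < n"
        using val_walk[of d x n v] w I(4) p by (cases "n \<le> len d x") auto
      then obtain k where k: "n = len d x + Suc k" by (metis less_iff_Suc_add add_Suc_right)
      let ?r = "walk d x (Suc k)"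
      have q: "q = [] @ cyc d x @ ?r"
        using w(3) walk_add[of d x "len d x" "Suc k"] iter_len[OF w(1)] unfolding k by (simp add: cyc_def)
      have "iter d n x = iter d (Suc k) x"
        unfolding k iter_add iter_len[OF w(1)] ..
      then have r: "awalk (\<phi> x) ?r v" using awalk_walk[of d x "Suc k"] w(1,4) by simp
      have Nil: "awalk (\<phi> x) [] (\<phi> x)" using w(1) by (simp add: awalk_Nil_iff \<phi>_verts)
      \<comment> \<open>For a walk longer than a full turn, the initial cycle is exchanged for the
        other cycle at \<open>x\<close>. The last arrow of that cycle and the next arrow of the walk
        form a turn, so the new path lies in \<open>I\<close>.\<close>
      have "single (\<phi> x, cyc d x, \<phi> x) 1 - single (\<phi> x, cyc (\<not> d) x, \<phi> x) 1 \<in> I"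
        using zeta_rel[OF w(1)] I(2) by blast
      from path_ideal_diff[OF I(1) this Nil r]
      have diff: "single (\<phi> x, q, v) 1 - single (\<phi> x, cyc (\<not> d) x @ ?r, v) 1 \<in> I"
        unfolding q by simp
      define l where "l = len (\<not> d) x - 1"
      define z where "z = iter (\<not> d) l x"
      have l: "len (\<not> d) x = Suc l" using len_gt_0[OF w(1), of "\<not> d"] by (simp add: l_def)
      have z: "z \<in> P" "nxt (\<not> d) z = x"
        using iter_len[OF w(1), of "\<not> d"] iter_P[OF w(1)] unfolding l z_def by simp_all
      have "cyc (\<not> d) x @ ?r = walk (\<not> d) x l @ [arr (\<not> d) z, arr (\<not> (\<not> d)) (nxt (\<not> d) z)] @ walk d (nxt d x) k"
        unfolding cyc_def l walk_Suc[of "\<not> d" x l] walk_Suc_left[of d x k] z(2) by (simp add: z_def)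
      moreover have "turning (\<phi> x) \<dots> v"
      proof (rule turningI)
        show "awalk (\<phi> x) (walk (\<not> d) x l) (\<phi> z)"
          using awalk_walk[of "\<not> d" x l] w(1) by (simp add: z_def)
        show "awalk (\<phi> (nxt (\<not> (\<not> d)) (nxt (\<not> d) z))) (walk d (nxt d x) k) v"
          using r w(1) unfolding walk_Suc_left[of d x k] by (simp add: awalk_Cons_iff z(2))
      qed (use z w(1) in auto)
      ultimately have "single (\<phi> x, cyc (\<not> d) x @ ?r, v) 1 \<in> I"
        using turning[OF I(1,2)] by metis
      from path_ideal_add[OF I(1) diff this] show ?thesis
        using p w(2) by simp
    qed
  qed
  have Some_I: "single p 1 - single q 1 \<in> I"
    if I: "ideal I (path_algebra Q :: ('k, _) module)" "?R \<subseteq> I" "p \<in> quiver_paths Q" "q \<in> quiver_paths Q"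
      "val p = Some m" "val q = Some m" for I p q m
  proof -
    obtain u p' v u' q' v' where pq: "p = (u, p', v)" "q = (u', q', v')" by (cases p; cases q)
    have "u = u' \<and> v = v' \<and> (p' = q' \<or> (\<exists>d x. x \<in> P \<and> u = \<phi> x \<and> v = \<phi> x \<and> p' = cyc d x \<and> q' = cyc (\<not> d) x))"
      using val_Some_cases[of u p' v u' q' v' m] I(3-6) unfolding pq cyc_def by auto
    then have "p = q \<or> (\<exists>d x. x \<in> P \<and> p = (\<phi> x, cyc d x, \<phi> x) \<and> q = (\<phi> x, cyc (\<not> d) x, \<phi> x))"
      using pq by auto
    then show ?thesis
    proof
      assume "p = q"
      then show ?thesis
        using additive_subgroup.zero_closed[OF ideal.axioms(1)[OF I(1)]]
        by (simp add: path_algebra_mono_alg)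
    next
      assume "\<exists>d x. x \<in> P \<and> p = (\<phi> x, cyc d x, \<phi> x) \<and> q = (\<phi> x, cyc (\<not> d) x, \<phi> x)"
      then obtain d x where "x \<in> P" "p = (\<phi> x, cyc d x, \<phi> x)" "q = (\<phi> x, cyc (\<not> d) x, \<phi> x)" by blast
      then show ?thesis using zeta_rel[of x d] I(2) by blast
    qed
  qed
  have eq: "brauer_algebra K Q = bound_quiver_algebra Q ?R"
    by (simp add: K_def brauer_algebra_def)
  show "alg_isomorphic (brauer_algebra K Q) (mono_alg basis idems pmul)"
    unfolding eq by (rule bound_quiver_algebra_isomorphic(1)) (fact surj rel None_I Some_I)+
  show "c \<odot>\<^bsub>brauer_algebra K Q\<^esub> X \<in> carrier (brauer_algebra K Q)"
    if "X \<in> carrier (brauer_algebra K Q)" for c X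
    using that unfolding eq
    by (rule bound_quiver_algebra_isomorphic(2)[rotated 4]) (fact surj rel None_I Some_I)+
  show "ring (brauer_algebra K Q)"
    unfolding eq by (rule bound_quiver_algebra_isomorphic(3)) (fact surj rel None_I Some_I)+
qed

end

section \<open>The pedigree of a Brauer quiver\<close>

lemma cas_heads_tails: "pre_digraph.cas G u p v \<Longrightarrow> u # map (head G) p = map (tail G) p @ [v]"
  by (induction p arbitrary: u) (auto simp: pre_digraph.cas.simps)

text \<open>On a closed walk the heads are the tails shifted cyclically. This passes between
  distinct heads, as in the definition of a cycle, and distinct tails.\<close>

lemma closed_heads_tails:
  assumes "pre_digraph.cas G u p u"
  shows "mset (map (head G) p) = mset (map (tail G) p)"
  using arg_cong[OF cas_heads_tails[OF assms], of mset] by simp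

locale brauer =
  fixes Q :: "('v, 'a) pre_digraph"
  assumes brauer: "brauer_quiver Q"
begin

sublocale fin_digraph Q
  using brauer by (simp add: brauer_quiver_def)

abbreviation "cycs \<equiv> quiver_cycles Q"
abbreviation "cv \<equiv> cycle_verts Q"

lemma arc_on_cycle: "a \<in> arcs Q \<Longrightarrow> \<exists>C\<in>cycs. a \<in> cycle_arcs C"
  using brauer by (auto simp: brauer_quiver_def)

lemma two_cycles: "v \<in> verts Q \<Longrightarrow> card {C \<in> cycs. v \<in> cv C} = 2"
  using brauer by (auto simp: brauer_quiver_def)

lemma cycle_from:
  assumes "C \<in> cycs" "v \<in> cv C"
  obtains r where "r \<noteq> []" "awalk v r v" "set r = cycle_arcs C" "distinct (map (tail Q) r)"
    "C = {rotate n r | n. True}"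
proof -
  obtain p where p: "C = {rotate n p | n. True}" "cycle p" using assms(1) by (auto simp: quiver_cycles_def)
  obtain u where u: "awalk u p u" "distinct (tl (awalk_verts u p))" "p \<noteq> []"
    using p(2) by (auto simp: cycle_def)
  have arcs: "cycle_arcs C = set p"
    unfolding cycle_arcs_def p(1) by auto
  have "v \<in> tail Q ` set p" using assms(2) by (simp add: cycle_verts_def arcs)
  then obtain a p1 p2 where a: "p = p1 @ a # p2" "tail Q a = v"
    by (auto dest!: split_list)
  have cas: "cas u p u" using u(1) by auto
  have "distinct (map (head Q) p)"
    using u(2,3) awalk_verts_conv'[OF cas] by simp
  moreover have "mset (map (head Q) p) = mset (map (tail Q) p)"
    by (rule closed_heads_tails[OF cas])
  ultimately have dist: "distinct (map (tail Q) p)"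
    using mset_eq_imp_distinct_iff by blast
  let ?r = "(a # p2) @ p1"
  have r: "?r = rotate (length p1) p" unfolding a(1) rotate_append ..
  have w: "awalk u p1 (awlast u p1)" "awalk (awlast u p1) (a # p2) u"
    using u(1) unfolding a(1) awalk_append_iff by auto
  have "awlast u p1 = v" using w(2) a(2) by (simp add: awalk_Cons_iff)
  then have "awalk v ?r v" using w by (intro awalk_appendI) auto
  moreover have "distinct (map (tail Q) ?r)" using dist unfolding a(1) by auto
  moreover have "set ?r = cycle_arcs C" unfolding arcs a(1) by auto
  moreover have "C = {rotate n ?r | n. True}"
  proof -
    \<comment> \<open>The amount added is complementary to \<open>length p1\<close> modulo
      \<open>length p\<close>, so it undoes the rotation leading from \<open>p\<close> to the list
      on the right.\<close>
    have "rotate n p = rotate (n + (length p - length p1 mod length p)) ?r" for n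
    proof -
      have "rotate (n + (length p - length p1 mod length p)) ?r =
          rotate (n + (length p - length p1 mod length p) + length p1) p"
        unfolding r by (simp add: rotate_rotate)
      also have "\<dots> = rotate n p"
      proof -
        have "length p1 < length p" unfolding a(1) by simp
        then have "n + (length p - length p1 mod length p) + length p1 = n + length p" by simp
        then show ?thesis by (metis rotate_conv_mod mod_add_self2)
      qed
      finally show ?thesis ..
    qed
    moreover have "rotate n ?r = rotate (n + length p1) p" for n
      unfolding r by (simp add: rotate_rotate)
    ultimately show ?thesis unfolding p(1) by blast
  qed
  ultimately show ?thesis using that[of ?r] by blast
qed

lemma cycle_nonempty: "C \<in> cycs \<Longrightarrow> \<exists>v. v \<in> cv C"
proof -
  assume "C \<in> cycs"
  then obtain p where p: "C = {rotate n p | n. True}" "cycle p" by (auto simp: quiver_cycles_def)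
  have "cycle_arcs C = set p" unfolding cycle_arcs_def p(1) by auto
  moreover have "p \<noteq> []" using p(2) by (auto simp: cycle_def)
  ultimately show ?thesis by (cases p) (auto simp: cycle_verts_def)
qed

lemma cycle_facts:
  assumes "C \<in> cycs"
  shows "cycle_arcs C \<subseteq> arcs Q" "cv C \<subseteq> verts Q" "inj_on (tail Q) (cycle_arcs C)"
    "inj_on (head Q) (cycle_arcs C)" "head Q ` cycle_arcs C = cv C"
proof -
  obtain v where v: "v \<in> cv C" using cycle_nonempty[OF assms] by blast
  obtain r where r: "r \<noteq> []" "awalk v r v" "set r = cycle_arcs C" "distinct (map (tail Q) r)"
    by (rule cycle_from[OF assms v])
  show arcs: "cycle_arcs C \<subseteq> arcs Q" using r(2,3) by (auto simp: awalk_def)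
  then show "cv C \<subseteq> verts Q" by (auto simp: cycle_verts_def)
  show "inj_on (tail Q) (cycle_arcs C)" using r(3,4) by (simp add: distinct_map)
  have cas: "cas v r v" using r(2) by auto
  have m: "mset (map (head Q) r) = mset (map (tail Q) r)"
    by (rule closed_heads_tails[OF cas])
  then have "distinct (map (head Q) r)" using r(4) mset_eq_imp_distinct_iff by blast
  then show "inj_on (head Q) (cycle_arcs C)" using r(3) by (simp add: distinct_map)
  have "set (map (head Q) r) = set (map (tail Q) r)" using mset_eq_setD[OF m] .
  then show "head Q ` cycle_arcs C = cv C" using r(3) by (simp add: cycle_verts_def)
qed

lemma finite_cv: "C \<in> cycs \<Longrightarrow> finite (cv C)"
  by (rule finite_subset[OF cycle_facts(2)]) simp_all

lemma common_vertex:
  assumes "C \<in> cycs" "C' \<in> cycs" "C \<noteq> C'" "u \<in> cv C" "u \<in> cv C'" "v \<in> cv C" "v \<in> cv C'"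
  shows "u = v"
proof -
  have "card (cv C \<inter> cv C') \<le> 1" using brauer assms(1-3) by (simp add: brauer_quiver_def)
  then show ?thesis
    using assms(4-7) finite_cv[OF assms(1)] card_le_Suc0_iff_eq[of "cv C \<inter> cv C'"] by auto
qed

text \<open>Unless the arc is a loop, its two ends are common to both cycles. A cycle through a loop
  has no further arrow, since it would visit the point of the loop twice.\<close>

lemma arc_unique_cycle:
  assumes "C \<in> cycs" "C' \<in> cycs" "a \<in> cycle_arcs C" "a \<in> cycle_arcs C'"
  shows "C = C'"
proof (cases "tail Q a = head Q a")
  case False
  have "tail Q a \<in> cv D \<and> head Q a \<in> cv D" if "D \<in> cycs" "a \<in> cycle_arcs D" for D
    using cycle_facts(5)[OF that(1)] that(2) by (auto simp: cycle_verts_def)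
  then show ?thesis using common_vertex[OF assms(1,2)] assms(3,4) False assms(1,2) by blast
next
  case True
  have "D = {rotate n [a] | n. True}" if D: "D \<in> cycs" "a \<in> cycle_arcs D" for D
  proof -
    have v: "tail Q a \<in> cv D" using D by (auto simp: cycle_verts_def)
    obtain r where r: "r \<noteq> []" "awalk (tail Q a) r (tail Q a)" "set r = cycle_arcs D"
      "distinct (map (tail Q) r)" "D = {rotate n r | n. True}"
      by (rule cycle_from[OF D(1) v])
    obtain b s where b: "r = b # s" using r(1) by (cases r) auto
    have "tail Q b = tail Q a" using r(2) unfolding b by (simp add: awalk_Cons_iff)
    then have "b = a" using inj_onD[OF cycle_facts(3)[OF D(1)]] D(2) r(3) b by auto
    have "s = []"
    proof (rule ccontr)
      assume s: "s \<noteq> []"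
      have "awalk (tail Q a) s (tail Q a)"
        using r(2) True \<open>b = a\<close> unfolding b by (simp add: awalk_Cons_iff)
      then have "tail Q (hd s) = tail Q a" using s by (cases s) (auto simp: awalk_Cons_iff)
      then show False using r(4) s \<open>b = a\<close> unfolding b by (cases s) auto
    qed
    then show ?thesis using r(5) b \<open>b = a\<close> by simp
  qed
  then show ?thesis using assms by blast
qed

section \<open>Successors on a cycle, and walks avoiding a cycle\<close>

definition out :: "'a list set \<Rightarrow> 'v \<Rightarrow> 'a"
  where "out C v = inv_into (cycle_arcs C) (tail Q) v"

definition succ :: "'a list set \<Rightarrow> 'v \<Rightarrow> 'v"
  where "succ C v = head Q (out C v)"

definition pred :: "'a list set \<Rightarrow> 'v \<Rightarrow> 'v"
  where "pred C v = inv_into (cv C) (succ C) v"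

lemma out: "v \<in> cv C \<Longrightarrow> out C v \<in> cycle_arcs C" "v \<in> cv C \<Longrightarrow> tail Q (out C v) = v"
  unfolding out_def cycle_verts_def by (simp_all add: inv_into_into f_inv_into_f)

lemma out_eq: "C \<in> cycs \<Longrightarrow> a \<in> cycle_arcs C \<Longrightarrow> out C (tail Q a) = a"
  unfolding out_def by (simp add: cycle_facts(3))

lemma inj_succ: "C \<in> cycs \<Longrightarrow> inj_on (succ C) (cv C)"
proof (rule inj_onI)
  fix u v assume C: "C \<in> cycs" and uv: "u \<in> cv C" "v \<in> cv C" "succ C u = succ C v"
  then have "out C u = out C v"
    using inj_onD[OF cycle_facts(4)[OF C], of "out C u" "out C v"] out(1) by (simp add: succ_def)
  then show "u = v" using out(2) uv by metis
qed

lemma succ_cv: "C \<in> cycs \<Longrightarrow> v \<in> cv C \<Longrightarrow> succ C v \<in> cv C"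
  using cycle_facts(5)[of C] out(1)[of v C] by (auto simp: succ_def)

lemma succ_image: "C \<in> cycs \<Longrightarrow> succ C ` cv C = cv C"
  by (rule endo_inj_surj) (auto simp: finite_cv inj_succ succ_cv)

lemma pred: "C \<in> cycs \<Longrightarrow> v \<in> cv C \<Longrightarrow> pred C v \<in> cv C" "C \<in> cycs \<Longrightarrow> v \<in> cv C \<Longrightarrow> succ C (pred C v) = v"
  unfolding pred_def using succ_image[of C] inv_into_into[of v "succ C" "cv C"] f_inv_into_f[of v "succ C" "cv C"]
  by simp_all

text \<open>By \<open>off_sym\<close> the reflexive transitive closure is symmetric, so it describes
  the parts into which the quiver falls when the arcs of \<open>C\<close> are removed.\<close>

definition off :: "'a list set \<Rightarrow> ('v \<times> 'v) set"
  where "off C = {(tail Q a, head Q a) | a. a \<in> arcs Q \<and> a \<notin> cycle_arcs C}"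

lemma awalk_off: "awalk u p v \<Longrightarrow> set p \<inter> cycle_arcs C = {} \<Longrightarrow> (u, v) \<in> (off C)\<^sup>*"
proof (induction p arbitrary: u)
  case (Cons a p)
  then have "(u, head Q a) \<in> off C" "(head Q a, v) \<in> (off C)\<^sup>*"
    by (auto simp: awalk_Cons_iff off_def)
  then show ?case by (rule converse_rtrancl_into_rtrancl)
qed (simp add: awalk_Nil_iff)

lemma off_awalk:
  assumes "(u, v) \<in> (off C)\<^sup>*" "u \<in> verts Q"
  shows "\<exists>p. awalk u p v \<and> set p \<inter> cycle_arcs C = {}"
  using assms
proof (induction rule: rtrancl_induct)
  case base
  then show ?case by (intro exI[of _ "[]"]) (simp add: awalk_Nil_iff)
next
  case (step v w)
  then obtain p where p: "awalk u p v" "set p \<inter> cycle_arcs C = {}" by blast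
  obtain a where a: "a \<in> arcs Q" "a \<notin> cycle_arcs C" "v = tail Q a" "w = head Q a"
    using step(2) by (auto simp: off_def)
  have "awalk u (p @ [a]) w"
    using p(1) arc_implies_awalk[OF a(1)] unfolding a(3,4) by (rule awalk_appendI)
  then show ?case using p(2) a(2) by (intro exI[of _ "p @ [a]"]) auto
qed

lemma cycle_off:
  assumes "C \<in> cycs" "C' \<in> cycs" "C \<noteq> C'" "u \<in> cv C'" "v \<in> cv C'"
  shows "(u, v) \<in> (off C)\<^sup>*"
proof -
  obtain r where r: "r \<noteq> []" "awalk u r u" "set r = cycle_arcs C'"
    by (rule cycle_from[OF assms(2,4)])
  have "v \<in> tail Q ` set r" using assms(5) r(3) by (simp add: cycle_verts_def)
  then obtain a r1 r2 where a: "r = r1 @ a # r2" "tail Q a = v" by (auto dest!: split_list)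
  have "awalk u r1 (awlast u r1)" "awalk (awlast u r1) (a # r2) u"
    using r(2) unfolding a(1) awalk_append_iff by auto
  then have "awalk u r1 v" using a(2) by (simp add: awalk_Cons_iff)
  moreover have "set r1 \<inter> cycle_arcs C = {}"
    using arc_unique_cycle[OF assms(1,2)] assms(3) r(3) unfolding a(1) by auto
  ultimately show ?thesis by (rule awalk_off)
qed

text \<open>An arc off \<open>C\<close> lies on a different cycle, the rest of which leads back
  without meeting an arc of \<open>C\<close>.\<close>

lemma off_sym:
  assumes "C \<in> cycs" "(u, v) \<in> (off C)\<^sup>*"
  shows "(v, u) \<in> (off C)\<^sup>*"
  using assms(2)
proof (induction rule: rtrancl_induct)
  case (step v w)
  then obtain a where a: "a \<in> arcs Q" "a \<notin> cycle_arcs C" "v = tail Q a" "w = head Q a"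
    by (auto simp: off_def)
  obtain C' where C': "C' \<in> cycs" "a \<in> cycle_arcs C'" using arc_on_cycle[OF a(1)] by blast
  have "v \<in> cv C'" "w \<in> cv C'"
    using a C' cycle_facts(5)[OF C'(1)] by (auto simp: cycle_verts_def)
  then have "(w, v) \<in> (off C)\<^sup>*" using cycle_off[OF assms(1) C'(1)] a(2) C'(2) by blast
  then show ?case using step.IH by (rule rtrancl_trans)
qed simp

text \<open>
  A shortest path off \<open>C\<close> between two points of \<open>C\<close>, closed up along \<open>C\<close>, would be a cycle sharing
  two points with \<open>C\<close>.
\<close>

lemma off_cycle_eq:
  assumes C: "C \<in> cycs" and "u \<in> cv C" "v \<in> cv C" "(u, v) \<in> (off C)\<^sup>*"
  shows "u = v"
proof (rule ccontr)
  assume neq: "u \<noteq> v"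
  define good where "good p \<longleftrightarrow> set p \<inter> cycle_arcs C = {} \<and>
    (\<exists>u v. u \<noteq> v \<and> u \<in> cv C \<and> v \<in> cv C \<and> apath u p v)" for p
  obtain p0 where p0: "awalk u p0 v" "set p0 \<inter> cycle_arcs C = {}"
    using off_awalk[OF assms(4)] cycle_facts(2)[OF C] assms(2) by blast
  have "good (awalk_to_apath p0)"
    unfolding good_def using apath_awalk_to_apath[OF p0(1)] awalk_to_apath_subset[OF p0(1)] p0(2) neq assms(2,3)
    by blast
  then obtain p where p: "good p" "\<And>q. good q \<Longrightarrow> length p \<le> length q"
    using ex_has_least_nat[of good "awalk_to_apath p0" length] by blast
  then obtain x y where xy: "x \<noteq> y" "x \<in> cv C" "y \<in> cv C" "apath x p y" and pC: "set p \<inter> cycle_arcs C = {}"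
    unfolding good_def by blast
  have pne: "p \<noteq> []" using xy(1,4) by (auto simp: apath_Nil_iff)
  have wp: "awalk x p y" using xy(4) by (simp add: apath_def)
  \<comment> \<open>By minimality: an inner point of \<open>p\<close> on \<open>C\<close> would cut
    off a shorter path of the same kind.\<close>
  have tails: "tail Q a \<notin> cv C" if a: "p = p1 @ a # p2" "p1 \<noteq> []" for p1 a p2
  proof
    assume w: "tail Q a \<in> cv C"
    have ap: "apath x p1 (awlast x p1)" "apath (awlast x p1) (a # p2) y"
      using xy(4) unfolding a(1) apath_append_iff by auto
    have l: "awlast x p1 = tail Q a" using ap(2) by (simp add: apath_Cons_iff)
    have "x \<noteq> tail Q a" using apath_nonempty_ends[OF ap(1) a(2)] l by simp
    then have "good p1" unfolding good_def using ap(1) l w xy(2) pC a(1) by auto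
    then show False using p(2)[of p1] a(1) by simp
  qed
  obtain r where r: "r \<noteq> []" "awalk y r y" "set r = cycle_arcs C" "distinct (map (tail Q) r)"
    by (rule cycle_from[OF C xy(3)])
  have "x \<in> tail Q ` set r" using xy(2) r(3) by (simp add: cycle_verts_def)
  \<comment> \<open>The list \<open>q\<close> is the section of \<open>C\<close> leading from
    \<open>y\<close> back to \<open>x\<close>; it closes \<open>p\<close> up to the cycle
    \<open>D\<close>.\<close>
  then obtain a q r2 where a: "r = q @ a # r2" "tail Q a = x" by (auto dest!: split_list)
  have "awalk y q (awlast y q)" "awalk (awlast y q) (a # r2) y"
    using r(2) unfolding a(1) awalk_append_iff by auto
  then have wq: "awalk y q x" using a(2) by (simp add: awalk_Cons_iff)
  have qne: "q \<noteq> []" using wq xy(1) by (auto simp: awalk_Nil_iff)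
  have w: "awalk x (p @ q) x" using wp wq by (rule awalk_appendI)
  have cas: "cas x (p @ q) x" using w by auto
  have dist: "distinct (map (tail Q) (p @ q))"
  proof -
    have "distinct (map (tail Q) p)" using xy(4) by (simp add: apath_def awalk_verts_conv pne)
    moreover have "distinct (map (tail Q) q)" using r(4) unfolding a(1) by simp
    moreover have "tail Q b \<noteq> tail Q c" if b: "b \<in> set p" and c: "c \<in> set q" for b c
    proof -
      have cC: "tail Q c \<in> cv C" using c r(3) unfolding a(1) by (auto simp: cycle_verts_def)
      obtain p1 p2 where p12: "p = p1 @ b # p2" using split_list[OF b] by blast
      show ?thesis
      proof (cases "p1 = []")
        case True
        then have "tail Q b = x" using wp p12 by (simp add: awalk_Cons_iff)
        moreover have "tail Q c \<in> tail Q ` set q" using c by blast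
        then have "tail Q c \<noteq> x" using r(4) a(2) unfolding a(1) by auto
        ultimately show ?thesis by simp
      next
        case False
        then show ?thesis using tails[OF p12 False] cC by auto
      qed
    qed
    then have "tail Q ` set p \<inter> tail Q ` set q = {}" by blast
    ultimately show ?thesis by simp
  qed
  have "mset (map (head Q) (p @ q)) = mset (map (tail Q) (p @ q))"
    by (rule closed_heads_tails[OF cas])
  then have "distinct (map (head Q) (p @ q))" using dist mset_eq_imp_distinct_iff by blast
  then have "distinct (tl (awalk_verts x (p @ q)))"
    using awalk_verts_conv'[OF cas] pne by simp
  then have cyc: "cycle (p @ q)" unfolding cycle_def using w pne by blast
  define D where "D = {rotate n (p @ q) | n. True}"
  have D: "D \<in> cycs" unfolding D_def quiver_cycles_def using cyc by blast
  have arcs: "cycle_arcs D = set (p @ q)" unfolding cycle_arcs_def D_def by auto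
  have "D \<noteq> C"
  proof
    assume "D = C"
    then show False using arcs pC pne by (cases p) auto
  qed
  moreover have "x \<in> cv D"
    using wp pne unfolding cycle_verts_def arcs by (cases p) (auto simp: awalk_Cons_iff)
  moreover have "y \<in> cv D"
    using wq qne unfolding cycle_verts_def arcs by (cases q) (auto simp: awalk_Cons_iff)
  ultimately have "x = y" using common_vertex[OF D C] xy(2,3) by blast
  then show False using xy(1) by simp
qed

text \<open>The point \<open>v\<close> separates \<open>C\<close> from whatever hangs on the rest of
  \<open>C'\<close>. A walk off \<open>C'\<close> returning to \<open>C\<close> would meet it at
  \<open>v\<close>, by \<open>off_cycle_eq\<close>, and so join \<open>u\<close> and
  \<open>v\<close> off \<open>C'\<close>, which the same lemma excludes.\<close>

lemma off_other:
  assumes C: "C \<in> cycs" "C' \<in> cycs" "C \<noteq> C'" and v: "v \<in> cv C" "v \<in> cv C'"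
    and u: "u \<in> cv C'" "u \<noteq> v" and w: "(u, w) \<in> (off C')\<^sup>*"
  shows "(v, w) \<in> (off C)\<^sup>* \<and> w \<notin> cv C"
  using w
proof (induction rule: rtrancl_induct)
  case base
  show ?case
    using cycle_off[OF C v(2) u(1)] common_vertex[OF C _ u(1) v] u(2) by blast
next
  case (step w x)
  obtain a where a: "a \<in> arcs Q" "a \<notin> cycle_arcs C'" "w = tail Q a" "x = head Q a"
    using step(2) by (auto simp: off_def)
  have "a \<notin> cycle_arcs C" using step.IH a(3) by (auto simp: cycle_verts_def)
  then have vx: "(v, x) \<in> (off C)\<^sup>*"
    using step.IH a by (auto simp: off_def intro: rtrancl_into_rtrancl)
  moreover have "x \<notin> cv C"
  proof
    assume "x \<in> cv C"
    then have "v = x" using off_cycle_eq[OF C(1) v(1) _ vx] by simp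
    moreover have "(u, x) \<in> (off C')\<^sup>*" using step(1,2) by (rule rtrancl_into_rtrancl)
    ultimately have "u = v" using off_cycle_eq[OF C(2) u(1) v(2)] by simp
    then show False using u(2) by simp
  qed
  ultimately show ?case by blast
qed

lemma cycles_at: "v \<in> verts Q \<Longrightarrow> \<exists>C C'. C \<noteq> C' \<and> {C \<in> cycs. v \<in> cv C} = {C, C'}"
proof -
  assume "v \<in> verts Q"
  then have "\<exists>C C'. {C \<in> cycs. v \<in> cv C} = {C, C'} \<and> C \<noteq> C'"
    using two_cycles unfolding card_2_iff by simp
  then show ?thesis by (elim exE conjE) (intro exI conjI)
qed

definition other :: "'v \<Rightarrow> 'a list set \<Rightarrow> 'a list set"
  where "other v C = (SOME C'. C' \<in> cycs \<and> v \<in> cv C' \<and> C' \<noteq> C)"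

lemma other:
  assumes "C \<in> cycs" "v \<in> cv C"
  shows "other v C \<in> cycs" "v \<in> cv (other v C)" "other v C \<noteq> C"
proof -
  have v: "v \<in> verts Q" using cycle_facts(2)[OF assms(1)] assms(2) by blast
  obtain D D' where D: "D \<noteq> D'" "{C \<in> cycs. v \<in> cv C} = {D, D'}"
    using cycles_at[OF v] by (elim exE conjE)
  then have "D \<in> {C \<in> cycs. v \<in> cv C}" "D' \<in> {C \<in> cycs. v \<in> cv C}" by simp_all
  then have "\<exists>C'. C' \<in> cycs \<and> v \<in> cv C' \<and> C' \<noteq> C"
    using D(1) by (cases "D = C") auto
  from someI_ex[OF this] have "other v C \<in> cycs \<and> v \<in> cv (other v C) \<and> other v C \<noteq> C"
    unfolding other_def .
  then show "other v C \<in> cycs" "v \<in> cv (other v C)" "other v C \<noteq> C" by simp_all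
qed

end

locale rooted_brauer = brauer Q for Q :: "('v, 'a) pre_digraph" +
  fixes x0 :: 'v and C0 :: "'a list set"
  assumes root: "C0 \<in> cycs" "x0 \<in> cv C0"
begin

text \<open>
  Unfolding of the Brauer quiver from the root: each point of the tree is mapped to a vertex and to
  the two cycles through it, of which the first is followed forwards by \<open>Alpha_End\<close> and the second
  backwards by \<open>Beta_End\<close>.
\<close>

definition move :: "bool \<Rightarrow> 'a list set \<Rightarrow> 'v \<Rightarrow> 'v"
  where "move d = (if d then pred else succ)"

primrec unfold_at :: "ped_point \<Rightarrow> 'v \<times> (bool \<Rightarrow> 'a list set)" where
  "unfold_at Omega = (x0, \<lambda>d. if d then other x0 C0 else C0)"
| "unfold_at (Alpha_End x) = (let (v, C) = unfold_at x; w = move False (C False) v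
     in (w, \<lambda>d. if d then other w (C False) else C False))"
| "unfold_at (Beta_End x) = (let (v, C) = unfold_at x; w = move True (C True) v
     in (w, \<lambda>d. if d then C True else other w (C True)))"

definition vt where "vt x = fst (unfold_at x)"
definition cy where "cy d x = snd (unfold_at x) d"

lemma vt_Omega: "vt Omega = x0" "cy False Omega = C0" "cy True Omega = other x0 C0"
  by (simp_all add: vt_def cy_def)

lemma vt_ext: "vt (ext d x) = move d (cy d x) (vt x)"
  by (cases d) (simp_all add: vt_def cy_def Let_def case_prod_beta)

lemma cy_ext: "cy d (ext d x) = cy d x" "cy (\<not> d) (ext d x) = other (vt (ext d x)) (cy d x)"
  by (cases d; simp add: vt_def cy_def Let_def case_prod_beta)+

lemma move_cv: "C \<in> cycs \<Longrightarrow> v \<in> cv C \<Longrightarrow> move d C v \<in> cv C"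
  by (simp add: move_def succ_cv pred(1))

lemma inj_move: "C \<in> cycs \<Longrightarrow> inj_on (move d C) (cv C)"
  using pred(2)[of C] by (auto simp: move_def inj_succ intro: inj_on_inverseI)

lemma cy_vt: "cy d x \<in> cycs \<and> vt x \<in> cv (cy d x) \<and> cy d x \<noteq> cy (\<not> d) x"
proof (induction x arbitrary: d rule: ped_point_induct)
  case Omega
  show ?case using root other[OF root] by (cases d) (auto simp: vt_Omega)
next
  case (ext e x)
  have e: "cy e (ext e x) \<in> cycs" "vt (ext e x) \<in> cv (cy e (ext e x))"
    using ext[of e] by (auto simp: cy_ext vt_ext move_cv)
  note o = other[OF e, folded cy_ext(2)[of e x], unfolded cy_ext(1)]
  show ?case
  proof (cases "d = e")
    case True
    then show ?thesis using e other[OF e] by (simp add: cy_ext)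
  next
    case False
    then have "d = (\<not> e)" by simp
    then show ?thesis using e other[OF e] by (simp add: cy_ext)
  qed
qed

lemmas cy_cycs = cy_vt[THEN conjunct1] and vt_cv = cy_vt[THEN conjunct2, THEN conjunct1]
  and cy_neq = cy_vt[THEN conjunct2, THEN conjunct2]

text \<open>Appending the letter \<open>d\<close> leaves the cycle of direction \<open>d\<close>
  unchanged, so a line of the tree unfolds a single cycle.\<close>

lemma cy_ltop: "cy d (ltop d x) = cy d x"
proof (induction x rule: ped_point_induct)
  case (ext e x)
  show ?case
  proof (cases "e = d")
    case True
    then show ?thesis using ext by (simp add: cy_ext)
  next
    case False
    then have "d = (\<not> e)" by simp
    then show ?thesis by simp
  qed
qed simp

lemma cy_line: "ltop d x = ltop d y \<Longrightarrow> cy d x = cy d y"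
  using cy_ltop by metis

text \<open>The tree is pruned wherever the unfolding would close up a cycle.\<close>

inductive_set pts :: "ped_point set" where
  Omega: "Omega \<in> pts"
| ext: "x \<in> pts \<Longrightarrow> vt (ext d x) \<noteq> vt (ltop d x) \<Longrightarrow> ext d x \<in> pts"

lemma pts_ext_iff: "ext d x \<in> pts \<longleftrightarrow> x \<in> pts \<and> vt (ext d x) \<noteq> vt (ltop d x)"
proof
  assume "ext d x \<in> pts"
  then show "x \<in> pts \<and> vt (ext d x) \<noteq> vt (ltop d x)"
  proof cases
    case Omega
    then show ?thesis by (cases d) simp_all
  next
    case (ext y e)
    then show ?thesis by simp
  qed
qed (auto intro: pts.ext)

text \<open>As \<open>move\<close> is injective on the cycle, a coincidence can be moved back along
  the line until one of the points is the top. The pruning excludes that the vertex of the top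
  recurs, which is why it compares with the top alone.\<close>

lemma line_inj:
  assumes "x \<in> pts" "y \<in> pts" "ltop d x = ltop d y" "vt x = vt y"
  shows "x = y"
  using assms
proof (induction "size x" arbitrary: x y rule: less_induct)
  case less
  have eq: "ltop d x = ltop d y" by fact
  consider "ltop d x = x" "ltop d y = y" | x' where "x = ext d x'" "ltop d y = y"
    | y' where "y = ext d y'" "ltop d x = x" | x' y' where "x = ext d x'" "y = ext d y'"
    using ltop_cases[of d x] ltop_cases[of d y] by blast
  then show ?case
  proof cases
    case 1
    show ?thesis by (rule trans[OF 1(1)[symmetric] trans[OF eq 1(2)]])
  next
    case 2
    then have "vt x \<noteq> vt (ltop d x')" using less.prems(1) pts_ext_iff[of d x'] by simp
    moreover have "ltop d x' = y" using eq 2 by simp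
    ultimately show ?thesis using less.prems(4) by simp
  next
    case 3
    then have "vt y \<noteq> vt (ltop d y')" using less.prems(2) pts_ext_iff[of d y'] by simp
    moreover have "ltop d y' = x" using eq 3 by simp
    ultimately show ?thesis using less.prems(4) by simp
  next
    case 4
    have l: "ltop d x' = ltop d y'" using eq 4 by simp
    have "move d (cy d x') (vt x') = move d (cy d x') (vt y')"
      using less.prems(4) 4 cy_line[OF l] by (simp add: vt_ext)
    then have "vt x' = vt y'"
      using inj_onD[OF inj_move[OF cy_cycs]] vt_cv[of x' d] vt_cv[of y' d] cy_line[OF l] by metis
    then have "x' = y'"
      using less.hyps[of x' y'] less.prems(1,2) 4 l by (simp add: pts_ext_iff)
    then show ?thesis using 4 by simp
  qed
qed

text \<open>The descendant of \<open>x\<close> reached by the word \<open>w\<close>, whose first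
  letter is the one next to \<open>x\<close>.\<close>

definition app :: "bool list \<Rightarrow> ped_point \<Rightarrow> ped_point"
  where "app w x = foldl (\<lambda>y e. ext e y) x w"

lemma app_simps [simp]: "app [] x = x" "app (e # w) x = app w (ext e x)"
  by (simp_all add: app_def)

lemma app_pts: "app w x \<in> pts \<Longrightarrow> x \<in> pts"
proof (induction w arbitrary: x)
  case (Cons e w)
  then have "ext e x \<in> pts" by simp
  then show ?case by (simp add: pts_ext_iff)
qed simp

lemma app_exists: "\<exists>w. x = app w Omega"
proof (induction x rule: ped_point_induct)
  case Omega
  show ?case by (rule exI[of _ "[]"]) simp
next
  case (ext d x)
  then obtain w where "x = app w Omega" by blast
  then have "ext d x = app (w @ [d]) Omega" by (simp add: app_def)
  then show ?case by blast
qed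

text \<open>Whatever grows through \<open>ext d x\<close> is attached, off the cycle
  \<open>cy d x\<close>, to a point \<open>z\<close> of the line strictly beyond \<open>x\<close>.
  Where the word leaves the line, \<open>off_other\<close> passes from the cycle entered to the
  cycle left.\<close>

lemma branch:
  assumes "app w (ext d x) \<in> pts"
  shows "\<exists>z\<in>pts. ltop d z = ltop d x \<and> size x < size z \<and>
    (vt z, vt (app w (ext d x))) \<in> (off (cy d x))\<^sup>*"
  using assms
proof (induction w arbitrary: d x)
  case Nil
  then show ?case by (intro bexI[of _ "ext d x"]) simp_all
next
  case (Cons e w)
  let ?y = "ext d x"
  have y: "?y \<in> pts" by (rule app_pts[OF Cons.prems])
  show ?case
  proof (cases "e = d")
    case True
    then have "app w (ext d ?y) \<in> pts" using Cons.prems by simp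
    from Cons.IH[OF this] True show ?thesis by (auto simp: cy_ext)
  next
    case False
    then have e: "e = (\<not> d)" by simp
    have "app w (ext (\<not> d) ?y) \<in> pts" using Cons.prems e by simp
    from Cons.IH[OF this] obtain z where z: "z \<in> pts" "ltop (\<not> d) z = ltop (\<not> d) ?y" "size ?y < size z"
      "(vt z, vt (app w (ext (\<not> d) ?y))) \<in> (off (cy (\<not> d) ?y))\<^sup>*" by blast
    have zC: "vt z \<in> cv (cy (\<not> d) ?y)" using vt_cv[of z "\<not> d"] cy_line[OF z(2)] by simp
    have "vt z \<noteq> vt ?y" using line_inj[OF z(1) y z(2)] z(3) by auto
    from off_other[OF cy_cycs cy_cycs cy_neq vt_cv vt_cv zC this z(4)]
    have "(vt ?y, vt (app (e # w) ?y)) \<in> (off (cy d x))\<^sup>*"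
      by (simp add: e cy_ext)
    then show ?thesis using y by (intro bexI[of _ ?y]) simp_all
  qed
qed

text \<open>Otherwise \<open>c\<close> and the point \<open>z\<close> supplied by
  \<open>branch\<close>, which have different vertices on the cycle \<open>cy d c\<close>, would be
  joined off that cycle.\<close>

lemma app_neq:
  assumes "app (d # w) c \<in> pts"
  shows "vt c \<noteq> vt (app (d # w) c)"
proof
  assume eq: "vt c = vt (app (d # w) c)"
  have c: "c \<in> pts" by (rule app_pts[OF assms])
  obtain z where z: "z \<in> pts" "ltop d z = ltop d c" "size c < size z" "(vt z, vt c) \<in> (off (cy d c))\<^sup>*"
    using branch[of w d c] assms eq by auto
  have "vt z \<in> cv (cy d c)" using vt_cv[of z d] cy_line[OF z(2)] by simp
  then have "vt z = vt c" using off_cycle_eq[OF cy_cycs _ vt_cv z(4)] by simp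
  then show False using line_inj[OF z(1) c z(2)] z(3) by simp
qed

text \<open>Off \<open>cy d c\<close>, one branch is attached to a point \<open>z\<close> beyond
  \<open>c\<close>, and the other one to \<open>c\<close> itself by \<open>off_other\<close>. A
  common vertex would join \<open>z\<close> and \<open>c\<close> off a cycle containing
  both.\<close>

lemma diverge_neq:
  assumes "app (d # w) c \<in> pts" "app ((\<not> d) # w') c \<in> pts"
  shows "vt (app (d # w) c) \<noteq> vt (app ((\<not> d) # w') c)"
proof
  assume eq: "vt (app (d # w) c) = vt (app ((\<not> d) # w') c)"
  let ?v = "vt (app (d # w) c)"
  have c: "c \<in> pts" by (rule app_pts[OF assms(1)])
  obtain z where z: "z \<in> pts" "ltop d z = ltop d c" "size c < size z" "(vt z, ?v) \<in> (off (cy d c))\<^sup>*"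
    using branch[of w d c] assms(1) by auto
  obtain y where y: "y \<in> pts" "ltop (\<not> d) y = ltop (\<not> d) c" "size c < size y" "(vt y, ?v) \<in> (off (cy (\<not> d) c))\<^sup>*"
    using branch[of w' "\<not> d" c] assms(2) eq by auto
  have yC: "vt y \<in> cv (cy (\<not> d) c)" using vt_cv[of y "\<not> d"] cy_line[OF y(2)] by simp
  have "vt y \<noteq> vt c" using line_inj[OF y(1) c y(2)] y(3) by auto
  from off_other[OF cy_cycs cy_cycs cy_neq vt_cv vt_cv yC this y(4)]
  have "(vt c, ?v) \<in> (off (cy d c))\<^sup>*" by simp
  then have "(vt z, vt c) \<in> (off (cy d c))\<^sup>*"
    using rtrancl_trans[OF z(4) off_sym[OF cy_cycs]] by blast
  moreover have "vt z \<in> cv (cy d c)" using vt_cv[of z d] cy_line[OF z(2)] by simp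
  ultimately have "vt z = vt c" using off_cycle_eq[OF cy_cycs _ vt_cv] by blast
  then show False using line_inj[OF z(1) c z(2)] z(3) by simp
qed

lemma app_inj: "app w c \<in> pts \<Longrightarrow> app w' c \<in> pts \<Longrightarrow> vt (app w c) = vt (app w' c) \<Longrightarrow> w = w'"
proof (induction w arbitrary: c w')
  case Nil
  then show ?case using app_neq[of "hd w'" "tl w'" c] by (cases w') auto
next
  case (Cons d w)
  show ?case
  proof (cases w')
    case Nil
    then show ?thesis using Cons.prems app_neq[OF Cons.prems(1)] by simp
  next
    case (Cons e u)
    show ?thesis
    proof (cases "d = e")
      case True
      then show ?thesis using Cons.IH[of "ext d c" u] Cons.prems Cons by simp
    next
      case False
      then have "e = (\<not> d)" by simp
      then show ?thesis using diverge_neq[of d w c u] Cons.prems Cons by simp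
    qed
  qed
qed

lemma inj_vt: "inj_on vt pts"
proof (rule inj_onI)
  fix x y assume xy: "x \<in> pts" "y \<in> pts" "vt x = vt y"
  obtain w w' where "x = app w Omega" "y = app w' Omega" using app_exists by metis
  then show "x = y" using app_inj[of w Omega w'] xy by simp
qed

lemma vt_verts: "vt x \<in> verts Q"
  using vt_cv[of x False] cycle_facts(2)[OF cy_cycs[of False x]] by blast

lemma ped_set_pts: "ped_set pts"
proof
  show "finite pts"
    by (rule inj_on_finite[OF inj_vt, of "verts Q"]) (auto simp: vt_verts)
qed (auto intro: pts.Omega simp: pts_ext_iff)

section \<open>The unfolding reaches each vertex and each arrow\<close>

interpretation ped_set pts by (rule ped_set_pts)

text \<open>Pruning happens exactly where the next vertex of the cycle is that of the top, so
  \<open>down\<close> also agrees with \<open>move\<close> at the closing step.\<close>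

lemma vt_down: "y \<in> pts \<Longrightarrow> vt (down d y) = move d (cy d y) (vt y)"
  using pts_ext_iff[of d y] vt_ext[of d y] by (auto simp: down_def)

lemma vt_nxt: "y \<in> pts \<Longrightarrow> vt (nxt d y) = succ (cy d y) (vt y)"
proof (cases d)
  case True
  assume y: "y \<in> pts"
  let ?x = "nxt True y"
  have x: "?x \<in> pts" "down True ?x = y" using nxt_True[OF y] by auto
  have l: "cy True ?x = cy True y" using cy_line[OF ltop_nxt[OF y, of True]] .
  have "vt y = pred (cy True y) (vt ?x)" using vt_down[OF x(1), of True] x(2) l by (simp add: move_def)
  then show ?thesis using pred(2)[OF cy_cycs, of "vt ?x" True y] vt_cv[of ?x True] l True by simp
next
  case False
  assume "y \<in> pts"
  then show ?thesis using vt_down[of y False] False by (simp add: nxt_def move_def)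
qed

definition arr :: "bool \<Rightarrow> ped_point \<Rightarrow> 'a"
  where "arr d x = out (cy d x) (vt x)"

lemma arr: "arr d x \<in> cycle_arcs (cy d x)" "tail Q (arr d x) = vt x" "arr d x \<in> arcs Q"
  using out[OF vt_cv, of d x] cycle_facts(1)[OF cy_cycs, of d x] by (auto simp: arr_def)

lemma head_arr: "x \<in> pts \<Longrightarrow> head Q (arr d x) = vt (nxt d x)"
  by (simp add: vt_nxt succ_def arr_def)

lemma cycles_vt:
  assumes "C \<in> cycs" "vt x \<in> cv C"
  shows "\<exists>d. C = cy d x"
proof -
  obtain D D' where D: "D \<noteq> D'" "{C \<in> cycs. vt x \<in> cv C} = {D, D'}"
    using cycles_at[OF vt_verts, of x] by (elim exE conjE)
  have "cy False x \<in> {D, D'}" "cy True x \<in> {D, D'}" "C \<in> {D, D'}"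
    using cy_cycs vt_cv assms unfolding D(2)[symmetric] by simp_all
  then have "C = cy False x \<or> C = cy True x" using cy_neq[of False x] by auto
  then show ?thesis by blast
qed

lemma arcs_vt:
  assumes "x \<in> pts" "a \<in> arcs Q" "tail Q a = vt x"
  shows "\<exists>d. a = arr d x"
proof -
  obtain C where C: "C \<in> cycs" "a \<in> cycle_arcs C" using arc_on_cycle[OF assms(2)] by blast
  have "vt x \<in> cv C"
    using imageI[OF C(2), of "tail Q"] unfolding cycle_verts_def assms(3) .
  then obtain d where "C = cy d x" using cycles_vt[OF C(1)] by blast
  then have "a = arr d x" using out_eq[OF C] assms(3) by (simp add: arr_def)
  then show ?thesis by blast
qed

lemma nxt_image: "nxt d ` pts = pts"
  by (rule endo_inj_surj) (auto simp: nxt_P inj_nxt)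

text \<open>The image is saturated under arrows: an arrow at a vertex of the image lies on one of
  the two cycles there, and both are unfolded by the lines through the corresponding point.\<close>

lemma vt_image: "vt ` pts = verts Q"
proof
  show "vt ` pts \<subseteq> verts Q" by (auto simp: vt_verts)
  show "verts Q \<subseteq> vt ` pts"
  proof (rule connected_closed_subset)
    show "Digraph_Component.connected Q" using brauer by (simp add: brauer_quiver_def)
    show "vt Omega \<in> verts Q" by (rule vt_verts)
    show "vt Omega \<in> vt ` pts" by (simp add: pts.Omega)
    fix a assume a: "a \<in> arcs Q"
    show "tail Q a \<in> vt ` pts \<longleftrightarrow> head Q a \<in> vt ` pts"
    proof
      assume "tail Q a \<in> vt ` pts"
      then obtain x where x: "x \<in> pts" "tail Q a = vt x" by auto
      then obtain d where "a = arr d x" using arcs_vt[OF x(1) a] by blast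
      then show "head Q a \<in> vt ` pts" using x(1) by (simp add: head_arr nxt_P)
    next
      assume "head Q a \<in> vt ` pts"
      then obtain y where y: "y \<in> pts" "head Q a = vt y" by auto
      obtain C where C: "C \<in> cycs" "a \<in> cycle_arcs C" using arc_on_cycle[OF a] by blast
      have "vt y \<in> cv C"
        using imageI[OF C(2), of "head Q"] unfolding cycle_facts(5)[OF C(1)] y(2) .
      then obtain d where d: "C = cy d y" using cycles_vt[OF C(1)] by blast
      \<comment> \<open>The arrow leaving the preceding point of this line has the same head as
        \<open>a\<close> and lies on the same cycle, where heads are distinct.\<close>
      obtain x where x: "x \<in> pts" "nxt d x = y" using y(1) nxt_image[of d] by (metis imageE)
      have l: "cy d x = cy d y" using cy_line[OF ltop_nxt[OF x(1), of d]] x(2) by simp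
      have "head Q (arr d x) = head Q a" using head_arr[OF x(1)] x(2) y(2) by simp
      then have "a = arr d x"
        using inj_onD[OF cycle_facts(4)[OF C(1)], of a "arr d x"] C(2) arr(1)[of d x] l d by simp
      then show "tail Q a \<in> vt ` pts" using x(1) arr(2) by simp
    qed
  qed
qed

theorem brauer_lines: "brauer_lines pts Q vt arr"
proof (intro brauer_lines.intro line_quiver.intro line_quiver_axioms.intro)
  show "ped_set pts" by (rule ped_set_pts)
  show "bij_betw vt pts (verts Q)" using inj_vt vt_image by (simp add: bij_betw_def)
  show "bij_betw (\<lambda>(d, x). arr d x) (UNIV \<times> pts) (arcs Q)"
    unfolding bij_betw_def
  proof
    show "inj_on (\<lambda>(d, x). arr d x) (UNIV \<times> pts)"
    proof (rule inj_onI)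
      fix s t assume st: "s \<in> UNIV \<times> pts" "t \<in> UNIV \<times> pts" "(\<lambda>(d, x). arr d x) s = (\<lambda>(d, x). arr d x) t"
      obtain d x e y where s: "s = (d, x)" "t = (e, y)" by (cases s; cases t)
      have eq: "arr d x = arr e y" and P: "x \<in> pts" "y \<in> pts" using st s by simp_all
      have "vt x = vt y" using arr(2)[of d x] arr(2)[of e y] eq by simp
      then have xy: "x = y" using inj_onD[OF inj_vt] P by blast
      have "cy d x = cy e x"
        using arc_unique_cycle[OF cy_cycs cy_cycs arr(1)[of d x], of e x] arr(1)[of e y] eq xy by simp
      then have "d = e" using cy_neq[of d x] by (cases "e = (\<not> d)") auto
      then show "s = t" using s xy by simp
    qed
    show "(\<lambda>(d, x). arr d x) ` (UNIV \<times> pts) = arcs Q"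
    proof
      show "arcs Q \<subseteq> (\<lambda>(d, x). arr d x) ` (UNIV \<times> pts)"
      proof
        fix a assume a: "a \<in> arcs Q"
        then have "tail Q a \<in> vt ` pts" using vt_image by simp
        then obtain x where x: "x \<in> pts" "tail Q a = vt x" by auto
        obtain d where "a = arr d x" using arcs_vt[OF x(1) a x(2)] by blast
        then have "a = (\<lambda>(d, x). arr d x) (d, x)" by simp
        then show "a \<in> (\<lambda>(d, x). arr d x) ` (UNIV \<times> pts)" using x(1) by blast
      qed
    qed (auto simp: arr(3))
  qed
  show "partial_monoid (ped_set.basis pts) (ped_set.idems pts) (ped_set.pmul pts)"
    by (rule basis_monoid)
qed (auto simp: arr(2) head_arr step_basis)

end

section \<open>Trivial extensions of pedigree algebras\<close>

lemma mono_alg_smult_closed: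
  "x \<in> carrier (mono_alg M E mul) \<Longrightarrow> c \<odot>\<^bsub>mono_alg M E mul\<^esub> x \<in> carrier (mono_alg M E mul)"
  using keys_map_mult_subset[of c x] by auto

text \<open>The table on \<open>basis\<close> is the middle term: its algebra is the trivial
  extension of the algebra on \<open>paths\<close>, and it is also the Brauer-quiver
  algebra.\<close>

theorem (in brauer_lines) trivial_extension_brauer_algebra:
  defines "K \<equiv> TYPE('k::field)"
  shows "alg_isomorphic (trivial_extension (pedigree_algebra K (pedigree_of P))) (brauer_algebra K Q)"
    and "alg_isomorphic (brauer_algebra K Q) (trivial_extension (pedigree_algebra K (pedigree_of P)))"
proof -
  let ?A = "pedigree_algebra TYPE('k) (pedigree_of P)"
  let ?N = "mono_alg paths idems pmul :: ('k, _) module" and ?M = "mono_alg basis idems pmul :: ('k, _) module"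
  have N: "ring ?N" by (rule partial_monoid.ring_mono_alg[OF paths_monoid])
  have M: "ring ?M" by (rule partial_monoid.ring_mono_alg[OF basis_monoid])
  note A = pedigree_algebra_isomorphic[where 'k = 'k]
  note B = brauer_algebra_isomorphic[where 'k = 'k]
  have AN: "alg_isomorphic (trivial_extension ?A) (trivial_extension ?N)"
    by (rule trivial_extension_isomorphic[OF A(1) A(3) N A(2) mono_alg_smult_closed])
  have NA: "alg_isomorphic (trivial_extension ?N) (trivial_extension ?A)"
    by (rule trivial_extension_isomorphic[OF alg_isomorphic_sym[OF A(1) A(3) A(2)] N A(3)
          mono_alg_smult_closed A(2)])
  have MN: "alg_isomorphic ?M (trivial_extension ?N)"
    by (rule symmetric_monoid.trivial_extension_mono_alg[OF basis_symmetric])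
  have NM: "alg_isomorphic (trivial_extension ?N) ?M"
    by (rule alg_isomorphic_sym[OF MN M mono_alg_smult_closed])
  have MB: "alg_isomorphic ?M (brauer_algebra TYPE('k) Q)"
    by (rule alg_isomorphic_sym[OF B(1) B(3) B(2)])
  show "alg_isomorphic (trivial_extension (pedigree_algebra K (pedigree_of P))) (brauer_algebra K Q)"
    unfolding K_def by (rule alg_isomorphic_trans[OF AN alg_isomorphic_trans[OF NM MB]])
  show "alg_isomorphic (brauer_algebra K Q) (trivial_extension (pedigree_algebra K (pedigree_of P)))"
    unfolding K_def by (rule alg_isomorphic_trans[OF B(1) alg_isomorphic_trans[OF MN NA]])
qed

section \<open>Pedigrees as prefix-closed sets\<close>

lemma ped_leaves_eq: "ped_leaves m = {x. size x = m}"
proof (induction m)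
  case 0
  have "size x = 0 \<longleftrightarrow> x = Omega" for x :: ped_point by (cases x) simp_all
  then show ?case by simp
next
  case (Suc m)
  show ?case
  proof (rule Set.set_eqI)
    fix x show "x \<in> ped_leaves (Suc m) \<longleftrightarrow> x \<in> {x. size x = Suc m}"
      using Suc by (cases x) auto
  qed
qed

lemma ped_tree_simps:
  "verts (ped_tree m) = {x. size x \<le> m}"
  "Alpha x \<in> arcs (ped_tree m) \<longleftrightarrow> size x < m" "Beta x \<in> arcs (ped_tree m) \<longleftrightarrow> size x < m"
  "tail (ped_tree m) = ped_tail" "head (ped_tree m) = ped_head"
proof -
  show "verts (ped_tree m) = {x. size x \<le> m}"
  proof (induction m)
    case 0
    show ?case using ped_leaves_eq[of 0] by auto
  next
    case (Suc m)
    then have "verts (ped_tree (Suc m)) = {x. size x \<le> m} \<union> ped_leaves (Suc m)" by simp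
    then show ?case unfolding ped_leaves_eq by auto
  qed
  show "Alpha x \<in> arcs (ped_tree m) \<longleftrightarrow> size x < m"
    by (induction m) (auto simp: ped_leaves_eq)
  show "Beta x \<in> arcs (ped_tree m) \<longleftrightarrow> size x < m"
    by (induction m) (auto simp: ped_leaves_eq)
  show "tail (ped_tree m) = ped_tail" "head (ped_tree m) = ped_head"
    by (cases m; simp)+
qed

lemma finite_ped_tree: "finite (verts (ped_tree m))"
proof -
  have "finite (ped_leaves n)" for n by (induction n) simp_all
  then show ?thesis by (induction m) simp_all
qed

lemma wf_ped_tree: "wf_digraph (ped_tree m)"
proof
  fix e assume "e \<in> arcs (ped_tree m)"
  then show "tail (ped_tree m) e \<in> verts (ped_tree m)" "head (ped_tree m) e \<in> verts (ped_tree m)"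
    by (cases e; simp add: ped_tree_simps)+
qed

lemma (in ped_set) pedigree_pedigree_of: "pedigree (pedigree_of P)"
  unfolding pedigree_def
proof (intro conjI)
  have "\<exists>m. \<forall>k\<in>size ` P. k \<le> m"
    unfolding finite_nat_set_iff_bounded_le[symmetric] by simp
  then obtain m where m: "\<And>x. x \<in> P \<Longrightarrow> size x \<le> m" by auto
  have arcs: "arcs L \<subseteq> arcs (ped_tree m)"
  proof
    fix a assume a: "a \<in> arcs L"
    show "a \<in> arcs (ped_tree m)"
    proof (cases a)
      case (Alpha x)
      then have "size (Alpha_End x) \<le> m" using a m[of "Alpha_End x"] by simp
      then show ?thesis using Alpha by (simp add: ped_tree_simps)
    next
      case (Beta x)
      then have "size (Beta_End x) \<le> m" using a m[of "Beta_End x"] by simp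
      then show ?thesis using Beta by (simp add: ped_tree_simps)
    qed
  qed
  have "subgraph L (ped_tree m)"
    unfolding subgraph_def compatible_def
    using arcs m wf_ped_tree ped.wf_digraph_axioms by (simp add: ped_tree_simps subset_iff)
  then show "\<exists>m. subgraph L (ped_tree m)" by blast
  show "Digraph_Component.connected L"
  proof (rule connectedI_closed_subset)
    show "wf_digraph L" by (rule ped.wf_digraph_axioms)
    show "Omega \<in> verts L" by simp
    fix S assume S: "Omega \<in> S" "\<And>a. a \<in> arcs L \<Longrightarrow> tail L a \<in> S \<longleftrightarrow> head L a \<in> S"
    have "x \<in> S" if "x \<in> P" for x
      using that
    proof (induction x rule: ped_point_induct)
      case (ext d x)
      then have "x \<in> S" using ext_P by blast
      then show ?case
        using S(2)[of "Alpha x"] S(2)[of "Beta x"] ext.prems by (cases d) auto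
    qed (rule S(1))
    then show "verts L \<subseteq> S" by auto
  qed
  show "Omega \<in> verts L" by simp
qed

text \<open>The first argument is a prefix of the second; with the first one fixed, this describes
  the subtree growing from it.\<close>

fun below :: "ped_point \<Rightarrow> ped_point \<Rightarrow> bool" where
  "below y Omega = (y = Omega)"
| "below y (Alpha_End x) = (y = Alpha_End x \<or> below y x)"
| "below y (Beta_End x) = (y = Beta_End x \<or> below y x)"

lemma below_refl: "below y y"
  by (cases y) simp_all

text \<open>The subtree growing from \<open>ext d x\<close> is joined to the rest only by the arrow
  between \<open>x\<close> and \<open>ext d x\<close>; without that arrow it would be cut off from
  the root.\<close>

lemma pedigree_arc:
  assumes "pedigree L" "ext d x \<in> verts L"
  shows "(if d then Beta x else Alpha x) \<in> arcs L"
proof (rule ccontr)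
  assume no: "(if d then Beta x else Alpha x) \<notin> arcs L"
  obtain m where sub: "subgraph L (ped_tree m)" and con: "Digraph_Component.connected L" and om: "Omega \<in> verts L"
    using assms by (auto simp: pedigree_def)
  have th: "tail L = ped_tail" "head L = ped_head"
    using sub by (simp_all add: subgraph_def compatible_def ped_tree_simps)
  have "verts L \<subseteq> {z. \<not> below (ext d x) z}"
  proof (rule connected_closed_subset[OF con om])
    show "Omega \<in> {z. \<not> below (ext d x) z}" by (cases d) simp_all
    fix a assume "a \<in> arcs L"
    then show "tail L a \<in> {z. \<not> below (ext d x) z} \<longleftrightarrow> head L a \<in> {z. \<not> below (ext d x) z}"
      using no by (cases a; cases d) (auto simp: th)
  qed
  then show False using assms(2) below_refl by auto
qed

lemma pedigree_eq_pedigree_of: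
  fixes L :: "(ped_point, ped_arrow) pre_digraph"
  assumes "pedigree L"
  shows "ped_set (verts L)" "L = pedigree_of (verts L)"
proof -
  obtain m where sub: "subgraph L (ped_tree m)" and om: "Omega \<in> verts L"
    using assms by (auto simp: pedigree_def)
  have th: "tail L = ped_tail" "head L = ped_head"
    using sub by (simp_all add: subgraph_def compatible_def ped_tree_simps)
  have wf: "wf_digraph L" using sub by (simp add: subgraph_def)
  have ends: "ped_tail a \<in> verts L" "ped_head a \<in> verts L" if "a \<in> arcs L" for a
    using wf_digraph.tail_in_verts[OF wf that] wf_digraph.head_in_verts[OF wf that] th by simp_all
  show "ped_set (verts L)"
  proof
    have "verts L \<subseteq> verts (ped_tree m)" using sub by (simp add: subgraph_def)
    then show "finite (verts L)" by (rule finite_subset) (rule finite_ped_tree)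
  next
    fix d x assume "ext d x \<in> verts L"
    then show "x \<in> verts L"
      using pedigree_arc[OF assms, of d x] ends[of "Alpha x"] ends[of "Beta x"] by (cases d) auto
  qed (rule om)
  have "arcs L = {Alpha x | x. Alpha_End x \<in> verts L} \<union> {Beta x | x. Beta_End x \<in> verts L}"
  proof (rule Set.set_eqI)
    fix a show "a \<in> arcs L \<longleftrightarrow>
        a \<in> {Alpha x | x. Alpha_End x \<in> verts L} \<union> {Beta x | x. Beta_End x \<in> verts L}"
      using ends[of a] pedigree_arc[OF assms, of False] pedigree_arc[OF assms, of True]
      by (cases a) auto
  qed
  then show "L = pedigree_of (verts L)"
    using th by (simp add: pedigree_of_def)
qed

lemma (in ped_set) brauer_lines_exists:
  "\<exists>(Q :: (nat, nat) pre_digraph) \<phi> arr. brauer_lines P Q \<phi> arr"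
proof -
  obtain f :: "ped_point \<Rightarrow> nat" where f: "inj_on f P"
    using finite_imp_inj_to_nat_seg[OF finite_P] by blast
  \<comment> \<open>Arrows are coded by numbers: halving gives back the code of the tail, and the
    parity gives the direction.\<close>
  define arr where "arr d x = 2 * f x + (if d then 1 else 0)" for d x
  define Q where "Q = \<lparr>verts = f ` P, arcs = (\<lambda>(d, x). arr d x) ` (UNIV \<times> P),
    tail = (\<lambda>n. n div 2), head = (\<lambda>n. f (nxt (odd n) (inv_into P f (n div 2))))\<rparr>"
  have arr: "arr d x div 2 = f x" "odd (arr d x) = d" for d x
    by (cases d; simp add: arr_def)+
  have "brauer_lines P Q f arr"
  proof (intro brauer_lines.intro line_quiver.intro line_quiver_axioms.intro)
    show "ped_set P" by (rule ped_set_axioms)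
    show "bij_betw f P (verts Q)" using f by (simp add: Q_def bij_betw_def)
    have "inj_on (\<lambda>(d, x). arr d x) (UNIV \<times> P)"
    proof (rule inj_onI)
      fix s t assume st: "s \<in> UNIV \<times> P" "t \<in> UNIV \<times> P" "(\<lambda>(d, x). arr d x) s = (\<lambda>(d, x). arr d x) t"
      obtain d x e y where s: "s = (d, x)" "t = (e, y)" by (cases s; cases t)
      then have eq: "arr d x = arr e y" using st(3) by simp
      have "f x = f y" using arr(1)[of d x] arr(1)[of e y] eq by simp
      moreover have "d = e" using arr(2)[of d x] arr(2)[of e y] eq by simp
      ultimately show "s = t" using st s inj_onD[OF f, of x y] by simp
    qed
    then show "bij_betw (\<lambda>(d, x). arr d x) (UNIV \<times> P) (arcs Q)"
      by (simp add: Q_def bij_betw_def)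
    show "partial_monoid basis idems pmul" by (rule basis_monoid)
    fix d :: bool and x assume "(d, x) \<in> UNIV \<times> P"
    then show x: "x \<in> P" by simp
    show "tail Q (arr d x) = f x" by (simp add: Q_def arr)
    show "head Q (arr d x) = f (nxt d x)" using x f by (simp add: Q_def arr)
    show "step d x \<in> basis" by (rule step_basis[OF x])
  qed simp
  then show ?thesis by blast
qed

theorem theorem17:
  shows "(\<forall>L. pedigree L \<and> card (verts L) \<ge> 2 \<longrightarrow>
      (\<exists>Q :: (nat, nat) pre_digraph. brauer_quiver Q \<and>
        alg_isomorphic (trivial_extension (pedigree_algebra TYPE('k::alg_closed_field) L))
          (brauer_algebra TYPE('k) Q))) \<and>
    (\<forall>Q :: ('v, 'a) pre_digraph. brauer_quiver Q \<and> card (verts Q) \<ge> 2 \<longrightarrow>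
      (\<exists>L. pedigree L \<and>
        alg_isomorphic (brauer_algebra TYPE('k) Q)
          (trivial_extension (pedigree_algebra TYPE('k) L))))"
proof (intro conjI allI impI)
  fix L assume "pedigree L \<and> card (verts L) \<ge> 2"
  then have L: "ped_set (verts L)" "L = pedigree_of (verts L)"
    using pedigree_eq_pedigree_of by blast+
  obtain Q :: "(nat, nat) pre_digraph" and \<phi> arr where Q: "brauer_lines (verts L) Q \<phi> arr"
    using ped_set.brauer_lines_exists[OF L(1)] by blast
  have "alg_isomorphic (trivial_extension (pedigree_algebra TYPE('k) L)) (brauer_algebra TYPE('k) Q)"
    using brauer_lines.trivial_extension_brauer_algebra(1)[OF Q, where 'k = 'k] L(2) by simp
  then show "\<exists>Q :: (nat, nat) pre_digraph. brauer_quiver Q \<and>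
      alg_isomorphic (trivial_extension (pedigree_algebra TYPE('k) L)) (brauer_algebra TYPE('k) Q)"
    using brauer_lines.brauer_quiver[OF Q] by blast
next
  fix Q :: "('v, 'a) pre_digraph" assume "brauer_quiver Q \<and> card (verts Q) \<ge> 2"
  then interpret brauer Q by unfold_locales simp
  obtain x0 where x0: "x0 \<in> verts Q"
    using brauer by (auto simp: brauer_quiver_def connected_conv)
  \<comment> \<open>Any vertex may serve as the root, and either of its two cycles as the line of
    arrows \<alpha> through it.\<close>
  obtain C0 C' where "{C \<in> cycs. x0 \<in> cv C} = {C0, C'}"
    using cycles_at[OF x0] by (elim exE conjE)
  then have "C0 \<in> {C \<in> cycs. x0 \<in> cv C}" by simp
  then have "C0 \<in> cycs" "x0 \<in> cv C0" by simp_all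
  then interpret rooted_brauer Q x0 C0 by unfold_locales
  have "pedigree (pedigree_of pts)"
    by (rule ped_set.pedigree_pedigree_of[OF ped_set_pts])
  moreover have "alg_isomorphic (brauer_algebra TYPE('k) Q)
      (trivial_extension (pedigree_algebra TYPE('k) (pedigree_of pts)))"
    by (rule brauer_lines.trivial_extension_brauer_algebra(2)[OF brauer_lines])
  ultimately show "\<exists>L. pedigree L \<and>
      alg_isomorphic (brauer_algebra TYPE('k) Q) (trivial_extension (pedigree_algebra TYPE('k) L))"
    by blast
qed

end
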